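(* Let $p$ denote a random variable with the common law of the $p_j$, and let $b=\operatorname{ess\,sup}_{\mathbb P}p$ denote the maximal probability. The limits $\Psi_{\rightarrow}$ and $\Psi_{\uparrow}$ are as follows for $x,y\in(0,\infty)$. (1) $$\Psi_{\rightarrow}(x,y)=\begin{cases} bx+y(1-b)\,\mathbb E\Bigl[\dfrac{p}{b-p}\Bigr], & \dfrac xy\ge \mathbb E\Bigl[\dfrac{p(1-p)}{(b-p)^2}\Bigr],\\[8pt] y z_0^2\,\mathbb E\Bigl[\dfrac{1-p}{(z_0-p)^2}\Bigr]-y, & \mathbb E\Bigl[\dfrac{p}{1-p}\Bigr]<\dfrac xy<\mathbb E\Bigl[\dfrac{p(1-p)}{(b-p)^2}\Bigr],\\[8pt] x, & 0<\dfrac xy\le \mathbb E\Bigl[\dfrac{p}{1-p}\Bigr],\end{cases}$$ with $z_0\in(b,1)$ uniquely defined by the equation $\dfrac xy=\mathbb E\Bigl[\dfrac{p(1-p)}{(z_0-p)^2}\Bigr]$. (2) $$\Psi_{\uparrow}(x,y)=\begin{cases} y-y z_0^2\,\mathbb E\Bigl[\dfrac{1-p}{(z_0+p)^2}\Bigr], & 0<\dfrac xy<\mathbb E\Bigl[\dfrac{1-p}{p}\Bigr],\\[8pt] y, & \dfrac xy\ge\mathbb E\Bigl[\dfrac{1-p}{p}\Bigr],\end{cases}$$ with $z_0\in(0,\infty)$ uniquely defined by the equation $\dfrac xy=\mathbb E\Bigl[\dfrac{p(1-p)}{(z_0+p)^2}\Bigr]$.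
   Context: The environment is an i.i.d. sequence $\{p_j\}_{j\in\mathbb Z_+}$ of random numbers $p_j\in[0,1]$ with distribution $\mathbb P$ and expectation $\mathbb E$, where $\mathbb Z_+=\{0,1,2,\dots\}$. Given $\{p_j\}$, the weights $\{X(i,j):(i,j)\in\mathbb Z_+^2\}$ are independent with $P(X(i,j)=1)=p_j=1-P(X(i,j)=0)$. $T_{\rightarrow}(k,\ell)$ is the maximum of $\sum_{z\in\pi}X(z)$ over all $\pi=\{(0,y_0),(1,y_1),\dots,(k-1,y_{k-1})\}$ with integers $0\le y_0\le y_1\le\dots\le y_{k-1}\le\ell$; and $T_{\uparrow}(k,\ell)$ is the maximum of $\sum_{z\in\pi}X(z)$ over all $\pi=\{(x_0,0),(x_1,1),\dots,(x_{\ell-1},\ell-1)\}$ with integers $0\le x_0\le x_1\le\dots\le x_{\ell-1}\le k$. The almost sure limits are $$\Psi_{\rightarrow}(x,y)=\lim_{n\to\infty}\tfrac1nT_{\rightarrow}(\lfloor nx\rfloor,\lfloor ny\rfloor),\qquad \Psi_{\uparrow}(x,y)=\lim_{n\to\infty}\tfrac1nT_{\uparrow}(\lfloor nx\rfloor,\lfloor ny\rfloor),\quad (x,y)\in(0,\infty)^2.$$ Here $\operatorname{ess\,sup}_{\mathbb P}f=\inf\{s\in\mathbb R:\mathbb P(f>s)=0\}$. The formulas are proved for $b<1$; results for the case $b=1$ follow by taking a limit.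
   Formalization: In (2), first case, if P(p=0)>0 the formal statement also requires x/y < E[(1-p)/p; p>0]; otherwise no z_0 in (0,∞) solves the equation (e.g. p uniform on {0,1/2}, x/y ≥ 1/2), so the stated formula is undefined. *)

theory Defs
  imports "HOL-Probability.Probability"
begin

text \<open>
  A strictly increasing coordinate makes the points of an admissible path distinct, so a path is
  given by its other coordinate, a nondecreasing function that is extensional outside its domain;
  hence the maxima range over finite nonempty sets.
\<close>

definition T_right :: "(nat \<times> nat \<Rightarrow> real) \<Rightarrow> nat \<Rightarrow> nat \<Rightarrow> real" where
  "T_right w k l =
     Max ((\<lambda>y. \<Sum>i<k. w (i, y i)) ` {y \<in> {..<k} \<rightarrow>\<^sub>E {..l}. mono_on {..<k} y})"

definition T_up :: "(nat \<times> nat \<Rightarrow> real) \<Rightarrow> nat \<Rightarrow> nat \<Rightarrow> real" where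
  "T_up w k l =
     Max ((\<lambda>x. \<Sum>j<l. w (x j, j)) ` {x \<in> {..<l} \<rightarrow>\<^sub>E {..k}. mono_on {..<l} x})"

text \<open>
  \<open>p j\<close> is the success probability of row \<open>j\<close>, with law \<open>\<mu>\<close>. The last assumption says that,
  conditionally on the \<open>\<sigma>\<close>-algebra generated by the environment, the weights are independent and
  \<open>X (i, j)\<close> takes the values 1 and 0 with probabilities \<open>p j\<close> and \<open>1 - p j\<close>.
\<close>

locale bernoulli_environment = prob_space M
  for M :: "'w measure"
    and \<mu> :: "real measure"
    and p :: "nat \<Rightarrow> 'w \<Rightarrow> real"
    and X :: "nat \<times> nat \<Rightarrow> 'w \<Rightarrow> real" +
  assumes p_indep: "indep_vars (\<lambda>_. borel) p UNIV"
    and p_law: "distr M borel (p j) = \<mu>"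
    and p_range: "\<omega> \<in> space M \<Longrightarrow> p j \<omega> \<in> {0..1}"
    and X_measurable: "X z \<in> borel_measurable M"
    and X_conditional_law:
      "finite F \<Longrightarrow>
       AE \<omega> in M.
         real_cond_exp M
           (vimage_algebra (space M) (\<lambda>\<omega> j. p j \<omega>) (\<Pi>\<^sub>M j\<in>UNIV. borel))
           (indicator {\<omega> \<in> space M. \<forall>z\<in>F. X z \<omega> = of_bool (a z)}) \<omega> =
         (\<Prod>z\<in>F. if a z then p (snd z) \<omega> else 1 - p (snd z) \<omega>)"
begin

lemma environment_subalgebra:
  "subalgebra M (vimage_algebra (space M) (\<lambda>\<omega> j. p j \<omega>) (\<Pi>\<^sub>M j\<in>UNIV. borel))"
proof -
  have "p j \<in> borel_measurable M" for j
    using p_indep by (simp add: indep_vars_def)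
  then have "(\<lambda>\<omega> j. p j \<omega>) \<in> M \<rightarrow>\<^sub>M (\<Pi>\<^sub>M j\<in>UNIV. borel)"
    by (intro measurable_PiM_single') auto
  then show ?thesis
    unfolding subalgebra_def
    by (auto simp: sets_vimage_algebra2[of _ "space M" "\<Pi>\<^sub>M j\<in>UNIV. borel"] space_PiM
        intro: measurable_sets)
qed

end

definition Psi_right_is ::
  "'w measure \<Rightarrow> (nat \<times> nat \<Rightarrow> 'w \<Rightarrow> real) \<Rightarrow> real \<Rightarrow> real \<Rightarrow> real \<Rightarrow> bool" where
  "Psi_right_is M X x y L \<longleftrightarrow>
     (AE \<omega> in M. (\<lambda>n. T_right (\<lambda>z. X z \<omega>) (nat \<lfloor>real n * x\<rfloor>) (nat \<lfloor>real n * y\<rfloor>) / real n)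
        \<longlonglongrightarrow> L)"

definition Psi_up_is ::
  "'w measure \<Rightarrow> (nat \<times> nat \<Rightarrow> 'w \<Rightarrow> real) \<Rightarrow> real \<Rightarrow> real \<Rightarrow> real \<Rightarrow> bool" where
  "Psi_up_is M X x y L \<longleftrightarrow>
     (AE \<omega> in M. (\<lambda>n. T_up (\<lambda>z. X z \<omega>) (nat \<lfloor>real n * x\<rfloor>) (nat \<lfloor>real n * y\<rfloor>) / real n)
        \<longlonglongrightarrow> L)"

text \<open>
  Expectation of \<open>f / g\<close> for nonnegative \<open>f\<close>, \<open>g\<close>, with values in \<open>[0, \<infinity>]\<close>. Division is that of
  \<^typ>\<open>ennreal\<close>: \<open>a / 0 = \<infinity>\<close> for \<open>a > 0\<close>, and \<open>0 / 0 = 0\<close>.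
\<close>

definition quot_expectation :: "real measure \<Rightarrow> (real \<Rightarrow> real) \<Rightarrow> (real \<Rightarrow> real) \<Rightarrow> ennreal" where
  "quot_expectation \<mu> f g = (\<integral>\<^sup>+ t. ennreal (f t) / ennreal (g t) \<partial>\<mu>)"

end

theory Submission
  imports Defs
begin

text \<open>
  Rows of the grid are queues in tandem. Adding boundary weights to last-passage percolation, Bernoulli
  variables of parameters \<open>q\<close> on the strict axis and geometric variables of parameters \<open>\<rho>\<close> on the weak
  axis, with \<open>P (1 - q) = \<rho> q (1 - P)\<close>, makes the model stationary (Burke's property), so the last-passage
  value with boundary is a sum of two sums of independent variables and concentrates around an explicit
  mean. This mean dominates the value without boundary, for every member of a one-parameter family of
  boundaries. At the critical member the domination is sharp: if an optimal path collected a macroscopic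
  part of a boundary, then moving the parameter slightly in the direction that increases that boundary
  would raise the value by a first-order amount, while the mean moves only to second order. Hence
  \<open>\<Psi>\<close> is the infimum of the means. All of this is quenched, with second-moment bounds of order \<open>1 / n\<close>;
  Borel--Cantelli along squares, monotonicity in \<open>n\<close> and Chebyshev's inequality for the environment give
  the almost sure limit.
\<close>

text \<open>The balance equation ties the probability of a site to a column parameter
  \<open>q\<close> and a row parameter \<rho>. The environment varies along one coordinate only, so
  the parameter of the other coordinate is taken constant, and this constant is the free parameter.
  For rightward paths it is the Bernoulli parameter u, with \<rho> = p(1-u)/(u(1-p)) in a row of
  probability p. For upward paths the grid is transposed, so the strict axis runs along the
  environment: \<rho> = z/(1+z) is constant and q = p(1+z)/(p+z). The equations for
  \<open>z\<^sub>0\<close> say that the derivative of the mean in u or z vanishes. The perturbation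
  moves the parameter both ways, so it works only at an interior critical point. Where the infimum
  sits at an endpoint, a nearby interior problem supplies the lower bound: at u = b the law is
  capped; at u = 1 or z = 0 the rectangle is shortened along the weak axis until a parameter close
  to the endpoint is critical, which can only lower the value.\<close>

subsection \<open>Last-passage percolation with boundary\<close>

text \<open>
  The first coordinate is the strict direction: a path collects one weight per column. \<open>lpp w I J k l\<close>
  uses \<open>k\<close> columns and \<open>l\<close> rows, so it corresponds to \<^const>\<open>T_right\<close> with row bound \<open>l - 1\<close>.
\<close>

fun lpp :: "(nat \<times> nat \<Rightarrow> nat) \<Rightarrow> (nat \<Rightarrow> nat) \<Rightarrow> (nat \<Rightarrow> nat) \<Rightarrow> nat \<Rightarrow> nat \<Rightarrow> nat" where
  "lpp w I J k 0 = (\<Sum>i<k. I i)"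
| "lpp w I J 0 (Suc l) = (\<Sum>j<Suc l. J j)"
| "lpp w I J (Suc k) (Suc l) = max (lpp w I J k (Suc l) + w (k, l)) (lpp w I J (Suc k) l)"

abbreviation lpp0 :: "(nat \<times> nat \<Rightarrow> nat) \<Rightarrow> nat \<Rightarrow> nat \<Rightarrow> nat" where
  "lpp0 w \<equiv> lpp w (\<lambda>_. 0) (\<lambda>_. 0)"

lemma lpp_0_left: "lpp w I J 0 l = (\<Sum>j<l. J j)"
  by (cases l) auto

lemma lpp_mono:
  assumes "\<And>s t. s < k \<Longrightarrow> t < l \<Longrightarrow> w (s, t) \<le> w' (s, t)" "\<And>s. s < k \<Longrightarrow> I s \<le> I' s" "\<And>t. t < l \<Longrightarrow> J t \<le> J' t"
  shows "lpp w I J k l \<le> lpp w' I' J' k l"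
  using assms
proof (induction w I J k l rule: lpp.induct)
  case (1 w I J k) then show ?case by (auto intro!: sum_mono)
next
  case (2 w I J l) then show ?case by (auto intro!: sum_mono add_mono)
next
  case (3 w I J k l)
  have "lpp w I J k (Suc l) + w (k, l) \<le> lpp w' I' J' k (Suc l) + w' (k, l)"
    using 3 by (intro add_mono) auto
  moreover have "lpp w I J (Suc k) l \<le> lpp w' I' J' (Suc k) l"
    using 3 by auto
  ultimately show ?case by (simp add: max.coboundedI1 max.coboundedI2)
qed

lemma lpp_cong:
  assumes "\<And>s t. s < k \<Longrightarrow> t < l \<Longrightarrow> w (s, t) = w' (s, t)" "\<And>s. s < k \<Longrightarrow> I s = I' s" "\<And>t. t < l \<Longrightarrow> J t = J' t"
  shows "lpp w I J k l = lpp w' I' J' k l"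
  by (rule antisym; rule lpp_mono) (auto simp: assms)

lemma lpp0_Suc_left: "lpp0 w k l \<le> lpp0 w (Suc k) l"
  by (cases l) auto

lemma lpp0_Suc_right: "lpp0 w k l \<le> lpp0 w k (Suc l)"
  by (cases k) (auto simp: lpp_0_left)

lemma lpp0_mono:
  assumes "k \<le> k'" "l \<le> l'"
  shows "lpp0 w k l \<le> lpp0 w k' l'"
proof -
  have "lpp0 w k l \<le> lpp0 w k' l" using assms(1)
    by (rule lift_Suc_mono_le[of "\<lambda>k. lpp0 w k l", OF lpp0_Suc_left])
  also have "\<dots> \<le> lpp0 w k' l'" using assms(2)
    by (rule lift_Suc_mono_le[of "\<lambda>l. lpp0 w k' l", OF lpp0_Suc_right])
  finally show ?thesis .
qed

lemma lpp0_le: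
  assumes "\<And>z. w z \<le> 1"
  shows "lpp0 w k l \<le> k"
proof (induction k arbitrary: l)
  case 0 then show ?case by (simp add: lpp_0_left)
next
  case (Suc k)
  show ?case
  proof (induction l)
    case (Suc l)
    have "lpp0 w k (Suc l) + w (k, l) \<le> k + 1" using \<open>\<And>l. lpp0 w k l \<le> k\<close> assms by (rule add_mono)
    then show ?case using Suc by simp
  qed simp
qed

text \<open>Steps along the strict axis collect weights and steps along the weak axis are free, so
  the reward of a lattice path depends only on the row used in each column. Rows 0 to
  \<open>l\<close> are \<open>Suc l\<close> rows.\<close>

lemma T_right_eq_lpp0:
  assumes "\<And>i j. i < k \<Longrightarrow> j \<le> l \<Longrightarrow> w (i, j) = real (v (i, j))"
  shows "T_right w k l = real (lpp0 v k (Suc l))"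
proof -
  let ?Y = "{y \<in> {..<k} \<rightarrow>\<^sub>E {..l}. mono_on {..<k} y}"
  have upper: "(\<Sum>i<k. v (i, y i)) \<le> lpp0 v k (Suc m)"
    if "mono_on {..<k} y" "\<forall>i<k. y i \<le> m" for y :: "nat \<Rightarrow> nat" and k m
    using that
  proof (induction k arbitrary: m)
    case (Suc k)
    \<comment> \<open>By monotonicity the earlier columns stay in rows up to \<open>y k\<close>, so
      the induction hypothesis is used with \<open>y k\<close> in place of \<open>m\<close>.\<close>
    have "(\<Sum>i<k. v (i, y i)) \<le> lpp0 v k (Suc (y k))"
      using Suc.prems by (intro Suc.IH) (auto simp: mono_on_def)
    then have "(\<Sum>i<Suc k. v (i, y i)) \<le> lpp0 v (Suc k) (Suc (y k))" by simp
    also have "\<dots> \<le> lpp0 v (Suc k) (Suc m)" using Suc.prems by (intro lpp0_mono) auto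
    finally show ?case .
  qed simp
  have lower: "\<exists>y. mono_on {..<k} y \<and> (\<forall>i<k. y i \<le> m) \<and> lpp0 v k (Suc m) \<le> (\<Sum>i<k. v (i, y i))" for k m
  proof (induction k arbitrary: m)
    case 0 then show ?case by (auto simp: mono_on_def lpp_0_left)
  next
    case (Suc k)
    note IHk = Suc.IH
    show ?case
    proof (induction m)
      case 0
      show ?case by (rule exI[of _ "\<lambda>_. 0"])
        (use IHk[of 0] in \<open>auto simp: mono_on_def sum_mono\<close>)
    next
      case (Suc m)
      show ?case
      \<comment> \<open>The branch that attains the maximum decides the witness: keep a path that
        avoids row \<open>Suc m\<close>, or place column \<open>k\<close> in that row after a path
        for the first \<open>k\<close> columns.\<close>
      proof (cases "lpp0 v (Suc k) (Suc m) \<ge> lpp0 v k (Suc (Suc m)) + v (k, Suc m)")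
        case True
        then show ?thesis using Suc by (metis le_SucI max.absorb2 lpp.simps(3) le_refl)
      next
        case False
        obtain y where y: "mono_on {..<k} y" "\<forall>i<k. y i \<le> Suc m" "lpp0 v k (Suc (Suc m)) \<le> (\<Sum>i<k. v (i, y i))"
          using IHk[of "Suc m"] by blast
        have "lpp0 v (Suc k) (Suc (Suc m)) = lpp0 v k (Suc (Suc m)) + v (k, Suc m)"
          using False unfolding lpp.simps(3)[of _ _ _ k "Suc m"] by (simp add: max_def)
        also have "\<dots> \<le> (\<Sum>i<Suc k. v (i, (y(k := Suc m)) i))"
          using y(3) by simp
        finally show ?thesis using y(1,2)
          by (intro exI[of _ "y(k := Suc m)"]) (auto simp: mono_on_def less_Suc_eq)
      qed
    qed
  qed
  have fin: "finite ?Y" by (rule finite_subset[OF _ finite_PiE[of "{..<k}" "\<lambda>_. {..l}"]]) auto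
  obtain y where y: "mono_on {..<k} y" "\<forall>i<k. y i \<le> l" "lpp0 v k (Suc l) \<le> (\<Sum>i<k. v (i, y i))"
    using lower by blast
  have sumeq: "(\<Sum>i<k. w (i, y i)) = real (\<Sum>i<k. v (i, y i))" if "\<forall>i<k. y i \<le> l" for y
    using that by (simp add: assms)
  show ?thesis unfolding T_right_def
  proof (rule Max_eqI)
    show "finite ((\<lambda>y. \<Sum>i<k. w (i, y i)) ` ?Y)" using fin by blast
    show "z \<le> real (lpp0 v k (Suc l))" if "z \<in> (\<lambda>y. \<Sum>i<k. w (i, y i)) ` ?Y" for z
      using that upper[of k _ l] by (force simp: sumeq PiE_iff simp del: of_nat_sum)
    show "real (lpp0 v k (Suc l)) \<in> (\<lambda>y. \<Sum>i<k. w (i, y i)) ` ?Y"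
    proof (rule image_eqI)
      let ?y = "restrict y {..<k}"
      show "?y \<in> ?Y" using y by (auto simp: mono_on_def)
      have "(\<Sum>i<k. v (i, y i)) = lpp0 v k (Suc l)" using upper[OF y(1,2)] y(3) by simp
      then show "real (lpp0 v k (Suc l)) = (\<Sum>i<k. w (i, ?y i))"
        using sumeq[OF y(2)] by simp
    qed
  qed
qed

lemma T_up_eq_T_right: "T_up w k l = T_right (\<lambda>(i, j). w (j, i)) l k"
  by (simp add: T_up_def T_right_def)

text \<open>
  The three terms correspond to an optimal path that collects at least \<open>K\<close> variables \<open>I\<close>, at least \<open>K'\<close>
  variables \<open>J\<close>, or fewer of both. Each term satisfies the recursion of \<^const>\<open>lpp\<close> with \<open>\<ge>\<close>, so no
  exit points are needed.
\<close>

lemma lpp_exit_bound: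
  fixes K K' :: nat
  assumes "\<And>s. s < k \<Longrightarrow> I s \<le> I1 s" "\<And>t. t < l \<Longrightarrow> J t \<le> J2 t"
  shows "int (lpp w I J k l) \<le>
    max (int (lpp w I1 J1 k l) - (int (\<Sum>s<K. I1 s) - int (\<Sum>s<K. I s)))
      (max (int (lpp w I2 J2 k l) - (int (\<Sum>t<K'. J2 t) - int (\<Sum>t<K'. J t)))
        (int (lpp0 w k l) + int (\<Sum>s<K. I s) + int (\<Sum>t<K'. J t)))"
  using assms
proof (induction w I J k l rule: lpp.induct)
  case (1 w I J k)
  show ?case
  \<comment> \<open>On the axis, up to \<open>K\<close> variables are absorbed by the third term.
    Beyond \<open>K\<close>, replacing \<open>I\<close> by \<open>I1\<close> gains exactly the
    subtracted difference on the first \<open>K\<close> columns and loses nothing on the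
    others.\<close>
  proof (cases "k \<le> K")
    case True
    then have "(\<Sum>s<k. I s) \<le> (\<Sum>s<K. I s)" by (intro sum_mono2) auto
    then have "int (\<Sum>s<k. I s) \<le> int (\<Sum>s<K. I s)" by linarith
    then show ?thesis by (simp add: max_def del: of_nat_sum)
  next
    case False
    have split: "(\<Sum>s<k. f s) = (\<Sum>s<K. f s) + (\<Sum>s\<in>{K..<k}. f s)" for f :: "nat \<Rightarrow> nat"
      using False sum.atLeastLessThan_concat[of 0 K k f] by (simp add: lessThan_atLeast0)
    have "(\<Sum>s\<in>{K..<k}. I s) \<le> (\<Sum>s\<in>{K..<k}. I1 s)" using 1 by (intro sum_mono) auto
    then show ?thesis using split[of I] split[of I1] by (simp add: max_def del: of_nat_sum)
  qed
next
  case (2 w I J l)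
  show ?case
  proof (cases "Suc l \<le> K'")
    case True
    then have "(\<Sum>s<Suc l. J s) \<le> (\<Sum>s<K'. J s)" by (intro sum_mono2) auto
    then have "int (\<Sum>s<Suc l. J s) \<le> int (\<Sum>s<K'. J s)" by linarith
    then show ?thesis by (simp add: max_def lpp_0_left del: of_nat_sum sum.lessThan_Suc)
  next
    case False
    have split: "(\<Sum>s<Suc l. f s) = (\<Sum>s<K'. f s) + (\<Sum>s\<in>{K'..<Suc l}. f s)" for f :: "nat \<Rightarrow> nat"
      using False sum.atLeastLessThan_concat[of 0 K' "Suc l" f] by (simp add: lessThan_atLeast0 del: sum.op_ivl_Suc)
    have "(\<Sum>s\<in>{K'..<Suc l}. J s) \<le> (\<Sum>s\<in>{K'..<Suc l}. J2 s)" using 2 by (intro sum_mono) auto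
    then show ?thesis using split[of J] split[of J2]
      by (simp add: max_def lpp_0_left del: of_nat_sum sum.lessThan_Suc sum.op_ivl_Suc)
  qed
next
  case (3 w I J k l)
  show ?case using 3 by (simp add: max_def split: if_splits del: of_nat_sum)
qed

section \<open>Queue representation of passage values\<close>

fun queue :: "nat \<Rightarrow> (nat \<Rightarrow> nat) \<Rightarrow> (nat \<Rightarrow> nat) \<Rightarrow> nat \<Rightarrow> nat" where
  "queue j I x 0 = j"
| "queue j I x (Suc k) = queue j I x k + x k - I k"

text \<open>If \<open>I\<close> holds the horizontal increments of \<open>lpp\<close> below a row,
  then \<open>queue\<close> is the vertical increment across the row at column \<open>k\<close> and
  \<open>served\<close> the horizontal increment above it: both formulas come from subtracting
  neighbouring values in the max recursion. Truncated subtraction supplies the maximum with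
  0.\<close>

definition served :: "nat \<Rightarrow> (nat \<Rightarrow> nat) \<Rightarrow> (nat \<Rightarrow> nat) \<Rightarrow> nat \<Rightarrow> nat" where
  "served j I x k = max (x k) (I k - queue j I x k)"

primrec outputs :: "(nat \<times> nat \<Rightarrow> nat) \<Rightarrow> (nat \<Rightarrow> nat) \<Rightarrow> (nat \<Rightarrow> nat) \<Rightarrow> nat \<Rightarrow> nat \<Rightarrow> nat" where
  "outputs w I J 0 = I"
| "outputs w I J (Suc l) = served (J l) (outputs w I J l) (\<lambda>s. w (s, l))"

text \<open>Two ways around a rectangle: up the left edge and along the top, or along the bottom and
  up the right edge. In one column this is \<open>max (queue + x) I\<close>, split in two
  ways.\<close>

lemma queue_conservation:
  "j + (\<Sum>i<k. served j I x i) = queue j I x k + (\<Sum>i<k. I i)"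
  by (induction k) (auto simp: served_def max_def)

text \<open>Reads the value along the left axis and the top edge. Under a stationary boundary each
  of the two sums has independent terms, although the sums may depend on each other.\<close>

lemma lpp_eq_sum_outputs:
  "lpp w I J k l = (\<Sum>j<l. J j) + (\<Sum>i<k. outputs w I J l i)"
proof (induction w I J k l rule: lpp.induct)
  case (3 w I J k l)
  let ?I = "outputs w I J l" and ?x = "\<lambda>s. w (s, l)"
  have "J l + (\<Sum>i<k. served (J l) ?I ?x i) = queue (J l) ?I ?x k + (\<Sum>i<k. ?I i)"
    by (rule queue_conservation)
  then show ?case unfolding lpp.simps 3
    by (auto simp: served_def max_def)
qed auto

lemma queue_cong:
  assumes "\<And>i. i < k \<Longrightarrow> I i = I' i" "\<And>i. i < k \<Longrightarrow> x i = x' i"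
  shows "queue j I x k = queue j I' x' k"
  using assms by (induction k) auto

lemma served_cong:
  assumes "\<And>i. i \<le> k \<Longrightarrow> I i = I' i" "\<And>i. i \<le> k \<Longrightarrow> x i = x' i"
  shows "served j I x k = served j I' x' k"
  using assms queue_cong[of k I I' x x' j] by (auto simp: served_def)

text \<open>This locality is what allows boundaries and weights on finite index sets, with default 0
  outside.\<close>

lemma outputs_cong:
  assumes "\<And>s t. s < k \<Longrightarrow> t < l \<Longrightarrow> w (s, t) = w' (s, t)" "\<And>s. s < k \<Longrightarrow> I s = I' s"
    "\<And>t. t < l \<Longrightarrow> J t = J' t" and "i < k"
  shows "outputs w I J l i = outputs w' I' J' l i"
  using assms
proof (induction l arbitrary: i)
  case (Suc l)
  have "served (J l) (outputs w I J l) (\<lambda>s. w (s, l)) i = served (J' l) (outputs w' I' J' l) (\<lambda>s. w' (s, l)) i"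
    using Suc by (auto intro!: served_cong)
  then show ?case by simp
qed auto

subsection \<open>Stationary boundaries\<close>

definition bern :: "real \<Rightarrow> nat pmf" where
  "bern q = map_pmf of_bool (bernoulli_pmf q)"

text \<open>Parametrised by the probability of failure, so that tails are powers of \<rho> and
  parameters multiply under minima.\<close>

definition geo :: "real \<Rightarrow> nat pmf" where
  "geo \<rho> = geometric_pmf (1 - \<rho>)"

lemma pmf_bern:
  assumes "0 \<le> q" "q \<le> 1"
  shows "pmf (bern q) n = (if n = 0 then 1 - q else if n = 1 then q else 0)"
proof -
  have "(of_bool :: bool \<Rightarrow> nat) -` {n} = (if n = 0 then {False} else if n = 1 then {True} else {})"
  proof (intro set_eqI)
    fix c :: bool
    show "c \<in> of_bool -` {n} \<longleftrightarrow> c \<in> (if n = 0 then {False} else if n = 1 then {True} else {})"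
      by (cases c; cases "n = 0"; cases "n = 1"; simp)
  qed
  then show ?thesis unfolding bern_def pmf_map using assms by (simp add: measure_pmf_single)
qed

lemma pmf_geo:
  assumes "0 \<le> \<rho>" "\<rho> < 1"
  shows "pmf (geo \<rho>) n = (1 - \<rho>) * \<rho> ^ n"
  unfolding geo_def using assms by (subst pmf_geometric) (auto simp: algebra_simps)

lemma set_bern: "set_pmf (bern q) \<subseteq> {0, 1}"
  by (auto simp: bern_def)

lemma pmf_bind_bern:
  assumes "0 \<le> q" "q \<le> 1"
  shows "pmf (bind_pmf (bern q) f) y = (1 - q) * pmf (f 0) y + q * pmf (f 1) y"
  unfolding bern_def using assms by (simp add: bind_map_pmf pmf_bind add.commute)

text \<open>Burke's property at one site. Only the inputs (0,1) and (1,0) can change the queue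
  length, the first raising it and the second lowering it when it is positive.
  \<open>balance\<close> equates these two flows, \<rho> being the ratio of successive geometric
  probabilities.\<close>

lemma queue_step_stationary:
  fixes p q \<rho> :: real
  assumes p: "0 \<le> p" "p \<le> 1" and q: "0 \<le> q" "q \<le> 1" and \<rho>: "0 \<le> \<rho>" "\<rho> < 1"
    and balance: "p * (1 - q) = \<rho> * q * (1 - p)"
  shows "do {i \<leftarrow> bern q; x \<leftarrow> bern p; j \<leftarrow> geo \<rho>; return_pmf (max x (i - j), j + x - i)}
    = pair_pmf (bern q) (geo \<rho>)" (is "?L = ?R")
proof (rule pmf_eqI)
  fix y :: "nat \<times> nat"
  obtain n m where y: "y = (n, m)" by force
  let ?g = "pmf (geo \<rho>)"
  let ?h = "\<lambda>i x. map_pmf (\<lambda>j. (max x (i - j), j + x - i)) (geo \<rho>)"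
  have L: "pmf ?L y = (1 - q) * ((1 - p) * pmf (?h 0 0) y + p * pmf (?h 0 1) y)
     + q * ((1 - p) * pmf (?h 1 0) y + p * pmf (?h 1 1) y)"
    by (simp only: pmf_bind_bern[OF p] pmf_bind_bern[OF q] map_pmf_def)
  have pre: "(\<lambda>j. (max x (i - j), j + x - i)) -` {(n, m)} = A \<Longrightarrow> pmf (?h i x) y = measure_pmf.prob (geo \<rho>) A" for i x A
    unfolding pmf_map y by simp
  have h00: "pmf (?h 0 0) y = (if n = 0 then ?g m else 0)"
    by (subst pre[of _ _ "if n = 0 then {m} else {}"]) (auto simp: measure_pmf_single)
  have h01: "pmf (?h 0 1) y = (if n = 1 \<and> m > 0 then ?g (m - 1) else 0)"
    by (subst pre[of _ _ "if n = 1 \<and> m > 0 then {m - 1} else {}"]) (auto simp: measure_pmf_single)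
  have h10: "pmf (?h 1 0) y = (if n = 0 then ?g (Suc m) else if n = 1 \<and> m = 0 then ?g 0 else 0)"
    by (subst pre[of _ _ "if n = 0 then {Suc m} else if n = 1 \<and> m = 0 then {0} else {}"])
      (auto simp: measure_pmf_single)
  have h11: "pmf (?h 1 1) y = (if n = 1 then ?g m else 0)"
    by (subst pre[of _ _ "if n = 1 then {m} else {}"]) (auto simp: measure_pmf_single)
  have R: "pmf ?R y = pmf (bern q) n * ?g m" by (simp add: y pmf_pair)
  have g: "?g (Suc k) = \<rho> * ?g k" for k using \<rho> by (simp add: pmf_geo)
  consider "n = 0" | "n = 1" "m = 0" | k where "n = 1" "m = Suc k" | "n > 1"
    by (metis One_nat_def Suc_lessI neq0_conv not0_implies_Suc)
  then show "pmf ?L y = pmf ?R y"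
  proof cases
    case 1
    have "(1 - q) * (1 - p) * ?g m + (\<rho> * q * (1 - p)) * ?g m = (1 - q) * ?g m"
      unfolding balance[symmetric] by (simp add: algebra_simps)
    then show ?thesis unfolding L R h00 h01 h10 h11 using 1 q by (simp add: g pmf_bern algebra_simps)
  next
    \<comment> \<open>An output 1 with an empty queue requires \<open>i = 1\<close> and
      \<open>j = 0\<close>; summing over \<open>x\<close> already gives the mass
      \<open>q * ?g 0\<close>.\<close>
    case 2
    then show ?thesis unfolding L R h00 h01 h10 h11 using q by (simp add: pmf_bern algebra_simps)
  next
    case 3
    have "q * p * (\<rho> * ?g k) + (p * (1 - q)) * ?g k = q * (\<rho> * ?g k)"
      unfolding balance by (simp add: algebra_simps)
    then show ?thesis unfolding L R h00 h01 h10 h11 using 3 q by (simp add: g pmf_bern algebra_simps)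
  next
    case 4
    then show ?thesis unfolding L R h00 h01 h10 h11 using q by (simp add: pmf_bern)
  qed
qed

definition bern_field :: "nat \<Rightarrow> (nat \<Rightarrow> real) \<Rightarrow> (nat \<Rightarrow> nat) pmf" where
  "bern_field k q = Pi_pmf {..<k} 0 (\<lambda>s. bern (q s))"

definition geo_field :: "nat \<Rightarrow> (nat \<Rightarrow> real) \<Rightarrow> (nat \<Rightarrow> nat) pmf" where
  "geo_field l \<rho> = Pi_pmf {..<l} 0 (\<lambda>t. geo (\<rho> t))"

definition weights :: "nat \<Rightarrow> nat \<Rightarrow> (nat \<times> nat \<Rightarrow> real) \<Rightarrow> (nat \<times> nat \<Rightarrow> nat) pmf" where
  "weights k l P = Pi_pmf ({..<k} \<times> {..<l}) 0 (\<lambda>z. bern (P z))"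

text \<open>\<open>served\<close> and \<open>outputs\<close> live on all columns, whereas the
  product laws put the default 0 outside the first \<open>k\<close>; truncation makes the laws
  comparable.\<close>

definition trunc :: "nat \<Rightarrow> (nat \<Rightarrow> nat) \<Rightarrow> nat \<Rightarrow> nat" where
  "trunc k f i = (if i < k then f i else 0)"

lemma bern_field_Suc:
  "bern_field (Suc k) q = do {y \<leftarrow> bern (q k); f \<leftarrow> bern_field k q; return_pmf (f(k := y))}"
  unfolding bern_field_def lessThan_Suc by (subst Pi_pmf_insert') auto

lemma geo_field_Suc:
  "geo_field (Suc k) q = do {y \<leftarrow> geo (q k); f \<leftarrow> geo_field k q; return_pmf (f(k := y))}"
  unfolding geo_field_def lessThan_Suc by (subst Pi_pmf_insert') auto

text \<open>After \<open>k\<close> columns the outputs are independent of the current queue, which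
  is again geometric, so column \<open>k\<close> sees exactly the input of
  \<open>queue_step_stationary\<close>. The calculation only commutes independent draws to expose
  this.\<close>

lemma row_stationary:
  fixes p q :: "nat \<Rightarrow> real"
  assumes "\<And>i. i < k \<Longrightarrow> 0 \<le> p i \<and> p i \<le> 1" "\<And>i. i < k \<Longrightarrow> 0 \<le> q i \<and> q i \<le> 1"
    and \<rho>: "0 \<le> \<rho>" "\<rho> < 1"
    and "\<And>i. i < k \<Longrightarrow> p i * (1 - q i) = \<rho> * q i * (1 - p i)"
  shows "do {I \<leftarrow> bern_field k q; x \<leftarrow> bern_field k p; j \<leftarrow> geo \<rho>;
        return_pmf (trunc k (served j I x), queue j I x k)}
    = pair_pmf (bern_field k q) (geo \<rho>)"
  using assms
proof (induction k)
  case 0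
  have "trunc 0 f = (\<lambda>_. 0)" for f by (auto simp: trunc_def)
  then show ?case by (simp add: bern_field_def bind_return_pmf pair_pmf_def)
next
  case (Suc k)
  have tr: "trunc (Suc k) (served j (I(k := i)) (x(k := z))) =
      (trunc k (served j I x))(k := max z (i - queue j I x k))"
    "queue j (I(k := i)) (x(k := z)) (Suc k) = queue j I x k + z - i" for j I x i z
  proof -
    have q: "queue j (I(k := i)) (x(k := z)) k = queue j I x k" by (rule queue_cong) auto
    then show "queue j (I(k := i)) (x(k := z)) (Suc k) = queue j I x k + z - i" by simp
    have "served j (I(k := i)) (x(k := z)) m = served j I x m" if "m < k" for m
      using that by (intro served_cong) auto
    then show "trunc (Suc k) (served j (I(k := i)) (x(k := z))) =
      (trunc k (served j I x))(k := max z (i - queue j I x k))"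
      using q by (auto simp: trunc_def served_def less_Suc_eq fun_eq_iff)
  qed
  have "do {I \<leftarrow> bern_field (Suc k) q; x \<leftarrow> bern_field (Suc k) p; j \<leftarrow> geo \<rho>;
        return_pmf (trunc (Suc k) (served j I x), queue j I x (Suc k))}
    = do {i \<leftarrow> bern (q k); I \<leftarrow> bern_field k q; z \<leftarrow> bern (p k); x \<leftarrow> bern_field k p; j \<leftarrow> geo \<rho>;
        return_pmf ((trunc k (served j I x))(k := max z (i - queue j I x k)), queue j I x k + z - i)}"
    by (simp add: bern_field_Suc bind_assoc_pmf bind_return_pmf tr del: queue.simps)
  also have "\<dots> = do {i \<leftarrow> bern (q k); z \<leftarrow> bern (p k); I \<leftarrow> bern_field k q; x \<leftarrow> bern_field k p; j \<leftarrow> geo \<rho>;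
        return_pmf ((trunc k (served j I x))(k := max z (i - queue j I x k)), queue j I x k + z - i)}"
    by (subst bind_commute_pmf[of "bern_field k q" "bern (p k)"]) (rule refl)
  also have "\<dots> = do {i \<leftarrow> bern (q k); z \<leftarrow> bern (p k);
        (f, j) \<leftarrow> do {I \<leftarrow> bern_field k q; x \<leftarrow> bern_field k p; j \<leftarrow> geo \<rho>;
        return_pmf (trunc k (served j I x), queue j I x k)};
        return_pmf (f(k := max z (i - j)), j + z - i)}"
    by (simp add: bind_assoc_pmf bind_return_pmf)
  also have "\<dots> = do {i \<leftarrow> bern (q k); z \<leftarrow> bern (p k);
        (f, j) \<leftarrow> pair_pmf (bern_field k q) (geo \<rho>);
        return_pmf (f(k := max z (i - j)), j + z - i)}"
    using Suc by simp
  also have "\<dots> = do {i \<leftarrow> bern (q k); z \<leftarrow> bern (p k); f \<leftarrow> bern_field k q; j \<leftarrow> geo \<rho>;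
        return_pmf (f(k := max z (i - j)), j + z - i)}"
    by (simp add: pair_pmf_def bind_assoc_pmf bind_return_pmf)
  also have "\<dots> = do {i \<leftarrow> bern (q k); f \<leftarrow> bern_field k q; z \<leftarrow> bern (p k); j \<leftarrow> geo \<rho>;
        return_pmf (f(k := max z (i - j)), j + z - i)}"
    by (subst bind_commute_pmf[of "bern_field k q" "bern (p k)"]) (rule refl)
  also have "\<dots> = do {f \<leftarrow> bern_field k q; i \<leftarrow> bern (q k); z \<leftarrow> bern (p k); j \<leftarrow> geo \<rho>;
        return_pmf (f(k := max z (i - j)), j + z - i)}"
    by (rule bind_commute_pmf)
  also have "\<dots> = do {f \<leftarrow> bern_field k q;
       (i, j) \<leftarrow> do {i \<leftarrow> bern (q k); z \<leftarrow> bern (p k); j \<leftarrow> geo \<rho>; return_pmf (max z (i - j), j + z - i)};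
        return_pmf (f(k := i), j)}"
    by (simp add: bind_assoc_pmf bind_return_pmf)
  also have "\<dots> = do {f \<leftarrow> bern_field k q; (i, j) \<leftarrow> pair_pmf (bern (q k)) (geo \<rho>);
        return_pmf (f(k := i), j)}"
    using Suc.prems by (subst queue_step_stationary) auto
  also have "\<dots> = do {f \<leftarrow> bern_field k q; i \<leftarrow> bern (q k); j \<leftarrow> geo \<rho>; return_pmf (f(k := i), j)}"
    by (simp add: pair_pmf_def bind_assoc_pmf bind_return_pmf)
  also have "\<dots> = do {i \<leftarrow> bern (q k); f \<leftarrow> bern_field k q; j \<leftarrow> geo \<rho>; return_pmf (f(k := i), j)}"
    by (rule bind_commute_pmf)
  also have "\<dots> = pair_pmf (bern_field (Suc k) q) (geo \<rho>)"
    by (simp add: pair_pmf_def bern_field_Suc bind_assoc_pmf bind_return_pmf)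
  finally show ?case .
qed

text \<open>Splits off the last row as an independent field, so that rows can be passed through
  \<open>row_stationary\<close> one at a time.\<close>

lemma weights_Suc:
  "weights k (Suc l) P = do {w \<leftarrow> weights k l P; x \<leftarrow> bern_field k (\<lambda>s. P (s, l));
     return_pmf (\<lambda>(s, t). if t = l then x s else w (s, t))}"
proof -
  let ?A = "{..<k} \<times> {..<l}" and ?B = "(\<lambda>s. (s, l)) ` {..<k}"
  have AB: "{..<k} \<times> {..<Suc l} = ?A \<union> ?B" by auto
  \<comment> \<open>The product law on row \<open>l\<close> is transported along the injection
    sending \<open>s\<close> to \<open>(s, l)\<close> by comparing point masses; functions that do
    not vanish outside that row have mass 0 on both sides.\<close>
  have B: "Pi_pmf ?B 0 (\<lambda>z. bern (P z)) =
      map_pmf (\<lambda>x (s, t). if t = l then x s else 0) (bern_field k (\<lambda>s. P (s, l)))"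
  proof (rule pmf_eqI)
    fix f :: "nat \<times> nat \<Rightarrow> nat"
    let ?h = "\<lambda>x (s :: nat, t). if t = l then x s else (0::nat)"
    have inj: "inj ?h" 
    proof (intro injI ext)
      fix x y :: "nat \<Rightarrow> nat" and s
      assume "?h x = ?h y"
      from fun_cong[OF this, of "(s, l)"] show "x s = y s" by simp
    qed
    show "pmf (Pi_pmf ?B 0 (\<lambda>z. bern (P z))) f = pmf (map_pmf ?h (bern_field k (\<lambda>s. P (s, l)))) f"
    proof (cases "\<forall>s t. t \<noteq> l \<longrightarrow> f (s, t) = 0")
      case True
      then have f: "f = ?h (\<lambda>s. f (s, l))" by (auto simp: fun_eq_iff)
      have eq: "(\<forall>z. z \<notin> ?B \<longrightarrow> f z = 0) \<longleftrightarrow> (\<forall>s. s \<notin> {..<k} \<longrightarrow> f (s, l) = 0)"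
        using True by auto (metis image_eqI lessThan_iff)
      have "pmf (map_pmf ?h (bern_field k (\<lambda>s. P (s, l)))) f = pmf (bern_field k (\<lambda>s. P (s, l))) (\<lambda>s. f (s, l))"
        by (subst f) (rule pmf_map_inj'[OF inj])
      also have "\<dots> = pmf (Pi_pmf ?B 0 (\<lambda>z. bern (P z))) f"
        unfolding bern_field_def pmf_Pi[OF finite_lessThan] pmf_Pi[OF finite_imageI[OF finite_lessThan]] eq
        by (auto simp: prod.reindex inj_on_def)
      finally show ?thesis by simp
    next
      case False
      then have "f \<notin> range ?h" by (auto simp: image_iff fun_eq_iff)
      then have "f \<notin> set_pmf (map_pmf ?h (bern_field k (\<lambda>s. P (s, l))))" by auto
      then have "pmf (map_pmf ?h (bern_field k (\<lambda>s. P (s, l)))) f = 0"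
        unfolding set_pmf_iff by blast
      moreover have "pmf (Pi_pmf ?B 0 (\<lambda>z. bern (P z))) f = 0"
        using False by (intro pmf_Pi_outside) auto
      ultimately show ?thesis by simp
    qed
  qed
  have "weights k (Suc l) P = map_pmf (\<lambda>(f, g) z. if z \<in> ?A then f z else g z)
      (pair_pmf (weights k l P) (Pi_pmf ?B 0 (\<lambda>z. bern (P z))))"
    unfolding weights_def AB by (subst Pi_pmf_union) auto
  also have "\<dots> = do {w \<leftarrow> weights k l P; x \<leftarrow> bern_field k (\<lambda>s. P (s, l));
     return_pmf (\<lambda>z. if z \<in> ?A then w z else (\<lambda>(s, t). if t = l then x s else 0) z)}"
    by (simp add: B pair_pmf_def map_pmf_def bind_assoc_pmf bind_return_pmf)
  also have "\<dots> = do {w \<leftarrow> weights k l P; x \<leftarrow> bern_field k (\<lambda>s. P (s, l));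
     return_pmf (\<lambda>(s, t). if t = l then x s else w (s, t))}"
  proof (intro bind_pmf_cong refl arg_cong[where f = return_pmf] ext)
    fix w x and z :: "nat \<times> nat" assume w: "w \<in> set_pmf (weights k l P)" and x: "x \<in> set_pmf (bern_field k (\<lambda>s. P (s, l)))"
    obtain s t where z: "z = (s, t)" by force
    have "w z = 0" if "z \<notin> ?A" using that w set_Pi_pmf_subset[of ?A 0 "\<lambda>z. bern (P z)"] unfolding weights_def by (cases z) auto
    moreover have "x s = 0" if "\<not> s < k" using that x set_Pi_pmf_subset[of "{..<k}" 0 "\<lambda>s. bern (P (s, l))"] unfolding bern_field_def by auto
    ultimately show "(if z \<in> ?A then w z else (\<lambda>(s, t). if t = l then x s else 0) z)
       = (\<lambda>(s, t). if t = l then x s else w (s, t)) z"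
      using z by auto
  qed
  finally show ?thesis .
qed

text \<open>The outputs of one row are the inputs of the next, and the new weights and the new
  geometric variable are independent of them. Only the law of the top edge is kept; the queue that
  leaves the row is projected away.\<close>

lemma outputs_stationary:
  assumes "\<And>s t. s < k \<Longrightarrow> t < l \<Longrightarrow> 0 \<le> P (s, t) \<and> P (s, t) \<le> 1" "\<And>i. i < k \<Longrightarrow> 0 \<le> q i \<and> q i \<le> 1"
    and "\<And>t. t < l \<Longrightarrow> 0 \<le> \<rho> t \<and> \<rho> t < 1"
    and "\<And>s t. s < k \<Longrightarrow> t < l \<Longrightarrow> P (s, t) * (1 - q s) = \<rho> t * q s * (1 - P (s, t))"
  shows "do {w \<leftarrow> weights k l P; I \<leftarrow> bern_field k q; J \<leftarrow> geo_field l \<rho>;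
      return_pmf (trunc k (outputs w I J l))} = bern_field k q"
  using assms
proof (induction l)
  case 0
  have tr: "trunc k I = I" if "I \<in> set_pmf (bern_field k q)" for I
    using that set_Pi_pmf_subset[of "{..<k}" 0 "\<lambda>s. bern (q s)"] unfolding bern_field_def trunc_def by fastforce
  have "do {I \<leftarrow> bern_field k q; return_pmf (trunc k I)} = do {I \<leftarrow> bern_field k q; return_pmf I}"
    by (intro bind_pmf_cong refl) (simp add: tr)
  then show ?case by (simp add: weights_def geo_field_def bind_return_pmf bind_return_pmf')
next
  case (Suc l)
  let ?W = "weights k l P" and ?B = "bern_field k q" and ?J = "geo_field l \<rho>" and ?x = "bern_field k (\<lambda>s. P (s, l))"
  have tr: "trunc k (outputs (\<lambda>(s, t). if t = l then x s else w (s, t)) I (J(l := j)) (Suc l)) =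
     trunc k (served j (trunc k (outputs w I J l)) x)" for w x I J j
  proof
    fix i
    have "served j (outputs (\<lambda>(s, t). if t = l then x s else w (s, t)) I (J(l := j)) l) x i =
        served j (trunc k (outputs w I J l)) x i" if "i < k"
      using that by (intro served_cong) (auto simp: trunc_def intro!: outputs_cong[of k])
    then show "trunc k (outputs (\<lambda>(s, t). if t = l then x s else w (s, t)) I (J(l := j)) (Suc l)) i =
     trunc k (served j (trunc k (outputs w I J l)) x) i" by (simp add: trunc_def)
  qed
  have "do {w \<leftarrow> weights k (Suc l) P; I \<leftarrow> ?B; J \<leftarrow> geo_field (Suc l) \<rho>;
      return_pmf (trunc k (outputs w I J (Suc l)))} =
    do {w \<leftarrow> ?W; x \<leftarrow> ?x; I \<leftarrow> ?B; j \<leftarrow> geo (\<rho> l); J \<leftarrow> ?J;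
      return_pmf (trunc k (served j (trunc k (outputs w I J l)) x))}"
    by (simp add: weights_Suc geo_field_Suc bind_assoc_pmf bind_return_pmf tr del: outputs.simps)
  also have "\<dots> = do {w \<leftarrow> ?W; x \<leftarrow> ?x; I \<leftarrow> ?B; J \<leftarrow> ?J; j \<leftarrow> geo (\<rho> l); 
      return_pmf (trunc k (served j (trunc k (outputs w I J l)) x))}"
    by (subst bind_commute_pmf[of "geo (\<rho> l)"]) (rule refl)
  also have "\<dots> = do {w \<leftarrow> ?W; I \<leftarrow> ?B; x \<leftarrow> ?x; J \<leftarrow> ?J; j \<leftarrow> geo (\<rho> l); 
      return_pmf (trunc k (served j (trunc k (outputs w I J l)) x))}"
    by (subst bind_commute_pmf[of ?x]) (rule refl)
  also have "\<dots> = do {w \<leftarrow> ?W; I \<leftarrow> ?B; J \<leftarrow> ?J; x \<leftarrow> ?x; j \<leftarrow> geo (\<rho> l); 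
      return_pmf (trunc k (served j (trunc k (outputs w I J l)) x))}"
    by (subst bind_commute_pmf[of ?x]) (rule refl)
  also have "\<dots> = do {I \<leftarrow> do {w \<leftarrow> ?W; I \<leftarrow> ?B; J \<leftarrow> ?J; return_pmf (trunc k (outputs w I J l))};
      x \<leftarrow> ?x; j \<leftarrow> geo (\<rho> l); return_pmf (trunc k (served j I x))}"
    by (simp add: bind_assoc_pmf bind_return_pmf)
  also have "\<dots> = do {I \<leftarrow> ?B; x \<leftarrow> ?x; j \<leftarrow> geo (\<rho> l); return_pmf (trunc k (served j I x))}"
    using Suc by (subst Suc.IH) auto
  also have "\<dots> = map_pmf fst (do {I \<leftarrow> ?B; x \<leftarrow> ?x; j \<leftarrow> geo (\<rho> l);
        return_pmf (trunc k (served j I x), queue j I x k)})"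
    by (simp add: map_pmf_def bind_assoc_pmf bind_return_pmf)
  also have "\<dots> = ?B"
    using Suc.prems by (subst row_stationary) (auto simp: map_fst_pair_pmf)
  finally show ?case .
qed

subsection \<open>Concentration and couplings\<close>

text \<open>Second moments dominate variances, and the cross terms of centred variables vanish by
  pairwise independence.\<close>

lemma (in prob_space) chebyshev_sum_indep:
  fixes Y :: "'i \<Rightarrow> 'a \<Rightarrow> real"
  assumes A: "finite A" and indep: "indep_vars (\<lambda>_. borel) Y A"
    and int: "\<And>i. i \<in> A \<Longrightarrow> integrable M (\<lambda>\<omega>. (Y i \<omega>)\<^sup>2)"
    and V: "\<And>i. i \<in> A \<Longrightarrow> expectation (\<lambda>\<omega>. (Y i \<omega>)\<^sup>2) \<le> V"
    and e: "0 < e"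
  shows "prob {\<omega> \<in> space M. e \<le> \<bar>(\<Sum>i\<in>A. Y i \<omega>) - (\<Sum>i\<in>A. expectation (Y i))\<bar>} \<le> real (card A) * V / e\<^sup>2"
proof -
  have meas: "Y i \<in> borel_measurable M" if "i \<in> A" for i
    using indep that by (auto simp: indep_vars_def)
  have int1: "integrable M (Y i)" if "i \<in> A" for i
    using square_integrable_imp_integrable[OF meas int] that by auto
  define Z where "Z i \<omega> = Y i \<omega> - expectation (Y i)" for i \<omega>
  have Zmeas[measurable]: "Z i \<in> borel_measurable M" if "i \<in> A" for i
    unfolding Z_def using meas[OF that] by measurable
  have Zint: "integrable M (Z i)" "expectation (Z i) = 0" if "i \<in> A" for i
  proof -
    have Z: "Z i = (\<lambda>\<omega>. Y i \<omega> - expectation (Y i))" by (auto simp: Z_def)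
    show "integrable M (Z i)" unfolding Z by (intro Bochner_Integration.integrable_diff int1 that integrable_const)
    have "expectation (\<lambda>\<omega>. Y i \<omega> - expectation (Y i)) = expectation (Y i) - expectation (\<lambda>_. expectation (Y i))"
      by (intro Bochner_Integration.integral_diff int1 that integrable_const)
    then show "expectation (Z i) = 0" unfolding Z by (simp add: prob_space)
  qed
  have indepZ: "indep_vars (\<lambda>_. borel) Z A"
  proof -
    have "Z = (\<lambda>i \<omega>. Y i \<omega> - expectation (Y i))" by (intro ext) (rule Z_def)
    moreover have "indep_vars (\<lambda>_. borel) (\<lambda>i \<omega>. (\<lambda>y. y - expectation (Y i)) (Y i \<omega>)) A"
      by (rule indep_vars_compose2[OF indep]) simp
    ultimately show ?thesis by (simp only:)
  qed
  have ZZ: "integrable M (\<lambda>\<omega>. Z i \<omega> * Z j \<omega>) \<and>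
      expectation (\<lambda>\<omega>. Z i \<omega> * Z j \<omega>) \<le> (if i = j then V else 0)"
    if ij: "i \<in> A" "j \<in> A" for i j
  proof (cases "i = j")
    case True
    have "variance (Y i) = expectation (\<lambda>\<omega>. (Y i \<omega>)\<^sup>2) - (expectation (Y i))\<^sup>2"
      by (rule variance_eq[OF int1[OF ij(1)] int[OF ij(1)]])
    also have "\<dots> \<le> V" using V[OF ij(1)] zero_le_power2[of "expectation (Y i)"] by linarith
    finally have "variance (Y i) \<le> V" .
    moreover have "integrable M (\<lambda>\<omega>. (Z i \<omega>)\<^sup>2)"
      unfolding Z_def power2_diff using int1[OF ij(1)] int[OF ij(1)]
      by (intro Bochner_Integration.integrable_add Bochner_Integration.integrable_diff) auto
    ultimately show ?thesis using True unfolding Z_def power2_eq_square by simp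
  next
    case False
    have "indep_vars (\<lambda>_. borel) Z {i, j}" using indepZ ij by (rule_tac indep_vars_subset) auto
    then have "integrable M (\<lambda>\<omega>. \<Prod>m\<in>{i, j}. Z m \<omega>)"
      "expectation (\<lambda>\<omega>. \<Prod>m\<in>{i, j}. Z m \<omega>) = (\<Prod>m\<in>{i, j}. expectation (Z m))"
      using Zint ij by (auto intro!: indep_vars_integrable indep_vars_lebesgue_integral)
    then show ?thesis using False Zint ij by simp
  qed
  let ?S = "\<lambda>\<omega>. \<Sum>i\<in>A. Z i \<omega>"
  have sq: "(?S \<omega>)\<^sup>2 = (\<Sum>i\<in>A. \<Sum>j\<in>A. Z i \<omega> * Z j \<omega>)" for \<omega>
    by (simp add: power2_eq_square sum_product)
  have Sint: "integrable M (\<lambda>\<omega>. (?S \<omega>)\<^sup>2)" unfolding sq using ZZ by auto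
  have "expectation (\<lambda>\<omega>. (?S \<omega>)\<^sup>2) = (\<Sum>i\<in>A. \<Sum>j\<in>A. expectation (\<lambda>\<omega>. Z i \<omega> * Z j \<omega>))"
    unfolding sq using ZZ by (simp add: Bochner_Integration.integral_sum)
  also have "\<dots> \<le> (\<Sum>i\<in>A. \<Sum>j\<in>A. if i = j then V else 0)" using ZZ by (intro sum_mono) auto
  also have "\<dots> = real (card A) * V" using A by simp
  finally have var: "expectation (\<lambda>\<omega>. (?S \<omega>)\<^sup>2) \<le> real (card A) * V" .
  have ES: "expectation ?S = 0" using Zint by (simp add: Bochner_Integration.integral_sum)
  have "?S \<in> borel_measurable M" by (intro borel_measurable_sum Zmeas)
  from Chebyshev_inequality[OF this Sint e]
  have "prob {\<omega> \<in> space M. e \<le> \<bar>?S \<omega>\<bar>} \<le> expectation (\<lambda>\<omega>. (?S \<omega>)\<^sup>2) / e\<^sup>2" by (simp add: ES)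
  also have "\<dots> \<le> real (card A) * V / e\<^sup>2" using var by (intro divide_right_mono) auto
  also have "?S = (\<lambda>\<omega>. (\<Sum>i\<in>A. Y i \<omega>) - (\<Sum>i\<in>A. expectation (Y i)))"
    by (simp add: Z_def sum_subtractf)
  finally show ?thesis by simp
qed

lemma chebyshev_Pi_pmf:
  fixes D :: "'i \<Rightarrow> nat pmf"
  assumes A: "finite A" "B \<subseteq> A"
    and "\<And>i. i \<in> B \<Longrightarrow> integrable (D i) (\<lambda>n. (real n)\<^sup>2)"
    and "\<And>i. i \<in> B \<Longrightarrow> measure_pmf.expectation (D i) (\<lambda>n. (real n)\<^sup>2) \<le> V"
    and "\<And>i. i \<in> B \<Longrightarrow> measure_pmf.expectation (D i) real = m i"
    and e: "0 < e"
  shows "measure_pmf.prob (Pi_pmf A d D) {f. e \<le> \<bar>real (\<Sum>i\<in>B. f i) - (\<Sum>i\<in>B. m i)\<bar>} \<le> real (card B) * V / e\<^sup>2"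
proof -
  have B: "finite B" using A finite_subset by blast
  have "prob_space.indep_vars (measure_pmf (Pi_pmf A d D)) (\<lambda>_. count_space UNIV) (\<lambda>i f. f i) B"
    using indep_vars_Pi_pmf[OF A(1)] A(2)
    by (rule prob_space.indep_vars_subset[OF measure_pmf.prob_space_axioms])
  then have ind: "prob_space.indep_vars (measure_pmf (Pi_pmf A d D)) (\<lambda>_. borel) (\<lambda>i f. real (f i)) B"
    by (rule prob_space.indep_vars_compose2[OF measure_pmf.prob_space_axioms]) auto
  have comp: "D i = map_pmf (\<lambda>f. f i) (Pi_pmf A d D)" if "i \<in> B" for i
    using that A by (subst Pi_pmf_component) auto
  have E: "measure_pmf.expectation (Pi_pmf A d D) (\<lambda>f. g (f i)) = measure_pmf.expectation (D i) g"
    if "i \<in> B" for i and g :: "nat \<Rightarrow> real"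
    by (subst comp[OF that]) simp
  have I: "integrable (Pi_pmf A d D) (\<lambda>f. g (f i)) \<longleftrightarrow> integrable (D i) g"
    if "i \<in> B" for i and g :: "nat \<Rightarrow> real"
    by (subst comp[OF that]) simp
  have "measure_pmf.prob (Pi_pmf A d D) {f \<in> space (Pi_pmf A d D).
      e \<le> \<bar>(\<Sum>i\<in>B. real (f i)) - (\<Sum>i\<in>B. measure_pmf.expectation (Pi_pmf A d D) (\<lambda>f. real (f i)))\<bar>}
      \<le> real (card B) * V / e\<^sup>2"
    using assms by (intro measure_pmf.chebyshev_sum_indep B ind e)
      (auto simp: E[where g = "\<lambda>n. (real n)\<^sup>2"] I[where g = "\<lambda>n. (real n)\<^sup>2"])
  moreover have "(\<Sum>i\<in>B. measure_pmf.expectation (Pi_pmf A d D) (\<lambda>f. real (f i))) = (\<Sum>i\<in>B. m i)"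
    using assms by (intro sum.cong refl) (auto simp: E)
  ultimately show ?thesis by simp
qed

lemma bern_moments:
  assumes "0 \<le> q" "q \<le> 1"
  shows "integrable (bern q) (f :: nat \<Rightarrow> real)"
    and "measure_pmf.expectation (bern q) real = q"
    and "measure_pmf.expectation (bern q) (\<lambda>n. (real n)\<^sup>2) = q"
proof -
  have "finite (set_pmf (bern q))" using set_bern by (rule finite_subset) auto
  then show "integrable (bern q) f" by (rule integrable_measure_pmf_finite)
  show "measure_pmf.expectation (bern q) real = q"
    "measure_pmf.expectation (bern q) (\<lambda>n. (real n)\<^sup>2) = q"
    unfolding bern_def using assms by simp_all
qed

lemma geo_moments:
  assumes "0 \<le> \<rho>" "\<rho> < 1"
  shows "measure_pmf.expectation (geo \<rho>) real = \<rho> / (1 - \<rho>)"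
    and "integrable (geo \<rho>) (\<lambda>n. (real n)\<^sup>2)"
    and "measure_pmf.expectation (geo \<rho>) (\<lambda>n. (real n)\<^sup>2) \<le> 2 / (1 - \<rho>)\<^sup>2"
proof -
  show "measure_pmf.expectation (geo \<rho>) real = \<rho> / (1 - \<rho>)"
    unfolding geo_def using assms expectation_geometric_pmf[of "1 - \<rho>"] by simp
  let ?a = "\<lambda>n. pmf (geo \<rho>) n * (real n)\<^sup>2"
  have a: "?a n = (1 - \<rho>) * \<rho> ^ n * (real n)\<^sup>2" for n using assms by (simp add: pmf_geo)
  have nonneg: "0 \<le> ?a n" for n by simp
  have sums: "(\<lambda>n. \<rho> ^ n * real n) sums (\<rho> / (1 - \<rho>)\<^sup>2)"
    using geometric_sums_times_n[of \<rho>] assms by simp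
  \<comment> \<open>Summation by parts: differences of squares turn the second moment into twice the
    sum of \<open>\<rho> ^ n * real n\<close>. The boundary term
    \<open>(real N)\<^sup>2 * \<rho> ^ N\<close> is kept on the left to close the induction.\<close>
  have tele: "(\<Sum>n<N. ?a n) + (real N)\<^sup>2 * \<rho> ^ N \<le> (\<Sum>n<Suc N. 2 * (\<rho> ^ n * real n))" for N
  proof (induction N)
    case (Suc N)
    have "\<rho> ^ Suc N * (2 * real N + 1) \<le> \<rho> ^ Suc N * (2 * real (Suc N))"
      using assms by (intro mult_left_mono) auto
    moreover have "?a N + (real (Suc N))\<^sup>2 * \<rho> ^ Suc N - (real N)\<^sup>2 * \<rho> ^ N = \<rho> ^ Suc N * (2 * real N + 1)"
      unfolding a by (simp add: algebra_simps power2_eq_square)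
    moreover have "\<rho> ^ Suc N * (2 * real (Suc N)) = 2 * (\<rho> ^ Suc N * real (Suc N))" by simp
    ultimately show ?case using Suc
      unfolding sum.lessThan_Suc[of _ "Suc N"] sum.lessThan_Suc[of ?a N] by linarith
  qed simp
  have bound: "(\<Sum>n<N. ?a n) \<le> 2 * (\<rho> / (1 - \<rho>)\<^sup>2)" for N
  proof -
    have "(\<Sum>n<N. ?a n) \<le> (\<Sum>n<N. ?a n) + (real N)\<^sup>2 * \<rho> ^ N" using assms by simp
    also have "\<dots> \<le> (\<Sum>n<Suc N. 2 * (\<rho> ^ n * real n))" by (rule tele)
    also have "\<dots> \<le> 2 * (\<rho> / (1 - \<rho>)\<^sup>2)"
      using sums_mult[OF sums, of 2] assms
      by (intro sum_le_suminf[THEN order_trans]) (auto simp: sums_iff)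
    finally show ?thesis .
  qed
  have summ: "summable ?a" by (rule summableI_nonneg_bounded[OF nonneg bound])
  have intc: "integrable (count_space UNIV) ?a"
    using summ by (simp add: integrable_count_space_nat_iff)
  then show "integrable (geo \<rho>) (\<lambda>n. (real n)\<^sup>2)"
    unfolding measure_pmf_eq_density by (subst integrable_density) auto
  have "measure_pmf.expectation (geo \<rho>) (\<lambda>n. (real n)\<^sup>2) = (\<integral>n. ?a n \<partial>count_space UNIV)"
    unfolding measure_pmf_eq_density by (subst integral_density) auto
  also have "\<dots> = (\<Sum>n. ?a n)" using intc by (rule integral_count_space_nat)
  also have "\<dots> \<le> 2 * (\<rho> / (1 - \<rho>)\<^sup>2)" using summ bound by (rule suminf_le_const)
  also have "\<dots> \<le> 2 / (1 - \<rho>)\<^sup>2" using assms by (simp add: divide_right_mono)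
  finally show "measure_pmf.expectation (geo \<rho>) (\<lambda>n. (real n)\<^sup>2) \<le> 2 / (1 - \<rho>)\<^sup>2" .
qed

text \<open>A second-moment bound uniform over parameters up to \<open>r\<close>. It is at least 1
  for \<open>r\<close> in [0,1), so it also covers the Bernoulli sums.\<close>

definition geo_moment_bound :: "real \<Rightarrow> real" where
  "geo_moment_bound r = 2 / (1 - r)\<^sup>2"

lemma geo_moment_bound_ge_1: "0 \<le> r \<Longrightarrow> r < 1 \<Longrightarrow> 1 \<le> geo_moment_bound r"
  using power_le_one[of "1 - r" 2] unfolding geo_moment_bound_def by (simp add: field_simps)

section \<open>Deviations of boundary sums and of passage values above the mean\<close>

lemma bern_field_deviation:
  assumes "\<And>s. s < k \<Longrightarrow> 0 \<le> q s \<and> q s \<le> 1" "K \<le> k" "0 < e"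
  shows "measure_pmf.prob (bern_field k q) {I. e \<le> \<bar>real (\<Sum>s<K. I s) - (\<Sum>s<K. q s)\<bar>} \<le> real K / e\<^sup>2"
  using chebyshev_Pi_pmf[of "{..<k}" "{..<K}" "\<lambda>s. bern (q s)" 1 q e 0] assms
  by (simp add: bern_field_def bern_moments subset_iff)

lemma geo_field_deviation:
  assumes "\<And>t. t < l \<Longrightarrow> 0 \<le> \<rho> t \<and> \<rho> t \<le> r" "r < 1" "K \<le> l" "0 < e"
  shows "measure_pmf.prob (geo_field l \<rho>) {J. e \<le> \<bar>real (\<Sum>t<K. J t) - (\<Sum>t<K. \<rho> t / (1 - \<rho> t))\<bar>}
    \<le> real K * geo_moment_bound r / e\<^sup>2"
proof -
  have m: "measure_pmf.expectation (geo (\<rho> t)) (\<lambda>n. (real n)\<^sup>2) \<le> geo_moment_bound r" if "t < l" for t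
  proof -
    have "measure_pmf.expectation (geo (\<rho> t)) (\<lambda>n. (real n)\<^sup>2) \<le> 2 / (1 - \<rho> t)\<^sup>2"
      using assms(1)[OF that] assms(2) by (intro geo_moments) auto
    also have "\<dots> \<le> 2 / (1 - r)\<^sup>2"
      using assms(1)[OF that] assms(2) by (intro divide_left_mono power_mono mult_pos_pos) auto
    finally show ?thesis by (simp add: geo_moment_bound_def)
  qed
  have "measure_pmf.prob (Pi_pmf {..<l} 0 (\<lambda>t. geo (\<rho> t)))
      {f. e \<le> \<bar>real (\<Sum>i\<in>{..<K}. f i) - (\<Sum>i\<in>{..<K}. \<rho> i / (1 - \<rho> i))\<bar>}
      \<le> real (card {..<K}) * geo_moment_bound r / e\<^sup>2"
  proof (rule chebyshev_Pi_pmf)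
    fix i assume "i \<in> {..<K}"
    then have "i < l" using assms(3) by auto
    then have "0 \<le> \<rho> i" "\<rho> i < 1" using assms(1)[of i] assms(2) by auto
    then show "integrable (geo (\<rho> i)) (\<lambda>n. (real n)\<^sup>2)"
      "measure_pmf.expectation (geo (\<rho> i)) real = \<rho> i / (1 - \<rho> i)"
      by (auto intro: geo_moments)
    show "measure_pmf.expectation (geo (\<rho> i)) (\<lambda>n. (real n)\<^sup>2) \<le> geo_moment_bound r"
      using m \<open>i < l\<close> by blast
  qed (use assms in auto)
  then show ?thesis by (simp add: geo_field_def)
qed

text \<open>The common bound \<open>r\<close> below 1 on the geometric parameters makes all
  deviation estimates uniform in the environment.\<close>

definition stationary :: "nat \<Rightarrow> nat \<Rightarrow> (nat \<times> nat \<Rightarrow> real) \<Rightarrow> (nat \<Rightarrow> real) \<Rightarrow> (nat \<Rightarrow> real) \<Rightarrow> real \<Rightarrow> bool" where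
  "stationary k l P q \<rho> r \<longleftrightarrow> r < 1 \<and> (\<forall>s<k. 0 \<le> q s \<and> q s \<le> 1) \<and> (\<forall>t<l. 0 \<le> \<rho> t \<and> \<rho> t \<le> r) \<and>
     (\<forall>s<k. \<forall>t<l. 0 \<le> P (s, t) \<and> P (s, t) \<le> 1 \<and> P (s, t) * (1 - q s) = \<rho> t * q s * (1 - P (s, t)))"

definition stationary_mean :: "nat \<Rightarrow> nat \<Rightarrow> (nat \<Rightarrow> real) \<Rightarrow> (nat \<Rightarrow> real) \<Rightarrow> real" where
  "stationary_mean k l q \<rho> = (\<Sum>s<k. q s) + (\<Sum>t<l. \<rho> t / (1 - \<rho> t))"

text \<open>The left axis and the top edge each stay within \<open>e\<close> of their means outside
  a Chebyshev event. A union bound combines them, so their mutual dependence is harmless.\<close>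

lemma lpp_stationary_deviation:
  assumes st: "stationary k l P q \<rho> r" and r: "0 \<le> r" and e: "0 < e"
  defines "N \<equiv> pair_pmf (weights k l P) (pair_pmf (bern_field k q) (geo_field l \<rho>))"
  shows "measure_pmf.prob N {(w, I, J). 2 * e \<le> \<bar>real (lpp w I J k l) - stationary_mean k l q \<rho>\<bar>}
    \<le> real (k + l) * geo_moment_bound r / e\<^sup>2"
proof -
  let ?A = "{(w, I, J). e \<le> \<bar>real (\<Sum>s<k. outputs w I J l s) - (\<Sum>s<k. q s)\<bar>} :: ((nat \<times> nat \<Rightarrow> nat) \<times> (nat \<Rightarrow> nat) \<times> (nat \<Rightarrow> nat)) set"
  let ?B = "{(w, I, J). e \<le> \<bar>real (\<Sum>t<l. J t) - (\<Sum>t<l. \<rho> t / (1 - \<rho> t))\<bar>} :: ((nat \<times> nat \<Rightarrow> nat) \<times> (nat \<Rightarrow> nat) \<times> (nat \<Rightarrow> nat)) set"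
  let ?C = "{(w, I, J). 2 * e \<le> \<bar>real (lpp w I J k l) - stationary_mean k l q \<rho>\<bar>}"
  have r1: "r < 1" using st by (simp add: stationary_def)
  have sub: "?C \<subseteq> ?A \<union> ?B"
    by (auto simp: lpp_eq_sum_outputs stationary_mean_def simp del: of_nat_sum)
  have "map_pmf (\<lambda>(w, I, J). trunc k (outputs w I J l)) N = bern_field k q"
    using outputs_stationary[of k l P q \<rho>] st r1 unfolding N_def stationary_def
    by (simp add: pair_pmf_def map_pmf_def bind_assoc_pmf bind_return_pmf) force
  then have "measure_pmf.prob (bern_field k q) {I. e \<le> \<bar>real (\<Sum>s<k. I s) - (\<Sum>s<k. q s)\<bar>} =
      measure_pmf.prob N ((\<lambda>(w, I, J). trunc k (outputs w I J l)) -` {I. e \<le> \<bar>real (\<Sum>s<k. I s) - (\<Sum>s<k. q s)\<bar>})"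
    by (metis measure_map_pmf)
  also have "(\<lambda>(w, I, J). trunc k (outputs w I J l)) -` {I. e \<le> \<bar>real (\<Sum>s<k. I s) - (\<Sum>s<k. q s)\<bar>} = ?A"
    by (auto simp: trunc_def)
  finally have A: "measure_pmf.prob N ?A \<le> real k / e\<^sup>2"
    using bern_field_deviation[of k q k e] st e by (simp add: stationary_def)
  have "map_pmf (\<lambda>z. snd (snd z)) N = map_pmf snd (map_pmf snd N)" by (simp add: pmf.map_comp o_def)
  then have "map_pmf (\<lambda>z. snd (snd z)) N = geo_field l \<rho>" by (simp add: N_def map_snd_pair_pmf)
  then have "measure_pmf.prob (geo_field l \<rho>) {J. e \<le> \<bar>real (\<Sum>t<l. J t) - (\<Sum>t<l. \<rho> t / (1 - \<rho> t))\<bar>}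
     = measure_pmf.prob (map_pmf (\<lambda>z. snd (snd z)) N) {J. e \<le> \<bar>real (\<Sum>t<l. J t) - (\<Sum>t<l. \<rho> t / (1 - \<rho> t))\<bar>}"
    by simp
  also have "\<dots> = measure_pmf.prob N ?B"
    unfolding measure_map_pmf by (intro arg_cong[where f = "measure_pmf.prob N"]) auto
  finally have B: "measure_pmf.prob N ?B \<le> real l * geo_moment_bound r / e\<^sup>2"
    using geo_field_deviation[of l \<rho> r l e] st e by (simp add: stationary_def)
  have "measure_pmf.prob N ?C \<le> measure_pmf.prob N (?A \<union> ?B)" by (rule measure_pmf.finite_measure_mono[OF sub]) simp
  also have "\<dots> \<le> measure_pmf.prob N ?A + measure_pmf.prob N ?B" by (rule measure_Un_le) auto
  also have "\<dots> \<le> real k / e\<^sup>2 + real l * geo_moment_bound r / e\<^sup>2" using A B by linarith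
  also have "\<dots> \<le> real k * geo_moment_bound r / e\<^sup>2 + real l * geo_moment_bound r / e\<^sup>2"
    using geo_moment_bound_ge_1[OF r r1] mult_left_mono[of 1 "geo_moment_bound r" "real k"]
    by (intro add_right_mono divide_right_mono) auto
  finally show ?thesis by (simp add: add_divide_distrib distrib_right)
qed

text \<open>For the same weights, a zero boundary gives the smaller value, so the upper tail of the
  stationary value controls this one.\<close>

lemma lpp0_upper_deviation:
  assumes st: "stationary k l P q \<rho> r" and r: "0 \<le> r" and e: "0 < e"
  shows "measure_pmf.prob (weights k l P) {w. stationary_mean k l q \<rho> + 2 * e \<le> real (lpp0 w k l)}
    \<le> real (k + l) * geo_moment_bound r / e\<^sup>2"
proof -
  define N where "N = pair_pmf (weights k l P) (pair_pmf (bern_field k q) (geo_field l \<rho>))"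
  have "measure_pmf.prob (weights k l P) {w. stationary_mean k l q \<rho> + 2 * e \<le> real (lpp0 w k l)} =
     measure_pmf.prob (map_pmf fst N) {w. stationary_mean k l q \<rho> + 2 * e \<le> real (lpp0 w k l)}"
    by (simp add: N_def map_fst_pair_pmf)
  also have "\<dots> = measure_pmf.prob N {(w, I, J). stationary_mean k l q \<rho> + 2 * e \<le> real (lpp0 w k l)}"
    unfolding measure_map_pmf by (intro arg_cong[where f = "measure_pmf.prob N"]) auto
  also have "\<dots> \<le> measure_pmf.prob N {(w, I, J). 2 * e \<le> \<bar>real (lpp w I J k l) - stationary_mean k l q \<rho>\<bar>}"
  proof (rule measure_pmf.finite_measure_mono)
    have "real (lpp0 w k l) \<le> real (lpp w I J k l)" for w I J
      by (intro of_nat_mono lpp_mono) auto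
    then show "{(w, I, J). stationary_mean k l q \<rho> + 2 * e \<le> real (lpp0 w k l)}
      \<subseteq> {(w, I, J). 2 * e \<le> \<bar>real (lpp w I J k l) - stationary_mean k l q \<rho>\<bar>}"
      by (auto simp del: of_nat_le_iff) (smt (verit))
  qed simp
  also have "\<dots> \<le> real (k + l) * geo_moment_bound r / e\<^sup>2"
    unfolding N_def by (rule lpp_stationary_deviation[OF st r e])
  finally show ?thesis .
qed

section \<open>Monotone couplings and deviations below the mean\<close>

lemma map_pmf_fst_pair: "map_pmf (\<lambda>z. g (fst z)) (pair_pmf M N) = map_pmf g M"
  using pmf.map_comp[of g fst "pair_pmf M N"] by (simp add: map_fst_pair_pmf o_def)

lemma map_pmf_snd_pair: "map_pmf (\<lambda>z. g (snd z)) (pair_pmf M N) = map_pmf g N"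
  using pmf.map_comp[of g snd "pair_pmf M N"] by (simp add: map_snd_pair_pmf o_def)

text \<open>Thinning: keeping a success of parameter \<open>q'\<close> with probability
  \<open>q / q'\<close> leaves parameter \<open>q\<close>.\<close>

lemma bern_coupling:
  assumes "0 \<le> q" "q \<le> q'" "q' \<le> 1"
  shows "\<exists>c. map_pmf fst c = bern q \<and> map_pmf snd c = bern q' \<and> (\<forall>(a, b) \<in> set_pmf c. a \<le> b)"
proof -
  let ?N = "pair_pmf (bern q') (bern (q / q'))"
  have r: "0 \<le> q / q'" "q / q' \<le> 1" using assms by (auto simp: divide_le_eq_1)
  \<comment> \<open>For \<open>q' = 0\<close> the quotient is 0 by convention and
    \<open>q = 0\<close> as well, so the identity survives.\<close>
  have mult: "q' * (q / q') = q" using assms by auto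
  have "map_pmf (\<lambda>(b, a). min a b) ?N = bern q"
  proof (rule pmf_eqI)
    fix n
    have "pmf (map_pmf (\<lambda>(b, a). min a b) ?N) n =
      (1 - q') * ((1 - q / q') * indicator {0} n + (q / q') * indicator {0} n)
      + q' * ((1 - q / q') * indicator {0} n + (q / q') * indicator {1} n)"
      unfolding map_pmf_def pair_pmf_def bind_assoc_pmf bind_return_pmf
      using assms r by (simp add: pmf_bind_bern indicator_def)
    also have "\<dots> = (1 - q' * (q / q')) * indicator {0} n + q' * (q / q') * indicator {1} n"
      by (simp add: algebra_simps)
    also have "\<dots> = pmf (bern q) n"
      unfolding mult using assms by (simp add: pmf_bern indicator_def)
    finally show "pmf (map_pmf (\<lambda>(b, a). min a b) ?N) n = pmf (bern q) n" .
  qed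
  then show ?thesis
    by (intro exI[of _ "map_pmf (\<lambda>(b, a). (min a b, b)) ?N"])
      (auto simp: pmf.map_comp o_def case_prod_unfold map_fst_pair_pmf)
qed

lemma geo_tail:
  assumes "0 \<le> \<rho>" "\<rho> < 1"
  shows "measure_pmf.prob (geo \<rho>) {n..} = \<rho> ^ n"
proof -
  have "measure_pmf.prob (geo \<rho>) {..<n} = (\<Sum>i<n. (1 - \<rho>) * \<rho> ^ i)"
    using assms by (simp add: measure_measure_pmf_finite pmf_geo)
  also have "\<dots> = 1 - \<rho> ^ n" using assms by (induction n) (auto simp: algebra_simps)
  finally have "measure_pmf.prob (geo \<rho>) (UNIV - {..<n}) = \<rho> ^ n"
    by (subst measure_pmf.finite_measure_Diff) (auto simp: measure_pmf.prob_space[simplified])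
  then show ?thesis by (simp add: Compl_eq_Diff_UNIV[symmetric] Compl_lessThan)
qed

text \<open>The minimum of independent geometric variables is geometric with the product parameter.\<close>

lemma geo_coupling:
  assumes "0 \<le> \<rho>" "\<rho> \<le> \<rho>'" "\<rho>' < 1"
  shows "\<exists>c. map_pmf fst c = geo \<rho> \<and> map_pmf snd c = geo \<rho>' \<and> (\<forall>(a, b) \<in> set_pmf c. a \<le> b)"
proof (cases "\<rho> = \<rho>'")
  case True
  then show ?thesis
    by (intro exI[of _ "map_pmf (\<lambda>a. (a, a)) (geo \<rho>)"]) (auto simp: pmf.map_comp o_def)
next
  case False
  then have r: "0 \<le> \<rho> / \<rho>'" "\<rho> / \<rho>' < 1" "\<rho>' \<noteq> 0" using assms by (auto simp: divide_less_eq_1)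
  let ?N = "pair_pmf (geo \<rho>') (geo (\<rho> / \<rho>'))"
  let ?m = "map_pmf (\<lambda>(b, a). min a b) ?N"
  have tail: "measure_pmf.prob ?m {n..} = \<rho> ^ n" for n
  proof -
    have "(\<lambda>(b, a). min a b) -` {n..} = {n..} \<times> {n..}" by auto
    then have "measure_pmf.prob ?m {n..} = \<rho>' ^ n * (\<rho> / \<rho>') ^ n"
      using assms r by (simp add: measure_pmf_prob_product geo_tail)
    then show ?thesis using r(3) by (simp add: power_mult_distrib[symmetric])
  qed
  have pmf_tail: "pmf N n = measure_pmf.prob N {n..} - measure_pmf.prob N {Suc n..}" for N :: "nat pmf" and n
  proof -
    have "{n} = {n..} - {Suc n..}" by auto
    then have "measure_pmf.prob N {n} = measure_pmf.prob N {n..} - measure_pmf.prob N {Suc n..}"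
      by (subst measure_pmf.finite_measure_Diff[symmetric]) auto
    then show ?thesis by (simp add: measure_pmf_single)
  qed
  have "?m = geo \<rho>"
    by (rule pmf_eqI) (use assms in \<open>simp only: pmf_tail tail geo_tail\<close>)
  then show ?thesis
    by (intro exI[of _ "map_pmf (\<lambda>(b, a). (min a b, b)) ?N"])
      (auto simp: pmf.map_comp o_def case_prod_unfold map_fst_pair_pmf)
qed

text \<open>Couples the weights site by site. This is how lower bounds proved for capped
  probabilities pass to the true ones.\<close>

lemma weights_mono:
  assumes "\<And>z. z \<in> {..<k} \<times> {..<l} \<Longrightarrow> 0 \<le> P' z \<and> P' z \<le> P z \<and> P z \<le> 1"
  shows "measure_pmf.prob (weights k l P) {w. real (lpp0 w k l) \<le> c}
    \<le> measure_pmf.prob (weights k l P') {w. real (lpp0 w k l) \<le> c}"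
proof -
  let ?A = "{..<k} \<times> {..<l}"
  have "\<forall>z. \<exists>d. z \<in> ?A \<longrightarrow> map_pmf fst d = bern (P' z) \<and> map_pmf snd d = bern (P z) \<and> (\<forall>(a, b) \<in> set_pmf d. a \<le> b)"
    using assms bern_coupling by meson
  then obtain d where d: "\<And>z. z \<in> ?A \<Longrightarrow> map_pmf fst (d z) = bern (P' z)"
    "\<And>z. z \<in> ?A \<Longrightarrow> map_pmf snd (d z) = bern (P z)"
    "\<And>z. z \<in> ?A \<Longrightarrow> \<forall>(a, b) \<in> set_pmf (d z). a \<le> b" by metis
  define N where "N = Pi_pmf ?A (0, 0) d"
  have 1: "weights k l P' = map_pmf (\<lambda>h. fst \<circ> h) N"
    unfolding weights_def N_def by (subst Pi_pmf_map[symmetric]) (auto intro!: Pi_pmf_cong simp: d)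
  have 2: "weights k l P = map_pmf (\<lambda>h. snd \<circ> h) N"
    unfolding weights_def N_def by (subst Pi_pmf_map[symmetric]) (auto intro!: Pi_pmf_cong simp: d)
  have "lpp0 (fst \<circ> h) k l \<le> lpp0 (snd \<circ> h) k l" if "h \<in> set_pmf N" for h
  proof (rule lpp_mono)
    fix s t assume "s < k" "t < l"
    then have "h (s, t) \<in> set_pmf (d (s, t))" using that by (simp add: N_def set_Pi_pmf PiE_dflt_def)
    then show "(fst \<circ> h) (s, t) \<le> (snd \<circ> h) (s, t)" using d(3)[of "(s, t)"] \<open>s < k\<close> \<open>t < l\<close> by auto
  qed auto
  then have "measure_pmf.prob N {h. real (lpp0 (snd \<circ> h) k l) \<le> c}
      \<le> measure_pmf.prob N {h. real (lpp0 (fst \<circ> h) k l) \<le> c}"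
    by (intro measure_pmf.finite_measure_mono_AE AE_pmfI) (auto intro: order_trans[OF of_nat_mono])
  then show ?thesis by (simp add: 1 2 vimage_def)
qed

text \<open>Places three boundaries on one probability space and applies
  \<open>lpp_exit_bound\<close>. \<open>gain1\<close> and \<open>gain2\<close> make its first two
  alternatives contradict concentration; the third is the claim. The slack \<open>6 * e\<close> pays
  for two passage values at \<open>2 * e\<close> and two partial sums at \<open>e\<close>; in the
  conclusion \<open>3 * e\<close> pays for one passage value and one partial sum.\<close>

lemma lpp0_lower_deviation:
  assumes st: "stationary k l P q \<rho> r" "stationary k l P q1 \<rho>1 r" "stationary k l P q2 \<rho>2 r"
    and r: "0 \<le> r" and e: "0 < e" and K: "K \<le> k" "K' \<le> l"
    and le: "\<And>s. s < k \<Longrightarrow> q s \<le> q1 s" "\<And>t. t < l \<Longrightarrow> \<rho> t \<le> \<rho>2 t"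
    and gain1: "stationary_mean k l q1 \<rho>1 - stationary_mean k l q \<rho> + 6 * e \<le> (\<Sum>s<K. q1 s) - (\<Sum>s<K. q s)"
    and gain2: "stationary_mean k l q2 \<rho>2 - stationary_mean k l q \<rho> + 6 * e
      \<le> (\<Sum>t<K'. \<rho>2 t / (1 - \<rho>2 t)) - (\<Sum>t<K'. \<rho> t / (1 - \<rho> t))"
  shows "measure_pmf.prob (weights k l P)
      {w. real (lpp0 w k l) \<le> stationary_mean k l q \<rho> - (3 * e + real K + (\<Sum>t<K'. \<rho> t / (1 - \<rho> t)))}
    \<le> 7 * (real (k + l) * geo_moment_bound r / e\<^sup>2)"
proof -
  \<comment> \<open>Only \<open>q\<close> and \<open>q1\<close> have to be ordered, so the variable
    of parameter \<open>q2\<close> is attached independently. For the geometric variables below, it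
    is \<rho> and \<open>\<rho>2\<close> that are ordered.\<close>
  have "\<exists>c. s < k \<longrightarrow> map_pmf fst c = bern (q s) \<and> map_pmf (\<lambda>z. fst (snd z)) c = bern (q1 s) \<and>
      map_pmf (\<lambda>z. snd (snd z)) c = bern (q2 s) \<and> (\<forall>z\<in>set_pmf c. fst z \<le> fst (snd z))" for s
  proof (cases "s < k")
    case True
    then obtain d where "map_pmf fst d = bern (q s)" "map_pmf snd d = bern (q1 s)" "\<forall>(a, b) \<in> set_pmf d. a \<le> b"
      using bern_coupling[of "q s" "q1 s"] st le unfolding stationary_def by blast
    then show ?thesis
      by (intro exI[of _ "map_pmf (\<lambda>((a, b), c). (a, b, c)) (pair_pmf d (bern (q2 s)))"])
        (auto simp: pmf.map_comp o_def case_prod_unfold map_snd_pair_pmf map_pmf_fst_pair)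
  qed simp
  then obtain cI where cI: "\<And>s. s < k \<Longrightarrow> map_pmf fst (cI s) = bern (q s)"
    "\<And>s. s < k \<Longrightarrow> map_pmf (\<lambda>z. fst (snd z)) (cI s) = bern (q1 s)"
    "\<And>s. s < k \<Longrightarrow> map_pmf (\<lambda>z. snd (snd z)) (cI s) = bern (q2 s)"
    "\<And>s z. s < k \<Longrightarrow> z \<in> set_pmf (cI s) \<Longrightarrow> fst z \<le> fst (snd z)"
    by metis
  have "\<exists>c. t < l \<longrightarrow> map_pmf fst c = geo (\<rho> t) \<and> map_pmf (\<lambda>z. fst (snd z)) c = geo (\<rho>1 t) \<and>
      map_pmf (\<lambda>z. snd (snd z)) c = geo (\<rho>2 t) \<and> (\<forall>z\<in>set_pmf c. fst z \<le> snd (snd z))" for t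
  proof (cases "t < l")
    case True
    then have "0 \<le> \<rho> t" "\<rho> t \<le> \<rho>2 t" "\<rho>2 t < 1" using st le unfolding stationary_def by fastforce+
    then obtain d where "map_pmf fst d = geo (\<rho> t)" "map_pmf snd d = geo (\<rho>2 t)" "\<forall>(a, b) \<in> set_pmf d. a \<le> b"
      using geo_coupling[of "\<rho> t" "\<rho>2 t"] by blast
    then show ?thesis
      by (intro exI[of _ "map_pmf (\<lambda>((a, b), c). (a, c, b)) (pair_pmf d (geo (\<rho>1 t)))"])
        (auto simp: pmf.map_comp o_def case_prod_unfold map_snd_pair_pmf map_pmf_fst_pair)
  qed simp
  then obtain cJ where cJ: "\<And>s. s < l \<Longrightarrow> map_pmf fst (cJ s) = geo (\<rho> s)"
    "\<And>s. s < l \<Longrightarrow> map_pmf (\<lambda>z. fst (snd z)) (cJ s) = geo (\<rho>1 s)"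
    "\<And>s. s < l \<Longrightarrow> map_pmf (\<lambda>z. snd (snd z)) (cJ s) = geo (\<rho>2 s)"
    "\<And>s z. s < l \<Longrightarrow> z \<in> set_pmf (cJ s) \<Longrightarrow> fst z \<le> snd (snd z)"
    by metis
  define FI where "FI = Pi_pmf {..<k} (0, 0, 0) cI"
  define FJ where "FJ = Pi_pmf {..<l} (0, 0, 0) cJ"
  define N where "N = pair_pmf (weights k l P) (pair_pmf FI FJ)"
  define B where "B = real (k + l) * geo_moment_bound r / e\<^sup>2"
  have r1: "r < 1" using st by (simp add: stationary_def)
  have FI: "map_pmf (\<lambda>f s. a (f s)) FI = bern_field k q'"
    if "a (0, 0, 0) = 0" "\<And>s. s < k \<Longrightarrow> map_pmf a (cI s) = bern (q' s)" for a q'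
  proof -
    have "bern_field k q' = Pi_pmf {..<k} 0 (\<lambda>s. map_pmf a (cI s))"
      unfolding bern_field_def using that by (intro Pi_pmf_cong) auto
    also have "\<dots> = map_pmf (\<lambda>h. a \<circ> h) FI"
      unfolding FI_def using that by (intro Pi_pmf_map) auto
    finally show ?thesis by (simp add: o_def)
  qed
  have FJ: "map_pmf (\<lambda>f s. a (f s)) FJ = geo_field l \<rho>'"
    if "a (0, 0, 0) = 0" "\<And>s. s < l \<Longrightarrow> map_pmf a (cJ s) = geo (\<rho>' s)" for a \<rho>'
  proof -
    have "geo_field l \<rho>' = Pi_pmf {..<l} 0 (\<lambda>s. map_pmf a (cJ s))"
      unfolding geo_field_def using that by (intro Pi_pmf_cong) auto
    also have "\<dots> = map_pmf (\<lambda>h. a \<circ> h) FJ"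
      unfolding FJ_def using that by (intro Pi_pmf_map) auto
    finally show ?thesis by (simp add: o_def)
  qed
  have NFI: "map_pmf (\<lambda>z. fst (snd z)) N = FI" and NFJ: "map_pmf (\<lambda>z. snd (snd z)) N = FJ"
    unfolding N_def by (simp_all add: map_pmf_snd_pair map_snd_pair_pmf map_fst_pair_pmf)
  have dev: "measure_pmf.prob N {(w, f, g). 2 * e \<le> \<bar>real (lpp w (\<lambda>s. a (f s)) (\<lambda>t. b (g t)) k l) - stationary_mean k l q' \<rho>'\<bar>} \<le> B"
    if st': "stationary k l P q' \<rho>' r" and a: "map_pmf (\<lambda>f s. a (f s)) FI = bern_field k q'"
      and b: "map_pmf (\<lambda>f s. b (f s)) FJ = geo_field l \<rho>'" for a b q' \<rho>'
  proof -
    have "map_pmf (\<lambda>(w, f, g). (w, \<lambda>s. a (f s), \<lambda>t. b (g t))) N =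
        pair_pmf (map_pmf id (weights k l P)) (pair_pmf (bern_field k q') (geo_field l \<rho>'))"
      unfolding N_def a[symmetric] b[symmetric] map_pair[symmetric] by (simp add: case_prod_unfold)
    then have "measure_pmf.prob (pair_pmf (weights k l P) (pair_pmf (bern_field k q') (geo_field l \<rho>')))
      {(w, I, J). 2 * e \<le> \<bar>real (lpp w I J k l) - stationary_mean k l q' \<rho>'\<bar>} =
      measure_pmf.prob (map_pmf (\<lambda>(w, f, g). (w, \<lambda>s. a (f s), \<lambda>t. b (g t))) N)
      {(w, I, J). 2 * e \<le> \<bar>real (lpp w I J k l) - stationary_mean k l q' \<rho>'\<bar>}" by simp
    also have "\<dots> = measure_pmf.prob N {(w, f, g). 2 * e \<le> \<bar>real (lpp w (\<lambda>s. a (f s)) (\<lambda>t. b (g t)) k l) - stationary_mean k l q' \<rho>'\<bar>}"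
      unfolding measure_map_pmf by (intro arg_cong[where f = "measure_pmf.prob N"]) auto
    finally show ?thesis using lpp_stationary_deviation[OF st' r e] by (simp add: B_def)
  qed
  have V: "1 \<le> geo_moment_bound r" using r r1 by (rule geo_moment_bound_ge_1)
  have devI: "measure_pmf.prob N {z. e \<le> \<bar>real (\<Sum>s<K. a (fst (snd z) s)) - (\<Sum>s<K. q' s)\<bar>} \<le> B"
    if "stationary k l P q' \<rho>' r" and a: "map_pmf (\<lambda>f s. a (f s)) FI = bern_field k q'" for a q' \<rho>'
  proof -
    have "map_pmf (\<lambda>z s. a (fst (snd z) s)) N = map_pmf (\<lambda>f s. a (f s)) (map_pmf (\<lambda>z. fst (snd z)) N)"
      by (simp add: pmf.map_comp o_def)
    also have "\<dots> = bern_field k q'" unfolding NFI a ..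
    finally have "measure_pmf.prob (map_pmf (\<lambda>z s. a (fst (snd z) s)) N) {I. e \<le> \<bar>real (\<Sum>s<K. I s) - (\<Sum>s<K. q' s)\<bar>} \<le> real K / e\<^sup>2"
      using bern_field_deviation[of k q' K e] that(1) K e by (simp add: stationary_def)
    moreover have "real K * 1 \<le> real (k + l) * geo_moment_bound r" using V K by (intro mult_mono) auto
    then have "real K / e\<^sup>2 \<le> B" unfolding B_def by (intro divide_right_mono) auto
    ultimately show ?thesis by (simp add: vimage_def)
  qed
  have devJ: "measure_pmf.prob N {z. e \<le> \<bar>real (\<Sum>t<K'. a (snd (snd z) t)) - (\<Sum>t<K'. \<rho>' t / (1 - \<rho>' t))\<bar>} \<le> B"
    if "stationary k l P q' \<rho>' r" and a: "map_pmf (\<lambda>f s. a (f s)) FJ = geo_field l \<rho>'" for a q' \<rho>'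
  proof -
    have "map_pmf (\<lambda>z s. a (snd (snd z) s)) N = map_pmf (\<lambda>f s. a (f s)) (map_pmf (\<lambda>z. snd (snd z)) N)"
      by (simp add: pmf.map_comp o_def)
    also have "\<dots> = geo_field l \<rho>'" unfolding NFJ a ..
    finally have "measure_pmf.prob (map_pmf (\<lambda>z s. a (snd (snd z) s)) N) {J. e \<le> \<bar>real (\<Sum>t<K'. J t) - (\<Sum>t<K'. \<rho>' t / (1 - \<rho>' t))\<bar>}
       \<le> real K' * geo_moment_bound r / e\<^sup>2"
      using geo_field_deviation[of l \<rho>' r K' e] that(1) K e by (simp add: stationary_def)
    moreover have "real K' * geo_moment_bound r \<le> real (k + l) * geo_moment_bound r" using V K by (intro mult_right_mono) auto
    then have "real K' * geo_moment_bound r / e\<^sup>2 \<le> B" unfolding B_def by (intro divide_right_mono) auto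
    ultimately show ?thesis by (simp add: vimage_def)
  qed
  note FI0 = FI[of fst q, OF _ cI(1), simplified] and FI1 = FI[of "\<lambda>z. fst (snd z)" q1, OF _ cI(2), simplified]
    and FI2 = FI[of "\<lambda>z. snd (snd z)" q2, OF _ cI(3), simplified]
  note FJ0 = FJ[of fst \<rho>, OF _ cJ(1), simplified] and FJ1 = FJ[of "\<lambda>z. fst (snd z)" \<rho>1, OF _ cJ(2), simplified]
    and FJ2 = FJ[of "\<lambda>z. snd (snd z)" \<rho>2, OF _ cJ(3), simplified]
  define m0 where "m0 = stationary_mean k l q \<rho>"
  define m1 where "m1 = stationary_mean k l q1 \<rho>1"
  define m2 where "m2 = stationary_mean k l q2 \<rho>2"
  \<comment> \<open>Seven bad events: three passage values, and the four partial sums that occur in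
    the exit bound.\<close>
  define A where "A i = (if i = 0 then {(w, f, g). 2 * e \<le> \<bar>real (lpp w (\<lambda>s. fst (f s)) (\<lambda>t. fst (g t)) k l) - m0\<bar>}
      else if i = 1 then {(w, f, g). 2 * e \<le> \<bar>real (lpp w (\<lambda>s. fst (snd (f s))) (\<lambda>t. fst (snd (g t))) k l) - m1\<bar>}
      else if i = 2 then {(w, f, g). 2 * e \<le> \<bar>real (lpp w (\<lambda>s. snd (snd (f s))) (\<lambda>t. snd (snd (g t))) k l) - m2\<bar>}
      else if i = 3 then {z. e \<le> \<bar>real (\<Sum>s<K. fst (fst (snd z) s)) - (\<Sum>s<K. q s)\<bar>}
      else if i = 4 then {z. e \<le> \<bar>real (\<Sum>s<K. fst (snd (fst (snd z) s))) - (\<Sum>s<K. q1 s)\<bar>}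
      else if i = 5 then {z. e \<le> \<bar>real (\<Sum>t<K'. fst (snd (snd z) t)) - (\<Sum>t<K'. \<rho> t / (1 - \<rho> t))\<bar>}
      else {z. e \<le> \<bar>real (\<Sum>t<K'. snd (snd (snd (snd z) t))) - (\<Sum>t<K'. \<rho>2 t / (1 - \<rho>2 t))\<bar>})" for i :: nat
  have AB: "measure_pmf.prob N (A i) \<le> B" for i
    unfolding A_def m0_def m1_def m2_def
    using dev[OF st(1) FI0 FJ0] dev[OF st(2) FI1 FJ1] dev[OF st(3) FI2 FJ2]
      devI[OF st(1) FI0] devI[OF st(2) FI1] devJ[OF st(1) FJ0] devJ[OF st(3) FJ2]
    by simp
  let ?T = "m0 - (3 * e + real K + (\<Sum>t<K'. \<rho> t / (1 - \<rho> t)))"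
  have "measure_pmf.prob (weights k l P) {w. real (lpp0 w k l) \<le> ?T} = measure_pmf.prob (map_pmf fst N) {w. real (lpp0 w k l) \<le> ?T}"
    unfolding N_def map_fst_pair_pmf ..
  also have "\<dots> = measure_pmf.prob N {z. real (lpp0 (fst z) k l) \<le> ?T}" by (simp add: vimage_def)
  also have "\<dots> \<le> measure_pmf.prob N (\<Union>i<7. A i)"
  proof (intro measure_pmf.finite_measure_mono_AE AE_pmfI impI)
    fix z assume z: "z \<in> set_pmf N" and zT: "z \<in> {z. real (lpp0 (fst z) k l) \<le> ?T}"
    obtain w f g where wfg: "z = (w, f, g)" by (cases z) auto
    have f: "fst (f s) \<le> fst (snd (f s))" if "s < k" for s
      using z that cI(4)[OF that, of "f s"] unfolding wfg N_def FI_def by (auto simp: set_Pi_pmf PiE_dflt_def)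
    have g: "fst (g s) \<le> snd (snd (g s))" if "s < l" for s
      using z that cJ(4)[OF that, of "g s"] unfolding wfg N_def FJ_def by (auto simp: set_Pi_pmf PiE_dflt_def)
    show "z \<in> (\<Union>i<7. A i)"
    proof (rule ccontr)
      assume "z \<notin> (\<Union>i<7. A i)"
      then have nA: "z \<notin> A i" if "i < 7" for i using that by blast
      let ?L0 = "lpp w (\<lambda>s. fst (f s)) (\<lambda>t. fst (g t)) k l"
      let ?L1 = "lpp w (\<lambda>s. fst (snd (f s))) (\<lambda>t. fst (snd (g t))) k l"
      let ?L2 = "lpp w (\<lambda>s. snd (snd (f s))) (\<lambda>t. snd (snd (g t))) k l"
      let ?I0 = "\<Sum>s<K. fst (f s)" and ?I1 = "\<Sum>s<K. fst (snd (f s))"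
      let ?J0 = "\<Sum>t<K'. fst (g t)" and ?J2 = "\<Sum>t<K'. snd (snd (g t))"
      have "int ?L0 \<le> max (int ?L1 - (int ?I1 - int ?I0)) (max (int ?L2 - (int ?J2 - int ?J0))
          (int (lpp0 w k l) + int ?I0 + int ?J0))"
        using f g by (rule lpp_exit_bound)
      then have "?L0 + ?I1 \<le> ?L1 + ?I0 \<or> ?L0 + ?J2 \<le> ?L2 + ?J0 \<or> ?L0 \<le> lpp0 w k l + ?I0 + ?J0"
        unfolding le_max_iff_disj by linarith
      then have "real ?L0 + real ?I1 \<le> real ?L1 + real ?I0 \<or> real ?L0 + real ?J2 \<le> real ?L2 + real ?J0
          \<or> real ?L0 \<le> real (lpp0 w k l) + real ?I0 + real ?J0"
        by (simp only: of_nat_add[symmetric] of_nat_le_iff)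
      moreover have "\<bar>real ?L0 - m0\<bar> < 2 * e" "\<bar>real ?L1 - m1\<bar> < 2 * e" "\<bar>real ?L2 - m2\<bar> < 2 * e"
        using nA[of 0] nA[of 1] nA[of 2] unfolding wfg A_def by auto
      moreover have "\<bar>real ?I0 - (\<Sum>s<K. q s)\<bar> < e" "\<bar>real ?I1 - (\<Sum>s<K. q1 s)\<bar> < e"
        "\<bar>real ?J0 - (\<Sum>t<K'. \<rho> t / (1 - \<rho> t))\<bar> < e" "\<bar>real ?J2 - (\<Sum>t<K'. \<rho>2 t / (1 - \<rho>2 t))\<bar> < e"
        using nA[of 3] nA[of 4] nA[of 5] nA[of 6] unfolding wfg A_def by (auto simp del: of_nat_sum)
      \<comment> \<open>Bernoulli variables are at most 1, so this part of the loss is bounded by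
        \<open>K\<close> with certainty.\<close>
      moreover have "?I0 \<le> K"
      proof -
        have "fst (f s) \<le> 1" if "s < k" for s
        proof -
          have "f s \<in> set_pmf (cI s)" using z that unfolding wfg N_def FI_def by (auto simp: set_Pi_pmf PiE_dflt_def)
          then have "fst (f s) \<in> set_pmf (bern (q s))" unfolding cI(1)[OF that, symmetric] by auto
          then show ?thesis using set_bern[of "q s"] by auto
        qed
        then have "?I0 \<le> (\<Sum>s<K. 1)" using K by (intro sum_mono) auto
        then show ?thesis by simp
      qed
      then have "real ?I0 \<le> real K" by linarith
      moreover have "real (lpp0 w k l) \<le> ?T" using zT wfg by simp
      ultimately show False using gain1 gain2 unfolding m0_def[symmetric] m1_def[symmetric] m2_def[symmetric]
        by (smt (verit))
    qed
  qed simp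
  also have "\<dots> \<le> (\<Sum>i<7. measure_pmf.prob N (A i))"
    by (rule measure_pmf.finite_measure_subadditive_finite) auto
  also have "\<dots> \<le> (\<Sum>i<(7::nat). B)" by (intro sum_mono AB)
  finally show ?thesis by (simp add: B_def m0_def)
qed

subsection \<open>From fixed to random environments\<close>

lemma borel_measurable_lpp0:
  assumes "\<And>z. (\<lambda>\<omega>. real (w \<omega> z)) \<in> borel_measurable M"
  shows "(\<lambda>\<omega>. real (lpp0 (w \<omega>) k l)) \<in> borel_measurable M"
proof (induction k arbitrary: l)
  case 0 then show ?case by (simp add: lpp_0_left)
next
  case (Suc k)
  note IH = this
  show ?case
  proof (induction l)
    case 0 then show ?case by simp
  next
    case (Suc l)
    have "(\<lambda>\<omega>. max (real (lpp0 (w \<omega>) k (Suc l)) + real (w \<omega> (k, l))) (real (lpp0 (w \<omega>) (Suc k) l)))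
        \<in> borel_measurable M"
      by (intro borel_measurable_max borel_measurable_add IH Suc assms)
    then show ?case by (simp add: of_nat_max)
  qed
qed

lemma (in prob_space) AE_eventually_not_in:
  assumes "\<And>m. A m \<in> sets M" "\<And>m. nmin \<le> m \<Longrightarrow> prob (A m) \<le> C / (real m)\<^sup>2"
  shows "AE \<omega> in M. eventually (\<lambda>m. \<omega> \<notin> A m) sequentially"
proof -
  have "summable (\<lambda>m. C / (real m)\<^sup>2)"
    using summable_mult[OF inverse_power_summable[of 2, where 'a = real], of C]
    by (simp add: divide_inverse)
  then have "summable (\<lambda>m. measure M (A m))"
    by (rule summable_comparison_test'[of _ nmin]) (use assms(2) in auto)
  then have "AE \<omega> in M. eventually (\<lambda>m. \<omega> \<in> space M - A m) sequentially"
    by (intro borel_cantelli_AE1) (auto simp: assms(1) emeasure_eq_measure)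
  then show ?thesis by (rule AE_mp) (auto elim: eventually_mono intro!: AE_I2)
qed

lemma nat_floor_sqrt_bounds:
  fixes n :: nat
  defines "m \<equiv> nat \<lfloor>sqrt n\<rfloor>"
  shows "m\<^sup>2 \<le> n" "n \<le> (m + 1)\<^sup>2" "sqrt n - 1 \<le> m" "real m \<le> sqrt n"
proof -
  have *: "real m \<le> sqrt n" "sqrt n < real m + 1"
    unfolding m_def by simp_all
  show "real m \<le> sqrt n" "sqrt n - 1 \<le> m" using * by auto
  have "(real m)\<^sup>2 \<le> (sqrt n)\<^sup>2" using * by (intro power_mono) auto
  then have "real (m\<^sup>2) \<le> real n" by simp
  then show "m\<^sup>2 \<le> n" by linarith
  have "(sqrt n)\<^sup>2 \<le> (real m + 1)\<^sup>2" using * by (intro power_mono) auto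
  then have "real n \<le> real ((m + 1)\<^sup>2)" by (simp add: add.commute)
  then show "n \<le> (m + 1)\<^sup>2" by linarith
qed

lemma eventually_sqrt_small:
  fixes e c :: real
  assumes "0 < e"
  shows "eventually (\<lambda>n::nat. c * (2 * sqrt n + 1) \<le> e * n) sequentially"
  using assms by real_asymp


text \<open>A bound of order 1/n is summable along squares. The largest square below
  \<open>n\<close> differs from \<open>n\<close> by order sqrt n, a relative error that the margin
  \<open>e\<close> absorbs.\<close>

lemma (in prob_space) AE_liminf_of_squares:
  fixes S :: "nat \<Rightarrow> 'a \<Rightarrow> real" and L e C :: real
  assumes meas: "\<And>n. S n \<in> borel_measurable M"
    and mono: "\<And>\<omega> m n. \<omega> \<in> space M \<Longrightarrow> m \<le> n \<Longrightarrow> S m \<omega> \<le> S n \<omega>"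
    and nonneg: "\<And>\<omega> n. \<omega> \<in> space M \<Longrightarrow> 0 \<le> S n \<omega>"
    and bound: "\<And>n. nmin \<le> n \<Longrightarrow> prob {\<omega> \<in> space M. S n \<omega> \<le> L * n} \<le> C / n"
    and e: "0 < e"
  shows "AE \<omega> in M. eventually (\<lambda>n. (L - e) * n \<le> S n \<omega>) sequentially"
proof -
  let ?A = "\<lambda>m. {\<omega> \<in> space M. S (m\<^sup>2) \<omega> \<le> L * real (m\<^sup>2)}"
  have "AE \<omega> in M. eventually (\<lambda>m. \<omega> \<notin> ?A m) sequentially"
  proof (rule AE_eventually_not_in)
    show "?A m \<in> sets M" for m using meas[of "m\<^sup>2"] by measurable
    show "prob (?A m) \<le> C / (real m)\<^sup>2" if "nmin \<le> m" for m
      using bound[of "m\<^sup>2"] that power2_nat_le_imp_le[of m "m\<^sup>2"]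
      by (metis le_square le_trans of_nat_power power2_eq_square)
  qed
  then show ?thesis
  proof (rule AE_mp, intro AE_I2 impI)
    fix \<omega> assume \<omega>: "\<omega> \<in> space M" and "eventually (\<lambda>m. \<omega> \<notin> ?A m) sequentially"
    then have ev: "eventually (\<lambda>m. L * real (m\<^sup>2) \<le> S (m\<^sup>2) \<omega>) sequentially"
      by (auto elim!: eventually_mono)
    have "filterlim (\<lambda>n::nat. nat \<lfloor>sqrt n\<rfloor>) at_top sequentially" by real_asymp
    then have "eventually (\<lambda>n. L * real ((nat \<lfloor>sqrt (real n)\<rfloor>)\<^sup>2) \<le> S ((nat \<lfloor>sqrt (real n)\<rfloor>)\<^sup>2) \<omega>) sequentially"
      by (rule eventually_compose_filterlim[OF ev])
    then show "eventually (\<lambda>n. (L - e) * n \<le> S n \<omega>) sequentially"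
      using eventually_sqrt_small[OF e, of L] eventually_ge_at_top[of 1]
    proof eventually_elim
      case (elim n)
      let ?m = "nat \<lfloor>sqrt (real n)\<rfloor>"
      show ?case
      \<comment> \<open>The comparison with a square is multiplied by \<open>L\<close>, which
        preserves it only for positive \<open>L\<close>; otherwise nonnegativity of \<open>S\<close>
        suffices.\<close>
      proof (cases "L \<le> 0")
        case True
        then have "(L - e) * n \<le> 0" using e by (intro mult_nonpos_nonneg) auto
        then show ?thesis using nonneg[OF \<omega>, of n] by linarith
      next
        case False
        have m: "?m\<^sup>2 \<le> n" "sqrt n - 1 \<le> ?m" by (rule nat_floor_sqrt_bounds)+
        have "1 \<le> sqrt n" using elim by simp
        then have "(sqrt n - 1)\<^sup>2 \<le> (real ?m)\<^sup>2" using m by (intro power_mono) auto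
        then have "real n - (2 * sqrt n + 1) \<le> (real ?m)\<^sup>2" by (simp add: power2_diff)
        then have "L * (real n - (2 * sqrt n + 1)) \<le> L * (real ?m)\<^sup>2" using False by (intro mult_left_mono) auto
        then have "(L - e) * n \<le> L * (real ?m)\<^sup>2" using elim by (simp add: algebra_simps)
        also have "\<dots> \<le> S (?m\<^sup>2) \<omega>" using elim by simp
        also have "\<dots> \<le> S n \<omega>" by (rule mono[OF \<omega> m(1)])
        finally show ?thesis .
      qed
    qed
  qed
qed

text \<open>Monotonicity now points to a square above \<open>n\<close>, still within order sqrt n of
  it.\<close>

lemma (in prob_space) AE_limsup_of_squares:
  fixes S :: "nat \<Rightarrow> 'a \<Rightarrow> real" and L e C :: real
  assumes meas: "\<And>n. S n \<in> borel_measurable M"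
    and mono: "\<And>\<omega> m n. \<omega> \<in> space M \<Longrightarrow> m \<le> n \<Longrightarrow> S m \<omega> \<le> S n \<omega>"
    and bound: "\<And>n. nmin \<le> n \<Longrightarrow> prob {\<omega> \<in> space M. L * n \<le> S n \<omega>} \<le> C / n"
    and e: "0 < e" and L: "0 \<le> L"
  shows "AE \<omega> in M. eventually (\<lambda>n. S n \<omega> \<le> (L + e) * n) sequentially"
proof -
  let ?A = "\<lambda>m. {\<omega> \<in> space M. L * real (m\<^sup>2) \<le> S (m\<^sup>2) \<omega>}"
  have "AE \<omega> in M. eventually (\<lambda>m. \<omega> \<notin> ?A m) sequentially"
  proof (rule AE_eventually_not_in)
    show "?A m \<in> sets M" for m using meas[of "m\<^sup>2"] by measurable
    show "prob (?A m) \<le> C / (real m)\<^sup>2" if "nmin \<le> m" for m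
      using bound[of "m\<^sup>2"] that power2_nat_le_imp_le[of m "m\<^sup>2"]
      by (metis le_square le_trans of_nat_power power2_eq_square)
  qed
  then show ?thesis
  proof (rule AE_mp, intro AE_I2 impI)
    fix \<omega> assume \<omega>: "\<omega> \<in> space M" and "eventually (\<lambda>m. \<omega> \<notin> ?A m) sequentially"
    then have ev: "eventually (\<lambda>m. S (m\<^sup>2) \<omega> \<le> L * real (m\<^sup>2)) sequentially"
      by (auto elim!: eventually_mono)
    have "filterlim (\<lambda>n::nat. nat \<lfloor>sqrt n\<rfloor> + 1) at_top sequentially" by real_asymp
    then have "eventually (\<lambda>n. S ((nat \<lfloor>sqrt (real n)\<rfloor> + 1)\<^sup>2) \<omega> \<le> L * real ((nat \<lfloor>sqrt (real n)\<rfloor> + 1)\<^sup>2)) sequentially"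
      by (rule eventually_compose_filterlim[OF ev])
    then show "eventually (\<lambda>n. S n \<omega> \<le> (L + e) * n) sequentially"
      using eventually_sqrt_small[OF e, of L]
    proof eventually_elim
      case (elim n)
      let ?m = "nat \<lfloor>sqrt (real n)\<rfloor>"
      have m: "n \<le> (?m + 1)\<^sup>2" "real ?m \<le> sqrt n" by (rule nat_floor_sqrt_bounds)+
      have "S n \<omega> \<le> S ((?m + 1)\<^sup>2) \<omega>" by (rule mono[OF \<omega> m(1)])
      also have "\<dots> \<le> L * (real ?m + 1)\<^sup>2" using elim by (simp add: add.commute)
      also have "\<dots> \<le> L * (sqrt n + 1)\<^sup>2" using L m by (intro mult_left_mono power_mono add_right_mono) auto
      also have "\<dots> = L * (real n + (2 * sqrt n + 1))" by (simp add: power2_sum)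
      also have "\<dots> \<le> (L + e) * n" using elim by (simp add: algebra_simps)
      finally show ?case .
    qed
  qed
qed

section \<open>Averaging quenched bounds over the environment\<close>

context bernoulli_environment
begin

lemma p_measurable[measurable]: "p j \<in> borel_measurable M"
  using p_indep by (auto simp: indep_vars_def)

declare X_measurable[measurable]

lemma sets_law: "sets \<mu> = sets borel"
  using p_law[of 0] by auto

lemma prob_space_law: "prob_space \<mu>"
  using p_law[of 0] prob_space_distr[OF p_measurable[of 0]] by simp

lemma AE_law_iff:
  assumes "{t. P t} \<in> sets borel"
  shows "(AE t in \<mu>. P t) \<longleftrightarrow> (AE \<omega> in M. P (p j \<omega>))"
  unfolding p_law[of j, symmetric] using assms by (subst AE_distr_iff) auto

lemma AE_law_unit: "AE t in \<mu>. 0 \<le> t \<and> t \<le> 1"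
  by (subst AE_law_iff[of _ 0]) (use p_range in \<open>auto intro!: AE_I2\<close>)

lemma environment_deviation:
  assumes f[measurable]: "f \<in> borel_measurable borel" and B: "\<And>t. 0 \<le> t \<Longrightarrow> t \<le> 1 \<Longrightarrow> \<bar>f t\<bar> \<le> B" and e: "0 < e"
  shows "prob {\<omega> \<in> space M. e \<le> \<bar>(\<Sum>j<L. f (p j \<omega>)) - real L * (\<integral>t. f t \<partial>\<mu>)\<bar>} \<le> real L * B\<^sup>2 / e\<^sup>2"
proof -
  have E: "expectation (\<lambda>\<omega>. f (p j \<omega>)) = (\<integral>t. f t \<partial>\<mu>)" for j
    unfolding p_law[of j, symmetric] by (subst integral_distr) auto
  have bd: "(f (p j \<omega>))\<^sup>2 \<le> B\<^sup>2" if "\<omega> \<in> space M" for j \<omega>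
    using B[of "p j \<omega>"] p_range[OF that, of j] by (metis abs_le_square_iff abs_of_nonneg abs_ge_zero order_trans atLeastAtMost_iff)
  have int: "integrable M (\<lambda>\<omega>. (f (p j \<omega>))\<^sup>2)" for j
    by (rule integrable_const_bound[where B = "B\<^sup>2"]) (use bd in \<open>auto intro!: AE_I2\<close>)
  have "prob {\<omega> \<in> space M. e \<le> \<bar>(\<Sum>j<L. f (p j \<omega>)) - (\<Sum>j<L. expectation (\<lambda>\<omega>. f (p j \<omega>)))\<bar>}
    \<le> real (card {..<L}) * B\<^sup>2 / e\<^sup>2"
  proof (rule chebyshev_sum_indep)
    show "indep_vars (\<lambda>_. borel) (\<lambda>j \<omega>. f (p j \<omega>)) {..<L}"
      by (rule indep_vars_compose2[OF indep_vars_subset[OF p_indep]]) auto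
    show "expectation (\<lambda>\<omega>. (f (p j \<omega>))\<^sup>2) \<le> B\<^sup>2" for j
    proof -
      have "expectation (\<lambda>\<omega>. (f (p j \<omega>))\<^sup>2) \<le> expectation (\<lambda>\<omega>. B\<^sup>2)"
        by (intro integral_mono int) (use bd in auto)
      then show ?thesis by (simp add: prob_space)
    qed
  qed (use int e in auto)
  then show ?thesis by (simp add: E)
qed

text \<open>Integrating a conditional expectation over the whole space recovers the unconditional
  probability.\<close>

lemma prob_pattern:
  assumes "finite F"
  shows "prob {\<omega> \<in> space M. \<forall>z\<in>F. X z \<omega> = of_bool (a z)} =
    expectation (\<lambda>\<omega>. \<Prod>z\<in>F. if a z then p (snd z) \<omega> else 1 - p (snd z) \<omega>)"
proof -
  let ?G = "vimage_algebra (space M) (\<lambda>\<omega> j. p j \<omega>) (\<Pi>\<^sub>M j\<in>UNIV. borel)"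
  let ?E = "{\<omega> \<in> space M. \<forall>z\<in>F. X z \<omega> = of_bool (a z)}"
  interpret finite_measure_subalgebra M ?G
    by unfold_locales (rule environment_subalgebra)
  have E: "?E \<in> sets M" using assms by measurable
  have "integrable M (indicator ?E :: 'w \<Rightarrow> real)"
    using E by (intro integrable_real_indicator) (auto simp: emeasure_eq_measure)
  then have "expectation (real_cond_exp M ?G (indicator ?E)) = expectation (indicator ?E)"
    by (rule real_cond_exp_int)
  moreover have "expectation (real_cond_exp M ?G (indicator ?E)) =
      expectation (\<lambda>\<omega>. \<Prod>z\<in>F. if a z then p (snd z) \<omega> else 1 - p (snd z) \<omega>)"
    by (rule integral_cong_AE) (use X_conditional_law[OF assms, of a] in \<open>auto intro!: borel_measurable_prod\<close>)
  ultimately show ?thesis using E by simp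
qed

text \<open>At each site the two one-point patterns have probabilities that add up to 1.\<close>

lemma AE_X_01: "AE \<omega> in M. \<forall>z. X z \<omega> \<in> {0, 1}"
proof (subst AE_all_countable, intro allI)
  fix z :: "nat \<times> nat"
  have "integrable M (p (snd z))"
    by (rule integrable_const_bound[where B = 1]) (use p_range in \<open>auto intro!: AE_I2\<close>)
  then have "expectation (\<lambda>\<omega>. 1 - p (snd z) \<omega>) = 1 - expectation (p (snd z))" by (simp add: prob_space)
  then have "prob {\<omega> \<in> space M. X z \<omega> = 1} + prob {\<omega> \<in> space M. X z \<omega> = 0} = 1"
    using prob_pattern[of "{z}" "\<lambda>_. True"] prob_pattern[of "{z}" "\<lambda>_. False"] by simp
  then have "prob ({\<omega> \<in> space M. X z \<omega> = 1} \<union> {\<omega> \<in> space M. X z \<omega> = 0}) = 1"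
    by (subst finite_measure_Union) auto
  then have "AE \<omega> in M. \<omega> \<in> {\<omega> \<in> space M. X z \<omega> = 1} \<union> {\<omega> \<in> space M. X z \<omega> = 0}"
    by (subst (asm) prob_eq_1) auto
  then show "AE \<omega> in M. X z \<omega> \<in> {0, 1}" by (rule AE_mp) (auto intro!: AE_I2)
qed

text \<open>A version of the weights with natural values at most 1 at every outcome, so that
  \<open>lpp\<close> and its bounds apply without exceptional sets.\<close>

definition X01 :: "nat \<times> nat \<Rightarrow> 'w \<Rightarrow> nat" where
  "X01 z \<omega> = (if X z \<omega> = 1 then 1 else 0)"

lemma X01_measurable[measurable]: "X01 z \<in> M \<rightarrow>\<^sub>M count_space UNIV"
  unfolding X01_def[abs_def] by measurable

lemma AE_X_eq_X01: "AE \<omega> in M. \<forall>z. X z \<omega> = real (X01 z \<omega>)"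
  using AE_X_01 by eventually_elim (auto simp: X01_def)

text \<open>The law of the weights is a mixture of the quenched product laws: both sides are finite
  sums over 0-1 patterns on \<open>F\<close>, matched by \<open>prob_pattern\<close>. The
  relabelling \<sigma> treats the grid and its transpose together.\<close>

lemma prob_X01_in:
  fixes \<sigma> :: "nat \<times> nat \<Rightarrow> nat \<times> nat"
  assumes F: "finite F" and inj: "inj_on \<sigma> F"
  defines "N \<equiv> \<lambda>\<omega>. Pi_pmf F 0 (\<lambda>z. bern (p (snd (\<sigma> z)) \<omega>))"
  shows "(\<lambda>\<omega>. measure_pmf.prob (N \<omega>) A) \<in> borel_measurable M"
    and "{\<omega> \<in> space M. (\<lambda>z. if z \<in> F then X01 (\<sigma> z) \<omega> else 0) \<in> A} \<in> sets M"
    and "prob {\<omega> \<in> space M. (\<lambda>z. if z \<in> F then X01 (\<sigma> z) \<omega> else 0) \<in> A} = expectation (\<lambda>\<omega>. measure_pmf.prob (N \<omega>) A)"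
proof -
  define S where "S = PiE_dflt F (0::nat) (\<lambda>_. {0, 1})"
  define h where "h \<omega> = (\<lambda>z. if z \<in> F then X01 (\<sigma> z) \<omega> else 0)" for \<omega>
  define E where "E f = {\<omega> \<in> space M. \<forall>z\<in>F. X01 (\<sigma> z) \<omega> = f z}" for f
  have S: "finite S" unfolding S_def using F by (intro finite_PiE_dflt) auto
  have supp: "set_pmf (N \<omega>) \<subseteq> S" for \<omega>
    unfolding N_def S_def using set_Pi_pmf_subset'[OF F] set_bern by (fastforce simp: PiE_dflt_def)
  have prob_N: "measure_pmf.prob (N \<omega>) A = (\<Sum>f\<in>S \<inter> A. pmf (N \<omega>) f)" for \<omega>
  proof -
    have "measure_pmf.prob (N \<omega>) A = measure_pmf.prob (N \<omega>) (S \<inter> A)"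
      using supp by (intro measure_pmf.finite_measure_eq_AE AE_pmfI) auto
    then show ?thesis using S by (simp add: measure_measure_pmf_finite)
  qed
  have pmf_N: "pmf (N \<omega>) f = (\<Prod>z\<in>F. if f z = 1 then p (snd (\<sigma> z)) \<omega> else 1 - p (snd (\<sigma> z)) \<omega>)"
    if "f \<in> S" "\<omega> \<in> space M" for f \<omega>
  proof -
    have "pmf (N \<omega>) f = (\<Prod>z\<in>F. pmf (bern (p (snd (\<sigma> z)) \<omega>)) (f z))"
      unfolding N_def using that by (intro pmf_Pi' F) (auto simp: S_def PiE_dflt_def)
    also have "\<dots> = (\<Prod>z\<in>F. if f z = 1 then p (snd (\<sigma> z)) \<omega> else 1 - p (snd (\<sigma> z)) \<omega>)"
    proof (rule prod.cong[OF refl])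
      fix z assume "z \<in> F"
      then have "f z \<in> {0, 1}" using that(1) unfolding S_def PiE_dflt_def by blast
      then show "pmf (bern (p (snd (\<sigma> z)) \<omega>)) (f z) = (if f z = 1 then p (snd (\<sigma> z)) \<omega> else 1 - p (snd (\<sigma> z)) \<omega>)"
        using p_range[OF that(2), of "snd (\<sigma> z)"] by (auto simp: pmf_bern)
    qed
    finally show ?thesis .
  qed
  have int: "integrable M (\<lambda>\<omega>. pmf (N \<omega>) f)" if "f \<in> S" for f
  proof (rule integrable_const_bound[where B = 1])
    show "(\<lambda>\<omega>. pmf (N \<omega>) f) \<in> borel_measurable M"
      by (subst measurable_cong[OF pmf_N[OF that]]) (auto intro!: borel_measurable_prod)
  qed (auto simp: pmf_le_1)
  show "(\<lambda>\<omega>. measure_pmf.prob (N \<omega>) A) \<in> borel_measurable M"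
    unfolding prob_N using int by (intro borel_measurable_sum) auto
  have E_meas: "E f \<in> sets M" for f unfolding E_def using F by measurable
  have un: "{\<omega> \<in> space M. h \<omega> \<in> A} = (\<Union>f\<in>S \<inter> A. E f)"
  proof (intro set_eqI iffI)
    fix \<omega> assume "\<omega> \<in> {\<omega> \<in> space M. h \<omega> \<in> A}"
    moreover have "h \<omega> \<in> S" by (auto simp: h_def S_def PiE_dflt_def X01_def)
    moreover have "\<omega> \<in> E (h \<omega>)" if "\<omega> \<in> space M" using that by (auto simp: E_def h_def)
    ultimately show "\<omega> \<in> (\<Union>f\<in>S \<inter> A. E f)" by blast
  next
    fix \<omega> assume "\<omega> \<in> (\<Union>f\<in>S \<inter> A. E f)"
    then obtain f where f: "f \<in> S" "f \<in> A" "\<omega> \<in> E f" by blast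
    then have "h \<omega> = f" by (auto simp: h_def E_def S_def PiE_dflt_def fun_eq_iff)
    then show "\<omega> \<in> {\<omega> \<in> space M. h \<omega> \<in> A}" using f by (auto simp: E_def)
  qed
  then show "{\<omega> \<in> space M. (\<lambda>z. if z \<in> F then X01 (\<sigma> z) \<omega> else 0) \<in> A} \<in> sets M"
    using S E_meas unfolding h_def by auto
  have probE: "prob (E f) = expectation (\<lambda>\<omega>. pmf (N \<omega>) f)" if f: "f \<in> S" for f
  proof -
    \<comment> \<open>\<open>prob_pattern\<close> speaks of the original sites, so the pattern is
      carried from \<open>F\<close> to its image under \<sigma>.\<close>
    define a where "a z = (f (the_inv_into F \<sigma> z) = 1)" for z
    have a: "a (\<sigma> z) = (f z = 1)" if "z \<in> F" for z using that inj by (simp add: a_def the_inv_into_f_f)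
    have f01: "f z = 0 \<or> f z = 1" if "z \<in> F" for z
    proof -
      have "f z \<in> {0, 1}" using f that unfolding S_def PiE_dflt_def by blast
      then show ?thesis by simp
    qed
    have "prob (E f) = prob {\<omega> \<in> space M. \<forall>z\<in>\<sigma> ` F. X z \<omega> = of_bool (a z)}"
    proof (rule finite_measure_eq_AE)
      show "AE \<omega> in M. (\<omega> \<in> E f) = (\<omega> \<in> {\<omega> \<in> space M. \<forall>z\<in>\<sigma> ` F. X z \<omega> = of_bool (a z)})"
        using AE_X_eq_X01
      proof eventually_elim
        case (elim \<omega>)
        have "X (\<sigma> z) \<omega> = of_bool (a (\<sigma> z)) \<longleftrightarrow> X01 (\<sigma> z) \<omega> = f z" if "z \<in> F" for z
          using spec[OF elim, of "\<sigma> z"] f01[OF that] a[OF that] by auto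
        then show ?case by (auto simp: E_def)
      qed
      show "{\<omega> \<in> space M. \<forall>z\<in>\<sigma> ` F. X z \<omega> = of_bool (a z)} \<in> sets M" using F by measurable
    qed (rule E_meas)
    also have "\<dots> = expectation (\<lambda>\<omega>. \<Prod>z\<in>\<sigma> ` F. if a z then p (snd z) \<omega> else 1 - p (snd z) \<omega>)"
      using F by (intro prob_pattern) auto
    also have "\<dots> = expectation (\<lambda>\<omega>. pmf (N \<omega>) f)"
    proof (rule Bochner_Integration.integral_cong[OF refl])
      fix \<omega> assume "\<omega> \<in> space M"
      then show "(\<Prod>z\<in>\<sigma> ` F. if a z then p (snd z) \<omega> else 1 - p (snd z) \<omega>) = pmf (N \<omega>) f"
        by (simp add: pmf_N[OF f] prod.reindex[OF inj] a cong: prod.cong)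
    qed
    finally show ?thesis .
  qed
  have "prob {\<omega> \<in> space M. h \<omega> \<in> A} = (\<Sum>f\<in>S \<inter> A. prob (E f))"
    unfolding un
  proof (rule finite_measure_finite_Union)
    show "disjoint_family_on E (S \<inter> A)"
      unfolding disjoint_family_on_def
    proof (intro ballI impI)
      fix f g assume fg: "f \<in> S \<inter> A" "g \<in> S \<inter> A" "f \<noteq> g"
      then obtain z where z: "f z \<noteq> g z" by blast
      moreover have "z \<in> F"
        using fg z by (cases z) (auto simp: S_def PiE_dflt_def)
      ultimately show "E f \<inter> E g = {}" by (auto simp: E_def)
    qed
  qed (use S E_meas in auto)
  also have "\<dots> = expectation (\<lambda>\<omega>. measure_pmf.prob (N \<omega>) A)"
    unfolding prob_N using int by (subst Bochner_Integration.integral_sum) (auto simp: probE)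
  finally show "prob {\<omega> \<in> space M. (\<lambda>z. if z \<in> F then X01 (\<sigma> z) \<omega> else 0) \<in> A} = expectation (\<lambda>\<omega>. measure_pmf.prob (N \<omega>) A)"
    by (simp add: h_def)
qed

text \<open>Off the good event \<Gamma> the quenched probability is only bounded by 1, which costs
  the probability of the complement. The predicate \<open>Q\<close> stands for either tail.\<close>

lemma prob_lpp0_le:
  fixes \<sigma> :: "nat \<times> nat \<Rightarrow> nat \<times> nat" and Q :: "real \<Rightarrow> bool"
  assumes inj: "inj \<sigma>" and \<Gamma>: "\<Gamma> \<in> sets M"
    and bound: "AE \<omega> in M. \<omega> \<in> \<Gamma> \<longrightarrow>
      measure_pmf.prob (weights k l (\<lambda>z. p (snd (\<sigma> z)) \<omega>)) {w. Q (real (lpp0 w k l))} \<le> c"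
    and c: "0 \<le> c"
  shows "prob {\<omega> \<in> space M. Q (real (lpp0 (\<lambda>z. X01 (\<sigma> z) \<omega>) k l))} \<le> prob (space M - \<Gamma>) + c"
proof -
  let ?F = "{..<k} \<times> {..<l}"
  let ?A = "{w. Q (real (lpp0 w k l))}"
  let ?g = "\<lambda>\<omega>. measure_pmf.prob (weights k l (\<lambda>z. p (snd (\<sigma> z)) \<omega>)) ?A"
  have inj': "inj_on \<sigma> ?F" using inj by (rule inj_on_subset) auto
  have ind: "integrable M (indicator (space M - \<Gamma>) :: 'w \<Rightarrow> real)"
    using \<Gamma> by (intro integrable_real_indicator) (auto simp: emeasure_eq_measure)
  note law = prob_X01_in[OF _ inj', of ?A, folded weights_def, simplified]
  have "lpp0 (\<lambda>z. if z \<in> ?F then X01 (\<sigma> z) \<omega> else 0) k l = lpp0 (\<lambda>z. X01 (\<sigma> z) \<omega>) k l" for \<omega>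
    by (rule lpp_cong) auto
  then have "prob {\<omega> \<in> space M. Q (real (lpp0 (\<lambda>z. X01 (\<sigma> z) \<omega>) k l))} = expectation ?g"
    using law(3) by simp
  also have "\<dots> \<le> expectation (\<lambda>\<omega>. indicator (space M - \<Gamma>) \<omega> + c)"
  proof (rule integral_mono_AE)
    show "integrable M (\<lambda>\<omega>. indicator (space M - \<Gamma>) \<omega> + c)" using ind by auto
    show "integrable M ?g"
      by (rule integrable_const_bound[where B = 1]) (use law(1) in \<open>auto simp: measure_pmf.prob_le_1\<close>)
    show "AE \<omega> in M. ?g \<omega> \<le> indicator (space M - \<Gamma>) \<omega> + c"
      using bound
    proof (rule AE_mp, intro AE_I2 impI)
      fix \<omega> assume "\<omega> \<in> space M" "\<omega> \<in> \<Gamma> \<longrightarrow> ?g \<omega> \<le> c"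
      then show "?g \<omega> \<le> indicator (space M - \<Gamma>) \<omega> + c"
        using c measure_pmf.prob_le_1[of "weights k l (\<lambda>z. p (snd (\<sigma> z)) \<omega>)" ?A]
        by (cases "\<omega> \<in> \<Gamma>") (auto simp: indicator_def intro: order_trans)
    qed
  qed
  also have "\<dots> = prob (space M - \<Gamma>) + c"
    using \<Gamma> by (subst Bochner_Integration.integral_add[OF ind]) (auto simp: prob_space)
  finally show ?thesis .
qed


text \<open>A union bound. The number of summands depends on the index because full sums and initial
  segments are controlled together.\<close>

lemma environment_deviations:
  fixes h :: "'i \<Rightarrow> real \<Rightarrow> real" and L :: "'i \<Rightarrow> nat" and B N e :: real
  assumes I: "finite I" and h: "\<And>i. i \<in> I \<Longrightarrow> h i \<in> borel_measurable borel"
    and B: "\<And>i t. i \<in> I \<Longrightarrow> 0 \<le> t \<Longrightarrow> t \<le> 1 \<Longrightarrow> \<bar>h i t\<bar> \<le> B"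
    and L: "\<And>i. i \<in> I \<Longrightarrow> real (L i) \<le> N" and e: "0 < e"
  obtains \<Gamma> where "\<Gamma> \<in> sets M" "prob (space M - \<Gamma>) \<le> real (card I) * (N * B\<^sup>2 / e\<^sup>2)"
    "\<And>\<omega> i. \<omega> \<in> \<Gamma> \<Longrightarrow> i \<in> I \<Longrightarrow> \<bar>(\<Sum>j<L i. h i (p j \<omega>)) - real (L i) * (\<integral>t. h i t \<partial>\<mu>)\<bar> < e"
proof -
  define A where "A i = {\<omega> \<in> space M. e \<le> \<bar>(\<Sum>j<L i. h i (p j \<omega>)) - real (L i) * (\<integral>t. h i t \<partial>\<mu>)\<bar>}" for i
  have A: "A i \<in> sets M" if "i \<in> I" for i
    using h[OF that] unfolding A_def by measurable
  have prob_A: "prob (A i) \<le> N * B\<^sup>2 / e\<^sup>2" if "i \<in> I" for i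
  proof -
    have "prob (A i) \<le> real (L i) * B\<^sup>2 / e\<^sup>2"
      unfolding A_def using h[OF that] B[OF that] e by (rule environment_deviation)
    also have "\<dots> \<le> N * B\<^sup>2 / e\<^sup>2" using L[OF that] by (intro divide_right_mono mult_right_mono) auto
    finally show ?thesis .
  qed
  let ?\<Gamma> = "space M - (\<Union>i\<in>I. A i)"
  have un: "(\<Union>i\<in>I. A i) \<in> sets M" using I A by auto
  have "space M - ?\<Gamma> = (\<Union>i\<in>I. A i)" using A by (auto simp: A_def)
  then have "prob (space M - ?\<Gamma>) \<le> (\<Sum>i\<in>I. prob (A i))"
    using finite_measure_subadditive_finite[OF I, of A] A by auto
  also have "\<dots> \<le> (\<Sum>i\<in>I. N * B\<^sup>2 / e\<^sup>2)" by (intro sum_mono prob_A)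
  finally have "prob (space M - ?\<Gamma>) \<le> real (card I) * (N * B\<^sup>2 / e\<^sup>2)" by simp
  then show thesis using un by (intro that[of ?\<Gamma>]) (auto simp: A_def not_le)
qed

lemma integral_law_bounds:
  assumes f: "f \<in> borel_measurable borel" and B: "\<And>t. 0 \<le> t \<Longrightarrow> t \<le> 1 \<Longrightarrow> 0 \<le> f t \<and> f t \<le> (B::real)"
  shows "integrable \<mu> f" "0 \<le> (\<integral>t. f t \<partial>\<mu>)" "(\<integral>t. f t \<partial>\<mu>) \<le> B"
proof -
  interpret \<mu>: prob_space \<mu> by (rule prob_space_law)
  have f': "f \<in> borel_measurable \<mu>" using f by (simp add: measurable_cong_sets[OF sets_law refl])
  have AE: "AE t in \<mu>. 0 \<le> f t \<and> f t \<le> B" using AE_law_unit by eventually_elim (use B in auto)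
  show int: "integrable \<mu> f"
    by (rule \<mu>.integrable_const_bound[where B = B]) (use AE f' in \<open>auto elim: AE_mp\<close>)
  show "0 \<le> (\<integral>t. f t \<partial>\<mu>)" by (rule integral_nonneg_AE) (use AE in auto)
  have "(\<integral>t. f t \<partial>\<mu>) \<le> (\<integral>t. B \<partial>\<mu>)" by (intro integral_mono_AE int) (use AE in auto)
  then show "(\<integral>t. f t \<partial>\<mu>) \<le> B" by (simp add: \<mu>.prob_space)
qed

text \<open>Both boundary parameters are functions of the environment at their own index, so that
  one statement serves both directions: for \<sigma> = \<open>id\<close> the function
  \<open>qf\<close> is constant, for the transpose \<open>\<rho>f\<close> is.\<close>

lemma prob_lpp0_upper:
  fixes \<sigma> :: "nat \<times> nat \<Rightarrow> nat \<times> nat" and qf \<rho>f :: "real \<Rightarrow> real" and a b r \<epsilon> :: real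
  assumes inj: "inj \<sigma>" and r: "0 \<le> r" "r < 1"
    and meas[measurable]: "qf \<in> borel_measurable borel" "\<rho>f \<in> borel_measurable borel"
    and range: "\<And>t. 0 \<le> t \<Longrightarrow> t \<le> 1 \<Longrightarrow> 0 \<le> qf t \<and> qf t \<le> 1 \<and> 0 \<le> \<rho>f t \<and> \<rho>f t \<le> r"
    and balance: "AE \<omega> in M. \<forall>s t. p (snd (\<sigma> (s, t))) \<omega> * (1 - qf (p s \<omega>)) =
      \<rho>f (p t \<omega>) * qf (p s \<omega>) * (1 - p (snd (\<sigma> (s, t))) \<omega>)"
    and ab: "0 \<le> a" "0 \<le> b" and \<epsilon>: "0 < \<epsilon>"
  defines "\<alpha> \<equiv> \<integral>t. qf t \<partial>\<mu>" and "\<beta> \<equiv> \<integral>t. \<rho>f t / (1 - \<rho>f t) \<partial>\<mu>"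
  shows "\<exists>C m0. \<forall>n\<ge>m0. prob {\<omega> \<in> space M. (a * \<alpha> + b * \<beta> + \<epsilon>) * real n \<le>
    real (lpp0 (\<lambda>z. X01 (\<sigma> z) \<omega>) (nat \<lfloor>real n * a\<rfloor>) (Suc (nat \<lfloor>real n * b\<rfloor>)))} \<le> C / real n"
proof -
  define B where "B = 1 + r / (1 - r)"
  define V where "V = geo_moment_bound r"
  \<comment> \<open>The errors are two environment sums, \<open>2 * e\<close> for the deviation and
    at most \<open>e\<close> for the additional row, five units of \<open>e = \<eta> * n\<close> in
    all.\<close>
  define \<eta> where "\<eta> = \<epsilon> / 8"
  have \<eta>: "0 < \<eta>" using \<epsilon> by (simp add: \<eta>_def)
  have B1: "1 \<le> B" using r by (simp add: B_def)
  have V0: "0 \<le> V" using geo_moment_bound_ge_1[OF r] by (simp add: V_def)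
  let ?bf = "\<lambda>t. \<rho>f t / (1 - \<rho>f t)"
  have bf: "0 \<le> ?bf t \<and> ?bf t \<le> B" if "0 \<le> t" "t \<le> 1" for t
  proof -
    have "?bf t \<le> r / (1 - r)" using range[OF that] r by (intro frac_le) auto
    then show ?thesis using range[OF that] r by (auto simp: B_def)
  qed
  have qB: "0 \<le> qf t \<and> qf t \<le> B" if "0 \<le> t" "t \<le> 1" for t using range[OF that] B1 by auto
  have \<beta>: "0 \<le> \<beta>" "\<beta> \<le> B" unfolding \<beta>_def by (rule integral_law_bounds; use bf in auto)+
  have \<alpha>: "0 \<le> \<alpha>" "\<alpha> \<le> 1" unfolding \<alpha>_def by (rule integral_law_bounds; use range in auto)+
  define C where "C = (2 * B\<^sup>2 + V) * (a + b + 1) / \<eta>\<^sup>2"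
  \<comment> \<open>From \<open>m0\<close> on, bounded contributions such as that of the additional
    row, at most \<open>B\<close>, are below \<open>e\<close>.\<close>
  define m0 where "m0 = Suc (nat \<lceil>B / \<eta>\<rceil>)"
  have "prob {\<omega> \<in> space M. (a * \<alpha> + b * \<beta> + \<epsilon>) * real n \<le>
    real (lpp0 (\<lambda>z. X01 (\<sigma> z) \<omega>) (nat \<lfloor>real n * a\<rfloor>) (Suc (nat \<lfloor>real n * b\<rfloor>)))} \<le> C / real n"
    if n: "m0 \<le> n" for n
  proof -
    define k where "k = nat \<lfloor>real n * a\<rfloor>"
    define l where "l = Suc (nat \<lfloor>real n * b\<rfloor>)"
    define e where "e = \<eta> * real n"
    have n1: "1 \<le> real n" using n by (simp add: m0_def)
    have "B / \<eta> \<le> real n" using n unfolding m0_def by linarith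
    then have Be: "B \<le> e" using \<eta> by (simp add: e_def field_simps)
    have e: "0 < e" using \<eta> n1 by (simp add: e_def)
    have k: "real k \<le> real n * a" using ab by (simp add: k_def)
    have l: "real l \<le> real n * b + 1" using ab by (simp add: l_def)
    have kl: "real (k + l) \<le> real n * (a + b + 1)" using k l n1 by (simp add: algebra_simps)
    obtain \<Gamma> where \<Gamma>: "\<Gamma> \<in> sets M"
      "prob (space M - \<Gamma>) \<le> real (card (UNIV :: bool set)) * (real n * (a + b + 1) * B\<^sup>2 / e\<^sup>2)"
      "\<And>\<omega> i. \<omega> \<in> \<Gamma> \<Longrightarrow> i \<in> UNIV \<Longrightarrow> \<bar>(\<Sum>j<(if i then k else l). (if i then qf else ?bf) (p j \<omega>))
        - real (if i then k else l) * (\<integral>t. (if i then qf else ?bf) t \<partial>\<mu>)\<bar> < e"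
    proof (rule environment_deviations[of UNIV "\<lambda>i. if i then qf else ?bf" B "\<lambda>i. if i then k else l"
          "real n * (a + b + 1)" e])
      show "(if i then qf else ?bf) \<in> borel_measurable borel" for i by simp
      show "\<bar>(if i then qf else ?bf) t\<bar> \<le> B" if "0 \<le> t" "t \<le> 1" for i t
        using bf[OF that] qB[OF that] by auto
      show "real (if i then k else l) \<le> real n * (a + b + 1)" for i using kl by auto
    qed (use e in auto)
    have "prob {\<omega> \<in> space M. (a * \<alpha> + b * \<beta> + \<epsilon>) * real n \<le> real (lpp0 (\<lambda>z. X01 (\<sigma> z) \<omega>) k l)}
      \<le> prob (space M - \<Gamma>) + real n * (a + b + 1) * V / e\<^sup>2"
    proof (rule prob_lpp0_le[OF inj \<Gamma>(1), of k l "\<lambda>x. (a * \<alpha> + b * \<beta> + \<epsilon>) * real n \<le> x"])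
      show "0 \<le> real n * (a + b + 1) * V / e\<^sup>2" using ab V0 by simp
      show "AE \<omega> in M. \<omega> \<in> \<Gamma> \<longrightarrow> measure_pmf.prob (weights k l (\<lambda>z. p (snd (\<sigma> z)) \<omega>))
          {w. (a * \<alpha> + b * \<beta> + \<epsilon>) * real n \<le> real (lpp0 w k l)} \<le> real n * (a + b + 1) * V / e\<^sup>2"
        using balance
      proof (rule AE_mp, intro AE_I2 impI)
        fix \<omega> assume \<omega>: "\<omega> \<in> space M" "\<omega> \<in> \<Gamma>"
          and bal: "\<forall>s t. p (snd (\<sigma> (s, t))) \<omega> * (1 - qf (p s \<omega>)) =
            \<rho>f (p t \<omega>) * qf (p s \<omega>) * (1 - p (snd (\<sigma> (s, t))) \<omega>)"
        let ?P = "\<lambda>z. p (snd (\<sigma> z)) \<omega>" and ?q = "\<lambda>s. qf (p s \<omega>)" and ?\<rho> = "\<lambda>t. \<rho>f (p t \<omega>)"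
        have st: "stationary k l ?P ?q ?\<rho> r"
          unfolding stationary_def using r range p_range[OF \<omega>(1)] bal by auto
        have "\<bar>(\<Sum>s<k. ?q s) - real k * \<alpha>\<bar> < e" using \<Gamma>(3)[OF \<omega>(2), of True] by (simp add: \<alpha>_def)
        moreover have "\<bar>(\<Sum>t<l. ?bf (p t \<omega>)) - real l * \<beta>\<bar> < e" using \<Gamma>(3)[OF \<omega>(2), of False] by (simp add: \<beta>_def)
        moreover have "real k * \<alpha> \<le> real n * a * \<alpha>" using k \<alpha>(1) by (rule mult_right_mono)
        moreover have "real l * \<beta> \<le> (real n * b + 1) * \<beta>" using l \<beta>(1) by (rule mult_right_mono)
        moreover have "\<epsilon> * real n = 8 * e" by (simp add: e_def \<eta>_def)
        ultimately have le: "stationary_mean k l ?q ?\<rho> + 2 * e \<le> (a * \<alpha> + b * \<beta> + \<epsilon>) * real n"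
          using Be \<beta> e unfolding stationary_mean_def by (simp add: algebra_simps)
        have "measure_pmf.prob (weights k l ?P) {w. (a * \<alpha> + b * \<beta> + \<epsilon>) * real n \<le> real (lpp0 w k l)}
          \<le> measure_pmf.prob (weights k l ?P) {w. stationary_mean k l ?q ?\<rho> + 2 * e \<le> real (lpp0 w k l)}"
          using le by (intro measure_pmf.finite_measure_mono) auto
        also have "\<dots> \<le> real (k + l) * V / e\<^sup>2"
          unfolding V_def by (rule lpp0_upper_deviation[OF st r(1) e])
        also have "\<dots> \<le> real n * (a + b + 1) * V / e\<^sup>2"
          using kl V0 by (intro divide_right_mono mult_right_mono) auto
        finally show "measure_pmf.prob (weights k l ?P) {w. (a * \<alpha> + b * \<beta> + \<epsilon>) * real n \<le> real (lpp0 w k l)}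
          \<le> real n * (a + b + 1) * V / e\<^sup>2" .
      qed
    qed
    also have "\<dots> \<le> 2 * (real n * (a + b + 1) * B\<^sup>2 / e\<^sup>2) + real n * (a + b + 1) * V / e\<^sup>2"
      using \<Gamma>(2) by simp
    also have "\<dots> = C / real n" using n1 \<eta> by (simp add: C_def e_def field_simps power2_eq_square)
    finally show ?thesis unfolding k_def l_def .
  qed
  then show ?thesis by blast
qed

text \<open>Index 0 is the base boundary; 1 raises the Bernoulli and 2 the geometric parameters. The
  gap conditions are the limiting form of the gains in \<open>lpp0_lower_deviation\<close>, with
  initial segments of length about \<delta>n. The loss \<open>\<delta> * (2 + \<beta> 0)\<close>
  consists of \<delta> for the Bernoulli segment, \<open>\<delta> * \<beta> 0\<close> for the
  geometric segment and a further \<delta> for all errors.\<close>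

lemma prob_lpp0_lower:
  fixes \<sigma> :: "nat \<times> nat \<Rightarrow> nat \<times> nat" and qf \<rho>f :: "nat \<Rightarrow> real \<Rightarrow> real" and g :: "real \<Rightarrow> real" and a b r \<delta> :: real
  assumes inj: "inj \<sigma>" and r: "0 \<le> r" "r < 1"
    and meas[measurable]: "\<And>i. qf i \<in> borel_measurable borel" "\<And>i. \<rho>f i \<in> borel_measurable borel"
    and range: "\<And>i t. 0 \<le> t \<Longrightarrow> t \<le> 1 \<Longrightarrow> 0 \<le> qf i t \<and> qf i t \<le> 1 \<and> 0 \<le> \<rho>f i t \<and> \<rho>f i t \<le> r"
    and g: "\<And>t. 0 \<le> t \<Longrightarrow> t \<le> 1 \<Longrightarrow> 0 \<le> g t \<and> g t \<le> t"
    and balance: "\<And>\<omega> i s t. \<omega> \<in> space M \<Longrightarrow> g (p (snd (\<sigma> (s, t))) \<omega>) * (1 - qf i (p s \<omega>)) =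
      \<rho>f i (p t \<omega>) * qf i (p s \<omega>) * (1 - g (p (snd (\<sigma> (s, t))) \<omega>))"
    and mono: "\<And>t. 0 \<le> t \<Longrightarrow> t \<le> 1 \<Longrightarrow> qf 0 t \<le> qf 1 t" "\<And>t. 0 \<le> t \<Longrightarrow> t \<le> 1 \<Longrightarrow> \<rho>f 0 t \<le> \<rho>f 2 t"
    and \<delta>: "0 < \<delta>" "\<delta> \<le> a" "\<delta> \<le> b"
  defines "\<alpha> \<equiv> \<lambda>i. \<integral>t. qf i t \<partial>\<mu>" and "\<beta> \<equiv> \<lambda>i. \<integral>t. \<rho>f i t / (1 - \<rho>f i t) \<partial>\<mu>"
  assumes gap1: "a * \<alpha> 1 + b * \<beta> 1 - (a * \<alpha> 0 + b * \<beta> 0) < \<delta> * (\<alpha> 1 - \<alpha> 0)"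
    and gap2: "a * \<alpha> 2 + b * \<beta> 2 - (a * \<alpha> 0 + b * \<beta> 0) < \<delta> * (\<beta> 2 - \<beta> 0)"
  shows "\<exists>C m0. \<forall>n\<ge>m0. prob {\<omega> \<in> space M.
    real (lpp0 (\<lambda>z. X01 (\<sigma> z) \<omega>) (nat \<lfloor>real n * a\<rfloor>) (Suc (nat \<lfloor>real n * b\<rfloor>)))
      \<le> (a * \<alpha> 0 + b * \<beta> 0 - \<delta> * (2 + \<beta> 0)) * real n} \<le> C / real n"
proof -
  define B where "B = 1 + r / (1 - r)"
  define V where "V = geo_moment_bound r"
  define gap where "gap = min (\<delta> * (\<alpha> 1 - \<alpha> 0) - (a * \<alpha> 1 + b * \<beta> 1 - (a * \<alpha> 0 + b * \<beta> 0)))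
    (\<delta> * (\<beta> 2 - \<beta> 0) - (a * \<alpha> 2 + b * \<beta> 2 - (a * \<alpha> 0 + b * \<beta> 0)))"
  have gap: "0 < gap" using gap1 gap2 by (simp add: gap_def)
  \<comment> \<open>Each gain estimate uses fifteen units of \<open>e\<close>: six required by the
    deviation lemma, six from environment sums, and three rounding errors bounded by
    \<open>B\<close>.\<close>
  define \<eta> where "\<eta> = min gap \<delta> / 24"
  have \<eta>: "0 < \<eta>" "24 * \<eta> \<le> gap" "24 * \<eta> \<le> \<delta>" using gap \<delta> by (auto simp: \<eta>_def)
  have ab: "0 \<le> a" "0 \<le> b" using \<delta> by auto
  have B1: "1 \<le> B" using r by (simp add: B_def)
  have V0: "0 \<le> V" using geo_moment_bound_ge_1[OF r] by (simp add: V_def)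
  let ?bf = "\<lambda>i t. \<rho>f i t / (1 - \<rho>f i t)"
  have bf: "0 \<le> ?bf i t \<and> ?bf i t \<le> B" if "0 \<le> t" "t \<le> 1" for i t
  proof -
    have "?bf i t \<le> r / (1 - r)" using range[OF that, of i] r by (intro frac_le) auto
    then show ?thesis using range[OF that, of i] r by (auto simp: B_def)
  qed
  have qB: "0 \<le> qf i t \<and> qf i t \<le> B" if "0 \<le> t" "t \<le> 1" for i t using range[OF that, of i] B1 by auto
  have \<beta>: "0 \<le> \<beta> i" "\<beta> i \<le> B" for i unfolding \<beta>_def by (rule integral_law_bounds; use bf in auto)+
  have \<alpha>: "0 \<le> \<alpha> i" "\<alpha> i \<le> 1" for i unfolding \<alpha>_def by (rule integral_law_bounds; use range in auto)+
  have intq: "integrable \<mu> (qf i)" and intb: "integrable \<mu> (?bf i)" for i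
    by (rule integral_law_bounds(1)[where B = B]; use bf qB in auto)+
  have \<alpha>01: "\<alpha> 0 \<le> \<alpha> 1" unfolding \<alpha>_def
  proof (intro integral_mono_AE intq)
    show "AE t in \<mu>. qf 0 t \<le> qf 1 t"
      using AE_law_unit by eventually_elim (use mono(1) in blast)
  qed
  have \<beta>02: "\<beta> 0 \<le> \<beta> 2" unfolding \<beta>_def
  proof (intro integral_mono_AE intb)
    show "AE t in \<mu>. ?bf 0 t \<le> ?bf 2 t"
      using AE_law_unit
    proof eventually_elim
      case (elim t)
      then show ?case using range[of t 0] range[of t 2] mono(2)[of t] r by (intro frac_le) auto
    qed
  qed
  define C where "C = (12 * B\<^sup>2 + 7 * V) * (a + b + 1) / \<eta>\<^sup>2"
  define m0 where "m0 = Suc (nat \<lceil>B / \<eta>\<rceil>)"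
  have "prob {\<omega> \<in> space M.
    real (lpp0 (\<lambda>z. X01 (\<sigma> z) \<omega>) (nat \<lfloor>real n * a\<rfloor>) (Suc (nat \<lfloor>real n * b\<rfloor>)))
      \<le> (a * \<alpha> 0 + b * \<beta> 0 - \<delta> * (2 + \<beta> 0)) * real n} \<le> C / real n"
    if n: "m0 \<le> n" for n
  proof -
    define k where "k = nat \<lfloor>real n * a\<rfloor>"
    define l where "l = Suc (nat \<lfloor>real n * b\<rfloor>)"
    define K where "K = nat \<lfloor>real n * \<delta>\<rfloor>"
    define e where "e = \<eta> * real n"
    have n1: "1 \<le> real n" using n by (simp add: m0_def)
    have "B / \<eta> \<le> real n" using n unfolding m0_def by linarith
    then have Be: "B \<le> e" using \<eta> by (simp add: e_def field_simps)
    have e: "0 < e" using \<eta> n1 by (simp add: e_def)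
    have gape: "24 * e \<le> gap * real n" "24 * e \<le> \<delta> * real n"
      using mult_right_mono[OF \<eta>(2), of "real n"] mult_right_mono[OF \<eta>(3), of "real n"] by (auto simp: e_def)
    have k: "real k \<le> real n * a" "real n * a - 1 \<le> real k" using ab by (auto simp: k_def)
    have l: "real l \<le> real n * b + 1" "real n * b \<le> real l" using ab by (auto simp: l_def) linarith
    have K: "real K \<le> real n * \<delta>" "real n * \<delta> - 1 \<le> real K" using \<delta> by (auto simp: K_def)
    have kl: "real (k + l) \<le> real n * (a + b + 1)" using k l n1 by (simp add: algebra_simps)
    have Kk: "K \<le> k" unfolding K_def k_def using \<delta> by (intro nat_mono floor_mono mult_left_mono) auto
    have "K \<le> nat \<lfloor>real n * b\<rfloor>" unfolding K_def using \<delta> by (intro nat_mono floor_mono mult_left_mono) auto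
    then have Kl: "K \<le> l" by (simp add: l_def)
    \<comment> \<open>Twelve environment sums: three boundaries, Bernoulli or geometric means, full
      length or initial segment.\<close>
    let ?I = "{..<3::nat} \<times> (UNIV :: bool set) \<times> (UNIV :: bool set)"
    let ?h = "\<lambda>(i, c, d :: bool). if c then qf i else ?bf i"
    let ?L = "\<lambda>(i :: nat, c, d). if d then (if c then k else l) else K"
    obtain \<Gamma> where \<Gamma>: "\<Gamma> \<in> sets M"
      "prob (space M - \<Gamma>) \<le> real (card ?I) * (real n * (a + b + 1) * B\<^sup>2 / e\<^sup>2)"
      "\<And>\<omega> i. \<omega> \<in> \<Gamma> \<Longrightarrow> i \<in> ?I \<Longrightarrow> \<bar>(\<Sum>j<?L i. ?h i (p j \<omega>)) - real (?L i) * (\<integral>t. ?h i t \<partial>\<mu>)\<bar> < e"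
    proof (rule environment_deviations[of ?I ?h B ?L "real n * (a + b + 1)" e])
      show "?h i \<in> borel_measurable borel" for i by (cases i) simp
      show "\<bar>?h i t\<bar> \<le> B" if "0 \<le> t" "t \<le> 1" for i t
        using bf[OF that, of "fst i"] qB[OF that, of "fst i"] by (cases i) auto
      show "real (?L i) \<le> real n * (a + b + 1)" for i using kl Kk by (cases i) auto
    qed (use e in auto)
    have "prob {\<omega> \<in> space M. real (lpp0 (\<lambda>z. X01 (\<sigma> z) \<omega>) k l) \<le> (a * \<alpha> 0 + b * \<beta> 0 - \<delta> * (2 + \<beta> 0)) * real n}
      \<le> prob (space M - \<Gamma>) + 7 * (real n * (a + b + 1) * V / e\<^sup>2)"
    proof (rule prob_lpp0_le[OF inj \<Gamma>(1), of k l "\<lambda>x. x \<le> (a * \<alpha> 0 + b * \<beta> 0 - \<delta> * (2 + \<beta> 0)) * real n"])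
      show "0 \<le> 7 * (real n * (a + b + 1) * V / e\<^sup>2)" using ab V0 by simp
      show "AE \<omega> in M. \<omega> \<in> \<Gamma> \<longrightarrow> measure_pmf.prob (weights k l (\<lambda>z. p (snd (\<sigma> z)) \<omega>))
          {w. real (lpp0 w k l) \<le> (a * \<alpha> 0 + b * \<beta> 0 - \<delta> * (2 + \<beta> 0)) * real n} \<le> 7 * (real n * (a + b + 1) * V / e\<^sup>2)"
      proof (intro AE_I2 impI)
        fix \<omega> assume \<omega>: "\<omega> \<in> space M" "\<omega> \<in> \<Gamma>"
        let ?P = "\<lambda>z. g (p (snd (\<sigma> z)) \<omega>)" and ?q = "\<lambda>i s. qf i (p s \<omega>)" and ?\<rho> = "\<lambda>i t. \<rho>f i (p t \<omega>)"
        have p01: "0 \<le> p j \<omega>" "p j \<omega> \<le> 1" for j using p_range[OF \<omega>(1), of j] by auto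
        have g01: "0 \<le> g (p j \<omega>)" "g (p j \<omega>) \<le> p j \<omega>" "g (p j \<omega>) \<le> 1" for j
          using g[OF p01, of j] p01[of j] by auto
        have st: "stationary k l ?P (?q i) (?\<rho> i) r" for i
          unfolding stationary_def using r range[OF p01] g01 balance[OF \<omega>(1)] by auto
        have dq: "\<bar>(\<Sum>s<k. ?q i s) - real k * \<alpha> i\<bar> < e" if "i < 3" for i
          using \<Gamma>(3)[OF \<omega>(2), of "(i, True, True)"] that by (simp add: \<alpha>_def)
        have db: "\<bar>(\<Sum>t<l. ?bf i (p t \<omega>)) - real l * \<beta> i\<bar> < e" if "i < 3" for i
          using \<Gamma>(3)[OF \<omega>(2), of "(i, False, True)"] that by (simp add: \<beta>_def)
        have dqK: "\<bar>(\<Sum>s<K. ?q i s) - real K * \<alpha> i\<bar> < e" if "i < 3" for i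
          using \<Gamma>(3)[OF \<omega>(2), of "(i, True, False)"] that by (simp add: \<alpha>_def)
        have dbK: "\<bar>(\<Sum>t<K. ?bf i (p t \<omega>)) - real K * \<beta> i\<bar> < e" if "i < 3" for i
          using \<Gamma>(3)[OF \<omega>(2), of "(i, False, False)"] that by (simp add: \<beta>_def)
        let ?sm = "\<lambda>i. stationary_mean k l (?q i) (?\<rho> i)"
        have sm_le: "?sm i \<le> real n * (a * \<alpha> i + b * \<beta> i) + B + 2 * e" if "i < 3" for i
        proof -
          have "real k * \<alpha> i \<le> real n * a * \<alpha> i" using k(1) \<alpha>(1) by (rule mult_right_mono)
          moreover have "real l * \<beta> i \<le> (real n * b + 1) * \<beta> i" using l(1) \<beta>(1) by (rule mult_right_mono)
          ultimately show ?thesis using dq[OF that] db[OF that] \<beta>(2)[of i] unfolding stationary_mean_def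
            by (simp add: algebra_simps)
        qed
        have sm_ge: "real n * (a * \<alpha> 0 + b * \<beta> 0) - B - 2 * e \<le> ?sm 0"
        proof -
          have "(real n * a - 1) * \<alpha> 0 \<le> real k * \<alpha> 0" using k(2) \<alpha>(1) by (rule mult_right_mono)
          moreover have "real n * b * \<beta> 0 \<le> real l * \<beta> 0" using l(2) \<beta>(1) by (rule mult_right_mono)
          ultimately show ?thesis using dq[of 0] db[of 0] \<alpha>(2)[of 0] B1 unfolding stationary_mean_def
            by (simp add: algebra_simps)
        qed
        have gain1: "?sm 1 - ?sm 0 + 6 * e \<le> (\<Sum>s<K. ?q 1 s) - (\<Sum>s<K. ?q 0 s)"
        proof -
          have "(real n * \<delta> - 1) * (\<alpha> 1 - \<alpha> 0) \<le> real K * (\<alpha> 1 - \<alpha> 0)"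
            using K(2) \<alpha>01 by (intro mult_right_mono) auto
          then have K\<alpha>: "real n * (\<delta> * (\<alpha> 1 - \<alpha> 0)) - B \<le> real K * \<alpha> 1 - real K * \<alpha> 0"
            using \<alpha>[of 0] \<alpha>[of 1] B1 by (simp add: algebra_simps)
          have "real n * gap \<le> real n * (\<delta> * (\<alpha> 1 - \<alpha> 0) - (a * \<alpha> 1 + b * \<beta> 1 - (a * \<alpha> 0 + b * \<beta> 0)))"
            unfolding gap_def by (intro mult_left_mono) auto
          then have "real n * (a * \<alpha> 1 + b * \<beta> 1) - real n * (a * \<alpha> 0 + b * \<beta> 0) + 24 * e \<le> real n * (\<delta> * (\<alpha> 1 - \<alpha> 0))"
            using gape(1) by (simp add: right_diff_distrib mult.commute)
          then show ?thesis using K\<alpha> sm_le[of 1] sm_ge dqK[of 0] dqK[of 1] Be by simp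
        qed
        have gain2: "?sm 2 - ?sm 0 + 6 * e \<le> (\<Sum>t<K. ?bf 2 (p t \<omega>)) - (\<Sum>t<K. ?bf 0 (p t \<omega>))"
        proof -
          have "(real n * \<delta> - 1) * (\<beta> 2 - \<beta> 0) \<le> real K * (\<beta> 2 - \<beta> 0)"
            using K(2) \<beta>02 by (intro mult_right_mono) auto
          then have K\<beta>: "real n * (\<delta> * (\<beta> 2 - \<beta> 0)) - B \<le> real K * \<beta> 2 - real K * \<beta> 0"
            using \<beta>[of 0] \<beta>[of 2] by (simp add: algebra_simps)
          have "real n * gap \<le> real n * (\<delta> * (\<beta> 2 - \<beta> 0) - (a * \<alpha> 2 + b * \<beta> 2 - (a * \<alpha> 0 + b * \<beta> 0)))"
            unfolding gap_def by (intro mult_left_mono) auto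
          then have "real n * (a * \<alpha> 2 + b * \<beta> 2) - real n * (a * \<alpha> 0 + b * \<beta> 0) + 24 * e \<le> real n * (\<delta> * (\<beta> 2 - \<beta> 0))"
            using gape(1) by (simp add: right_diff_distrib mult.commute)
          then show ?thesis using K\<beta> sm_le[of 2] sm_ge dbK[of 0] dbK[of 2] Be by simp
        qed
        have "real K * \<beta> 0 \<le> real n * \<delta> * \<beta> 0" using K(1) \<beta>(1) by (rule mult_right_mono)
        then have le: "(a * \<alpha> 0 + b * \<beta> 0 - \<delta> * (2 + \<beta> 0)) * real n
            \<le> ?sm 0 - (3 * e + real K + (\<Sum>t<K. ?bf 0 (p t \<omega>)))"
          using sm_ge dbK[of 0] K(1) gape(2) Be by (simp add: algebra_simps)
        \<comment> \<open>The actual probabilities dominate \<open>g (p j)\<close>, so replacing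
          them by the latter can only make a small value more likely.\<close>
        have "measure_pmf.prob (weights k l (\<lambda>z. p (snd (\<sigma> z)) \<omega>))
            {w. real (lpp0 w k l) \<le> (a * \<alpha> 0 + b * \<beta> 0 - \<delta> * (2 + \<beta> 0)) * real n}
          \<le> measure_pmf.prob (weights k l ?P) {w. real (lpp0 w k l) \<le> (a * \<alpha> 0 + b * \<beta> 0 - \<delta> * (2 + \<beta> 0)) * real n}"
          by (rule weights_mono) (use g01 p01 in auto)
        also have "\<dots> \<le> measure_pmf.prob (weights k l ?P) {w. real (lpp0 w k l) \<le> ?sm 0 - (3 * e + real K + (\<Sum>t<K. ?bf 0 (p t \<omega>)))}"
          using le by (intro measure_pmf.finite_measure_mono) auto
        also have "\<dots> \<le> 7 * (real (k + l) * V / e\<^sup>2)"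
          unfolding V_def
          by (rule lpp0_lower_deviation[OF st st st r(1) e Kk Kl _ _ gain1 gain2]) (use mono p01 in auto)
        also have "\<dots> \<le> 7 * (real n * (a + b + 1) * V / e\<^sup>2)"
          using kl V0 by (intro mult_left_mono divide_right_mono mult_right_mono) auto
        finally show "measure_pmf.prob (weights k l (\<lambda>z. p (snd (\<sigma> z)) \<omega>))
            {w. real (lpp0 w k l) \<le> (a * \<alpha> 0 + b * \<beta> 0 - \<delta> * (2 + \<beta> 0)) * real n} \<le> 7 * (real n * (a + b + 1) * V / e\<^sup>2)" .
      qed
    qed
    also have "\<dots> \<le> 12 * (real n * (a + b + 1) * B\<^sup>2 / e\<^sup>2) + 7 * (real n * (a + b + 1) * V / e\<^sup>2)"
      using \<Gamma>(2) by (simp add: card_cartesian_product)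
    also have "\<dots> = C / real n" using n1 \<eta> by (simp add: C_def e_def field_simps power2_eq_square)
    finally show ?thesis unfolding k_def l_def .
  qed
  then show ?thesis by blast
qed

end

subsection \<open>One-parameter families of boundaries\<close>

text \<open>
  Truncating the probabilities at \<open>c\<close> lowers the weights, and puts an atom at \<open>c\<close> when \<open>c\<close> is below the
  essential supremum. Then the critical equation is solvable, which is what lower bounds need in the
  regimes where the infimum of the means is not attained.
\<close>

definition cap :: "real \<Rightarrow> real \<Rightarrow> real" where
  "cap c t = min t c"

text \<open>The averaged geometric mean for constant Bernoulli parameter \<open>u\<close>. In a row
  of capped probability g, balance forces \<rho> = g(1-u)/(u(1-g)), and the integrand is
  \<rho>/(1-\<rho>).\<close>

definition right_mean :: "real measure \<Rightarrow> real \<Rightarrow> real \<Rightarrow> real" where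
  "right_mean \<mu> c u = (\<integral>t. cap c t * (1 - u) / (u - cap c t) \<partial>\<mu>)"

text \<open>Minus the divided difference of \<open>right_mean\<close> between \<open>u\<close> and
  \<open>v\<close>; on the diagonal, minus its derivative and, when the cap is inactive, the
  integral of the critical equation.\<close>

definition right_slope :: "real measure \<Rightarrow> real \<Rightarrow> real \<Rightarrow> real \<Rightarrow> real" where
  "right_slope \<mu> c u v = (\<integral>t. cap c t * (1 - cap c t) / ((u - cap c t) * (v - cap c t)) \<partial>\<mu>)"

text \<open>The averaged Bernoulli parameter when the geometric parameter is the constant
  \<open>z / (1 + z)\<close>, whose mean is \<open>z\<close>; the integrand balances it against
  probability t.\<close>

definition up_mean :: "real measure \<Rightarrow> real \<Rightarrow> real" where
  "up_mean \<mu> z = (\<integral>t. t * (1 + z) / (t + z) \<partial>\<mu>)"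

text \<open>Minus the divided difference of \<open>up_mean\<close>.\<close>

definition up_slope :: "real measure \<Rightarrow> real \<Rightarrow> real \<Rightarrow> real" where
  "up_slope \<mu> z v = (\<integral>t. t * (1 - t) / ((t + z) * (t + v)) \<partial>\<mu>)"

lemma cap_measurable[measurable]: "cap c \<in> borel_measurable borel"
  unfolding cap_def by measurable

lemma cap_bounds:
  assumes "0 \<le> t" "0 \<le> c"
  shows "0 \<le> cap c t" "cap c t \<le> c" "cap c t \<le> t"
  using assms by (auto simp: cap_def)

lemma exists_small:
  fixes A B K :: real
  assumes "0 < A" "0 < B" "0 \<le> K"
  shows "\<exists>s>0. s < A \<and> K * s < B"
proof -
  \<comment> \<open>The denominator \<open>K + 1\<close> stays positive for
    \<open>K = 0\<close>.\<close>
  define D where "D = B / (K + 1)"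
  define s where "s = min A D / 2"
  have "0 < D" using assms by (auto simp: D_def)
  then have "0 < s" "s < A" "s < D" using assms by (auto simp: s_def min_def)
  then have s: "0 < s" "s < A" "s < B / (K + 1)" by (auto simp: D_def)
  then have "s * (K + 1) < B" using assms by (simp add: pos_less_divide_eq)
  then have "K * s < B" using s by (simp add: algebra_simps)
  then show ?thesis using s by blast
qed

section \<open>Almost sure linear bounds for passage values\<close>

context bernoulli_environment
begin

text \<open>\<open>a\<close> scales the strict axis and \<open>b\<close> the weak one;
  \<open>Suc\<close> because a bound on the row index includes row 0.\<close>

definition passage :: "(nat \<times> nat \<Rightarrow> nat \<times> nat) \<Rightarrow> real \<Rightarrow> real \<Rightarrow> nat \<Rightarrow> 'w \<Rightarrow> real" where
  "passage \<sigma> a b n \<omega> = real (lpp0 (\<lambda>z. X01 (\<sigma> z) \<omega>) (nat \<lfloor>real n * a\<rfloor>) (Suc (nat \<lfloor>real n * b\<rfloor>)))"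

text \<open>The margin \<open>e\<close> is quantified outside the almost sure statement, so each
  margin needs one Borel--Cantelli argument and bounds pass to limits in \<open>c\<close>. Countably
  many margins are merged only in \<open>AE_tendsto\<close>.\<close>

definition liminf_ge :: "(nat \<times> nat \<Rightarrow> nat \<times> nat) \<Rightarrow> real \<Rightarrow> real \<Rightarrow> real \<Rightarrow> bool" where
  "liminf_ge \<sigma> a b c \<longleftrightarrow> (\<forall>e>0. AE \<omega> in M. eventually (\<lambda>n. (c - e) * real n \<le> passage \<sigma> a b n \<omega>) sequentially)"

definition limsup_le :: "(nat \<times> nat \<Rightarrow> nat \<times> nat) \<Rightarrow> real \<Rightarrow> real \<Rightarrow> real \<Rightarrow> bool" where
  "limsup_le \<sigma> a b c \<longleftrightarrow> (\<forall>e>0. AE \<omega> in M. eventually (\<lambda>n. passage \<sigma> a b n \<omega> \<le> (c + e) * real n) sequentially)"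

lemma liminf_geD:
  "liminf_ge \<sigma> a b c \<Longrightarrow> 0 < e \<Longrightarrow> AE \<omega> in M. eventually (\<lambda>n. (c - e) * real n \<le> passage \<sigma> a b n \<omega>) sequentially"
  by (simp add: liminf_ge_def)

lemma limsup_leD:
  "limsup_le \<sigma> a b c \<Longrightarrow> 0 < e \<Longrightarrow> AE \<omega> in M. eventually (\<lambda>n. passage \<sigma> a b n \<omega> \<le> (c + e) * real n) sequentially"
  by (simp add: limsup_le_def)

lemma passage_measurable: "passage \<sigma> a b n \<in> borel_measurable M"
  unfolding passage_def[abs_def] by (rule borel_measurable_lpp0) measurable

lemma passage_nonneg: "0 \<le> passage \<sigma> a b n \<omega>"
  by (simp add: passage_def)

lemma passage_mono:
  assumes "a \<le> a'" "b \<le> b'"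
  shows "passage \<sigma> a b n \<omega> \<le> passage \<sigma> a' b' n \<omega>"
  unfolding passage_def using assms
  by (intro of_nat_mono lpp0_mono nat_mono floor_mono Suc_le_mono[THEN iffD2] mult_left_mono) auto

lemma passage_mono_n:
  assumes "0 \<le> a" "0 \<le> b" "m \<le> n"
  shows "passage \<sigma> a b m \<omega> \<le> passage \<sigma> a b n \<omega>"
  unfolding passage_def using assms
  by (intro of_nat_mono lpp0_mono nat_mono floor_mono Suc_le_mono[THEN iffD2] mult_right_mono) auto

lemma passage_le:
  assumes "0 \<le> a"
  shows "passage \<sigma> a b n \<omega> \<le> a * real n"
proof -
  have "lpp0 (\<lambda>z. X01 (\<sigma> z) \<omega>) (nat \<lfloor>real n * a\<rfloor>) (Suc (nat \<lfloor>real n * b\<rfloor>)) \<le> nat \<lfloor>real n * a\<rfloor>"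
    by (rule lpp0_le) (simp add: X01_def)
  then have "passage \<sigma> a b n \<omega> \<le> real (nat \<lfloor>real n * a\<rfloor>)" by (simp add: passage_def)
  also have "\<dots> \<le> a * real n" using assms by (simp add: mult.commute)
  finally show ?thesis .
qed

lemma limsup_le_trivial:
  assumes "0 \<le> a"
  shows "limsup_le \<sigma> a b a"
  unfolding limsup_le_def
proof (intro allI impI AE_I2 always_eventually)
  fix e :: real and \<omega> n assume "0 < e"
  then have "0 \<le> e * real n" by simp
  then show "passage \<sigma> a b n \<omega> \<le> (a + e) * real n"
    using passage_le[OF assms, of \<sigma> b n \<omega>] by (simp add: distrib_right)
qed

lemma liminf_ge_0: "liminf_ge \<sigma> a b 0"
  unfolding liminf_ge_def
proof (intro allI impI AE_I2 always_eventually)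
  fix e :: real and \<omega> n assume "0 < e"
  then have "(0 - e) * real n \<le> 0" by (simp add: mult_nonpos_nonneg)
  then show "(0 - e) * real n \<le> passage \<sigma> a b n \<omega>" using passage_nonneg[of \<sigma> a b n \<omega>] by linarith
qed

lemma liminf_ge_mono:
  assumes "liminf_ge \<sigma> a b c" "a \<le> a'" "b \<le> b'" "c' \<le> c"
  shows "liminf_ge \<sigma> a' b' c'"
  unfolding liminf_ge_def
proof (intro allI impI)
  fix e :: real assume "0 < e"
  then have "AE \<omega> in M. eventually (\<lambda>n. (c - e) * real n \<le> passage \<sigma> a b n \<omega>) sequentially"
    using assms(1) by (auto simp: liminf_ge_def)
  then show "AE \<omega> in M. eventually (\<lambda>n. (c' - e) * real n \<le> passage \<sigma> a' b' n \<omega>) sequentially"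
  proof (eventually_elim)
    case (elim \<omega>)
    then show ?case
    proof (eventually_elim)
      case (elim n)
      have "(c' - e) * real n \<le> (c - e) * real n" using assms(4) by (intro mult_right_mono) auto
      then show ?case using elim passage_mono[OF assms(2,3), of \<sigma> n \<omega>] by linarith
    qed
  qed
qed

lemma limsup_le_mono:
  assumes "limsup_le \<sigma> a b c" "c \<le> c'"
  shows "limsup_le \<sigma> a b c'"
  unfolding limsup_le_def
proof (intro allI impI)
  fix e :: real assume "0 < e"
  then have "AE \<omega> in M. eventually (\<lambda>n. passage \<sigma> a b n \<omega> \<le> (c + e) * real n) sequentially"
    using assms(1) by (auto simp: limsup_le_def)
  then show "AE \<omega> in M. eventually (\<lambda>n. passage \<sigma> a b n \<omega> \<le> (c' + e) * real n) sequentially"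
  proof (eventually_elim)
    case (elim \<omega>)
    then show ?case
    proof (eventually_elim)
      case (elim n)
      have "(c + e) * real n \<le> (c' + e) * real n" using assms(2) by (intro mult_right_mono) auto
      then show ?case using elim by linarith
    qed
  qed
qed

lemma liminf_ge_lim:
  assumes "\<And>i::nat. liminf_ge \<sigma> a b (f i)" "f \<longlonglongrightarrow> c"
  shows "liminf_ge \<sigma> a b c"
  unfolding liminf_ge_def
proof (intro allI impI)
  fix e :: real assume e: "0 < e"
  then have "eventually (\<lambda>i. c - e / 2 < f i) sequentially" using assms(2) by (intro order_tendstoD) auto
  then obtain i where "c - e / 2 < f i" by (auto simp: eventually_sequentially)
  then have "liminf_ge \<sigma> a b (c - e / 2)" using assms(1)[of i] by (auto intro: liminf_ge_mono)
  then show "AE \<omega> in M. eventually (\<lambda>n. (c - e) * real n \<le> passage \<sigma> a b n \<omega>) sequentially"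
    using liminf_geD[of \<sigma> a b "c - e / 2" "e / 2"] e by simp
qed

lemma limsup_le_lim:
  assumes "\<And>i::nat. limsup_le \<sigma> a b (f i)" "f \<longlonglongrightarrow> c"
  shows "limsup_le \<sigma> a b c"
  unfolding limsup_le_def
proof (intro allI impI)
  fix e :: real assume e: "0 < e"
  then have "eventually (\<lambda>i. f i < c + e / 2) sequentially" using assms(2) by (intro order_tendstoD) auto
  then obtain i where "f i < c + e / 2" by (auto simp: eventually_sequentially)
  then have "limsup_le \<sigma> a b (c + e / 2)" using assms(1)[of i] by (auto intro: limsup_le_mono)
  then show "AE \<omega> in M. eventually (\<lambda>n. passage \<sigma> a b n \<omega> \<le> (c + e) * real n) sequentially"
    using limsup_leD[of \<sigma> a b "c + e / 2" "e / 2"] e by (simp add: add.assoc)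
qed

lemma AE_tendsto:
  assumes "liminf_ge \<sigma> a b c" "limsup_le \<sigma> a b c"
  shows "AE \<omega> in M. (\<lambda>n. passage \<sigma> a b n \<omega> / real n) \<longlonglongrightarrow> c"
proof -
  have "AE \<omega> in M. \<forall>i::nat. eventually (\<lambda>n. (c - 1 / Suc i) * real n \<le> passage \<sigma> a b n \<omega>) sequentially
      \<and> eventually (\<lambda>n. passage \<sigma> a b n \<omega> \<le> (c + 1 / Suc i) * real n) sequentially"
    using assms unfolding liminf_ge_def limsup_le_def by (subst AE_all_countable) auto
  then show ?thesis
  proof (eventually_elim)
    case (elim \<omega>)
    show ?case
    proof (rule tendstoI)
      fix e :: real assume "0 < e"
      then obtain i where i: "1 / Suc i < e" using nat_approx_posE by blast
      have "eventually (\<lambda>n. (c - 1 / Suc i) * real n \<le> passage \<sigma> a b n \<omega>) sequentially"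
        "eventually (\<lambda>n. passage \<sigma> a b n \<omega> \<le> (c + 1 / Suc i) * real n) sequentially" using elim by auto
      then show "eventually (\<lambda>n. dist (passage \<sigma> a b n \<omega> / real n) c < e) sequentially"
        using eventually_gt_at_top[of 0]
      proof eventually_elim
        case (elim n)
        then have "c - 1 / Suc i \<le> passage \<sigma> a b n \<omega> / real n" "passage \<sigma> a b n \<omega> / real n \<le> c + 1 / Suc i"
          by (simp_all add: pos_le_divide_eq pos_divide_le_eq)
        then show ?case using i by (simp add: dist_real_def abs_less_iff)
      qed
    qed
  qed
qed

lemma T_right_eq_passage: "AE \<omega> in M. \<forall>n. T_right (\<lambda>z. X z \<omega>) (nat \<lfloor>real n * x\<rfloor>) (nat \<lfloor>real n * y\<rfloor>) = passage id x y n \<omega>"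
  using AE_X_eq_X01
proof eventually_elim
  case (elim \<omega>)
  then show ?case unfolding passage_def
    by (intro allI T_right_eq_lpp0[where v = "\<lambda>z. X01 (id z) \<omega>"]) simp
qed

text \<open>Upward paths are strict in the second coordinate, so \<open>y\<close> becomes the extent
  of the strict axis after transposition.\<close>

lemma T_up_eq_passage: "AE \<omega> in M. \<forall>n. T_up (\<lambda>z. X z \<omega>) (nat \<lfloor>real n * x\<rfloor>) (nat \<lfloor>real n * y\<rfloor>) = passage prod.swap y x n \<omega>"
  using AE_X_eq_X01
proof eventually_elim
  case (elim \<omega>)
  then show ?case unfolding passage_def T_up_eq_T_right
    by (intro allI T_right_eq_lpp0[where v = "\<lambda>z. X01 (prod.swap z) \<omega>"]) simp
qed

lemma Psi_right_isI:
  assumes "liminf_ge id x y c" "limsup_le id x y c"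
  shows "Psi_right_is M X x y c"
  unfolding Psi_right_is_def
  using AE_tendsto[OF assms] T_right_eq_passage[of x y] by eventually_elim simp

lemma Psi_up_isI:
  assumes "liminf_ge prod.swap y x c" "limsup_le prod.swap y x c"
  shows "Psi_up_is M X x y c"
  unfolding Psi_up_is_def
  using AE_tendsto[OF assms] T_up_eq_passage[of x y] by eventually_elim simp

text \<open>\<kappa> is the loss of \<open>prob_lpp0_lower\<close> per unit of \<delta>. It does not
  depend on \<delta>, so \<delta> can be chosen to keep the loss within half the margin; the other
  half goes to the passage through squares.\<close>

lemma liminf_geI:
  assumes ab: "0 < a" "0 < b" and \<kappa>: "0 < \<kappa>"
    and bound: "\<And>\<delta>. 0 < \<delta> \<Longrightarrow> \<delta> \<le> a \<Longrightarrow> \<delta> \<le> b \<Longrightarrow>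
      \<exists>C m0. \<forall>n\<ge>m0. prob {\<omega> \<in> space M. passage \<sigma> a b n \<omega> \<le> (h - \<delta> * \<kappa>) * real n} \<le> C / real n"
  shows "liminf_ge \<sigma> a b h"
  unfolding liminf_ge_def
proof (intro allI impI)
  fix e :: real assume e: "0 < e"
  define \<delta> where "\<delta> = min (min a b) (e / (2 * \<kappa>))"
  have "\<delta> * \<kappa> \<le> e / (2 * \<kappa>) * \<kappa>" unfolding \<delta>_def using \<kappa> by (intro mult_right_mono) auto
  then have \<delta>: "0 < \<delta>" "\<delta> \<le> a" "\<delta> \<le> b" "\<delta> * \<kappa> \<le> e / 2"
    using ab \<kappa> e by (auto simp: \<delta>_def)
  from bound[OF \<delta>(1-3)] obtain C m0 where
    "\<And>n. m0 \<le> n \<Longrightarrow> prob {\<omega> \<in> space M. passage \<sigma> a b n \<omega> \<le> (h - \<delta> * \<kappa>) * real n} \<le> C / real n" by blast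
  then have "AE \<omega> in M. eventually (\<lambda>n. (h - \<delta> * \<kappa> - e / 2) * real n \<le> passage \<sigma> a b n \<omega>) sequentially"
    using ab e by (intro AE_liminf_of_squares[where nmin = m0 and C = C] passage_measurable passage_mono_n passage_nonneg) auto
  then show "AE \<omega> in M. eventually (\<lambda>n. (h - e) * real n \<le> passage \<sigma> a b n \<omega>) sequentially"
  proof eventually_elim
    case (elim \<omega>)
    then show ?case
    proof eventually_elim
      case (elim n)
      have "(h - e) * real n \<le> (h - \<delta> * \<kappa> - e / 2) * real n" using \<delta>(4) by (intro mult_right_mono) auto
      then show ?case using elim by linarith
    qed
  qed
qed

lemma limsup_leI:
  assumes ab: "0 \<le> a" "0 \<le> b" and h: "0 \<le> h"
    and bound: "\<And>\<epsilon>. 0 < \<epsilon> \<Longrightarrow>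
      \<exists>C m0. \<forall>n\<ge>m0. prob {\<omega> \<in> space M. (h + \<epsilon>) * real n \<le> passage \<sigma> a b n \<omega>} \<le> C / real n"
  shows "limsup_le \<sigma> a b h"
  unfolding limsup_le_def
proof (intro allI impI)
  fix e :: real assume e: "0 < e"
  from bound[of "e / 2"] e obtain C m0 where
    "\<And>n. m0 \<le> n \<Longrightarrow> prob {\<omega> \<in> space M. (h + e / 2) * real n \<le> passage \<sigma> a b n \<omega>} \<le> C / real n" by auto
  then have "AE \<omega> in M. eventually (\<lambda>n. passage \<sigma> a b n \<omega> \<le> (h + e / 2 + e / 2) * real n) sequentially"
    using ab e h by (intro AE_limsup_of_squares[where nmin = m0 and C = C] passage_measurable passage_mono_n) auto
  then show "AE \<omega> in M. eventually (\<lambda>n. passage \<sigma> a b n \<omega> \<le> (h + e) * real n) sequentially" by (simp add: add.assoc)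
qed

lemma integral_law_lipschitz:
  assumes "integrable \<mu> f" "integrable \<mu> g" "\<And>t. 0 \<le> t \<Longrightarrow> t \<le> 1 \<Longrightarrow> \<bar>f t - g t\<bar> \<le> (d::real)"
  shows "\<bar>(\<integral>t. f t \<partial>\<mu>) - (\<integral>t. g t \<partial>\<mu>)\<bar> \<le> d"
proof -
  interpret \<mu>: prob_space \<mu> by (rule prob_space_law)
  have AE: "AE t in \<mu>. \<bar>f t - g t\<bar> \<le> d" using AE_law_unit by eventually_elim (use assms(3) in auto)
  have "\<bar>(\<integral>t. f t \<partial>\<mu>) - (\<integral>t. g t \<partial>\<mu>)\<bar> = \<bar>\<integral>t. f t - g t \<partial>\<mu>\<bar>"
    using assms by simp
  also have "\<dots> \<le> (\<integral>t. \<bar>f t - g t\<bar> \<partial>\<mu>)" by (rule integral_abs_bound)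
  also have "\<dots> \<le> (\<integral>t. d \<partial>\<mu>)" using assms AE by (intro integral_mono_AE) auto
  finally show ?thesis by (simp add: \<mu>.prob_space)
qed

section \<open>Rightward boundaries: constant Bernoulli parameter\<close>

lemma right_slope_integrable:
  assumes "0 \<le> c" "c < u" "c < v" "c \<le> 1"
  shows "integrable \<mu> (\<lambda>t. cap c t * (1 - cap c t) / ((u - cap c t) * (v - cap c t)))"
proof (rule integral_law_bounds(1)[where B = "1 / ((u - c) * (v - c))"])
  fix t :: real assume t: "0 \<le> t" "t \<le> 1"
  note cap = cap_bounds[OF t(1) assms(1)]
  have "cap c t * (1 - cap c t) \<le> 1 * 1" using cap assms by (intro mult_mono) auto
  moreover have "(u - c) * (v - c) \<le> (u - cap c t) * (v - cap c t)" using cap assms by (intro mult_mono) auto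
  moreover have "0 < (u - c) * (v - c)" using assms by simp
  moreover have "0 \<le> cap c t * (1 - cap c t)" using cap assms by simp
  ultimately show "0 \<le> cap c t * (1 - cap c t) / ((u - cap c t) * (v - cap c t)) \<and>
      cap c t * (1 - cap c t) / ((u - cap c t) * (v - cap c t)) \<le> 1 / ((u - c) * (v - c))"
    using cap assms by (auto intro!: frac_le)
qed measurable

lemma right_mean_integrable:
  assumes "0 \<le> c" "c < u" "u \<le> 1"
  shows "integrable \<mu> (\<lambda>t. cap c t * (1 - u) / (u - cap c t))" "0 \<le> right_mean \<mu> c u"
proof -
  have "0 \<le> cap c t * (1 - u) / (u - cap c t) \<and> cap c t * (1 - u) / (u - cap c t) \<le> 1 / (u - c)"
    if t: "0 \<le> t" "t \<le> 1" for t
  proof -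
    note cap = cap_bounds[OF t(1) assms(1)]
    have "cap c t * (1 - u) \<le> 1 * 1" using cap assms by (intro mult_mono) auto
    then show ?thesis using cap assms by (auto intro!: frac_le)
  qed
  note b = integral_law_bounds[OF _ this, simplified]
  show "integrable \<mu> (\<lambda>t. cap c t * (1 - u) / (u - cap c t))" "0 \<le> right_mean \<mu> c u"
    unfolding right_mean_def by (rule b; measurable)+
qed

text \<open>Pointwise, (1-v)(u-g) - (1-u)(v-g) = (u-v)(1-g). This exact identity replaces
  differentiation under the integral.\<close>

lemma right_mean_diff:
  assumes "0 \<le> c" "c < u" "u \<le> 1" "c < v" "v \<le> 1"
  shows "right_mean \<mu> c v - right_mean \<mu> c u = (u - v) * right_slope \<mu> c u v"
proof -
  have "right_mean \<mu> c v - right_mean \<mu> c u =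
      (\<integral>t. cap c t * (1 - v) / (v - cap c t) - cap c t * (1 - u) / (u - cap c t) \<partial>\<mu>)"
    unfolding right_mean_def using assms by (intro Bochner_Integration.integral_diff[symmetric] right_mean_integrable) auto
  also have "\<dots> = (\<integral>t. (u - v) * (cap c t * (1 - cap c t) / ((u - cap c t) * (v - cap c t))) \<partial>\<mu>)"
  proof (rule Bochner_Integration.integral_cong[OF refl])
    fix t
    have "u - cap c t \<noteq> 0" "v - cap c t \<noteq> 0" using assms by (auto simp: cap_def)
    then show "cap c t * (1 - v) / (v - cap c t) - cap c t * (1 - u) / (u - cap c t) =
       (u - v) * (cap c t * (1 - cap c t) / ((u - cap c t) * (v - cap c t)))"
      by (simp add: divide_simps) (simp add: algebra_simps)
  qed
  also have "\<dots> = (u - v) * right_slope \<mu> c u v"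
    unfolding right_slope_def by (rule integral_mult_right_zero)
  finally show ?thesis .
qed

text \<open>The difference has three factors in its denominator, each at least \<open>m - c\<close>,
  and a numerator at most 1 times the displacement.\<close>

lemma right_slope_lipschitz:
  assumes "0 \<le> c" "c \<le> 1" "c < m" "m \<le> u" "m \<le> v" "m \<le> w"
  shows "\<bar>right_slope \<mu> c w u - right_slope \<mu> c w v\<bar> \<le> 1 / (m - c) ^ 3 * \<bar>u - v\<bar>"
  unfolding right_slope_def
proof (rule integral_law_lipschitz)
  fix t :: real assume t: "0 \<le> t" "t \<le> 1"
  let ?g = "cap c t"
  note cap = cap_bounds[OF t(1) assms(1)]
  have pos: "0 < w - ?g" "0 < u - ?g" "0 < v - ?g" using cap assms by auto
  have eq: "?g * (1 - ?g) / ((w - ?g) * (u - ?g)) - ?g * (1 - ?g) / ((w - ?g) * (v - ?g))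
     = ?g * (1 - ?g) / ((w - ?g) * (u - ?g) * (v - ?g)) * (v - u)"
    using pos by (simp add: divide_simps) (simp add: algebra_simps)
  have "?g * (1 - ?g) \<le> 1 * 1" using cap assms by (intro mult_mono) auto
  moreover have "0 \<le> ?g * (1 - ?g)" using cap assms by simp
  moreover have "(m - c) ^ 3 \<le> (w - ?g) * (u - ?g) * (v - ?g)"
    unfolding power3_eq_cube using cap assms pos by (intro mult_mono) auto
  ultimately have "?g * (1 - ?g) / ((w - ?g) * (u - ?g) * (v - ?g)) \<le> 1 / (m - c) ^ 3"
    using assms by (intro frac_le) auto
  moreover have "0 \<le> ?g * (1 - ?g) / ((w - ?g) * (u - ?g) * (v - ?g))" using pos \<open>0 \<le> ?g * (1 - ?g)\<close> by auto
  ultimately show "\<bar>?g * (1 - ?g) / ((w - ?g) * (u - ?g)) - ?g * (1 - ?g) / ((w - ?g) * (v - ?g))\<bar> \<le> 1 / (m - c) ^ 3 * \<bar>u - v\<bar>"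
    unfolding eq abs_mult abs_of_nonneg[OF \<open>0 \<le> ?g * (1 - ?g) / ((w - ?g) * (u - ?g) * (v - ?g))\<close>]
      abs_minus_commute[of v u] by (intro mult_right_mono) auto
qed (use assms in \<open>auto intro!: right_slope_integrable\<close>)

lemma right_slope_mono:
  assumes "0 \<le> c" "c \<le> 1" "c < u" "u \<le> v" "c < w"
  shows "right_slope \<mu> c w v \<le> right_slope \<mu> c w u"
  unfolding right_slope_def
proof (rule integral_mono_AE)
  show "AE t in \<mu>. cap c t * (1 - cap c t) / ((w - cap c t) * (v - cap c t))
      \<le> cap c t * (1 - cap c t) / ((w - cap c t) * (u - cap c t))"
    using AE_law_unit
  proof eventually_elim
    case (elim t)
    then show ?case using cap_bounds[of t c] assms by (intro divide_left_mono mult_left_mono mult_pos_pos mult_nonneg_nonneg) auto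
  qed
qed (use assms in \<open>auto intro!: right_slope_integrable\<close>)

text \<open>The geometric parameter increases in g and decreases in u. Used with \<open>c\<close>
  equal to \<open>g\<close>, the bound also compares two values of u.\<close>

lemma right_\<rho>_bound:
  assumes "0 \<le> (g::real)" "g \<le> c" "c < m" "m \<le> u" "u \<le> 1"
  shows "0 \<le> g * (1 - u) / (u * (1 - g)) \<and> g * (1 - u) / (u * (1 - g)) \<le> (c * (1 - m)) / (m * (1 - c))"
proof -
  have "g * (1 - u) \<le> c * (1 - m)" using assms by (intro mult_mono) auto
  moreover have "m * (1 - c) \<le> u * (1 - g)" using assms by (intro mult_mono) auto
  moreover have "0 < m * (1 - c)" using assms by (intro mult_pos_pos) auto
  moreover have "0 \<le> g * (1 - u)" using assms by simp
  ultimately show ?thesis using assms by (auto intro!: frac_le divide_nonneg_nonneg)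
qed

lemma right_\<rho>_r:
  assumes "0 \<le> (c::real)" "c < m" "m < 1"
  shows "0 \<le> (c * (1 - m)) / (m * (1 - c))" "(c * (1 - m)) / (m * (1 - c)) < 1"
proof -
  show "0 \<le> (c * (1 - m)) / (m * (1 - c))" using assms by (intro divide_nonneg_nonneg mult_nonneg_nonneg) auto
  have "0 < m * (1 - c)" using assms by (intro mult_pos_pos) auto
  moreover have "c * (1 - m) < m * (1 - c)" using assms by (simp add: algebra_simps)
  ultimately show "(c * (1 - m)) / (m * (1 - c)) < 1" by simp
qed

lemma right_odds:
  assumes "g < v" "0 < v" "g < (1::real)"
  shows "(g * (1 - v) / (v * (1 - g))) / (1 - g * (1 - v) / (v * (1 - g))) = g * (1 - v) / (v - g)"
    and "g * (1 - v) = g * (1 - v) / (v * (1 - g)) * v * (1 - g)"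
proof -
  have v: "v * (1 - g) \<noteq> 0" using assms by auto
  have "1 - g * (1 - v) / (v * (1 - g)) = (v - g) / (v * (1 - g))" using v by (simp add: divide_simps) (simp add: algebra_simps)
  then show "(g * (1 - v) / (v * (1 - g))) / (1 - g * (1 - v) / (v * (1 - g))) = g * (1 - v) / (v - g)"
    using v by simp
  show "g * (1 - v) = g * (1 - v) / (v * (1 - g)) * v * (1 - g)" using v by simp
qed

text \<open>Index 1 takes \<open>u + s\<close>, raising the Bernoulli parameter; index 2 takes
  \<open>u - s\<close>, raising the geometric ones. By \<open>right_mean_diff\<close> the mean
  changes by \<open>s\<close> times the difference between \<open>x\<close> and \<open>y\<close>
  times a slope, so at a critical \<open>u\<close> both gap conditions reduce to continuity of the
  slope.\<close>

lemma right_lower: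
  assumes c: "0 \<le> c" "c < u" "u < 1" and xy: "0 < x" "0 < y" and crit: "x = y * right_slope \<mu> c u u"
  shows "liminf_ge id x y (u * x + y * right_mean \<mu> c u)"
proof (rule liminf_geI[OF xy, where \<kappa> = "2 + right_mean \<mu> c u"])
  interpret \<mu>: prob_space \<mu> by (rule prob_space_law)
  let ?R = "right_slope \<mu> c u"
  show "0 < 2 + right_mean \<mu> c u" using right_mean_integrable(2)[of c u] c by auto
  fix \<delta> :: real assume \<delta>: "0 < \<delta>" "\<delta> \<le> x" "\<delta> \<le> y"
  have R: "0 < ?R u" using crit xy by (auto simp: zero_less_mult_iff)
  define m where "m = (u + c) / 2"
  have m: "c < m" "m < u" using c by (auto simp: m_def)
  define K where "K = 1 / (m - c) ^ 3"
  have K: "0 \<le> K" using m by (simp add: K_def)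
  \<comment> \<open>Keeps \<open>u - s\<close> above the midpoint \<open>m\<close> and
    \<open>u + s\<close> below 1, and makes the change of the slope, times \<open>y\<close>, smaller
    than both \<delta> and \<delta> times the slope at \<open>u\<close>.\<close>
  obtain s where s: "0 < s" "s < min (u - m) (1 - u)" "y * K * s < min \<delta> (\<delta> * ?R u)"
    using exists_small[of "min (u - m) (1 - u)" "min \<delta> (\<delta> * ?R u)" "y * K"] m c \<delta> R K xy by auto
  define v where "v i = (if i = 1 then u + s else if i = 2 then u - s else u)" for i :: nat
  have v: "m < v i" "v i < 1" for i using s m c by (auto simp: v_def)
  have lip: "\<bar>?R (v i) - ?R u\<bar> * y < min \<delta> (\<delta> * ?R u)" for i
  proof -
    have "\<bar>?R (v i) - ?R u\<bar> \<le> K * \<bar>v i - u\<bar>" unfolding K_def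
      using right_slope_lipschitz[of c m "v i" u u] v[of i] m c by auto
    also have "\<dots> \<le> K * s" using s K by (intro mult_left_mono) (auto simp: v_def)
    finally have "\<bar>?R (v i) - ?R u\<bar> * y \<le> K * s * y" using xy by (intro mult_right_mono) auto
    then show ?thesis using s by (simp add: mult_ac)
  qed
  have diff: "right_mean \<mu> c (v i) - right_mean \<mu> c u = (u - v i) * ?R (v i)" for i
    using v[of i] m c by (intro right_mean_diff) auto
  let ?\<rho> = "\<lambda>i t. cap c t * (1 - v i) / (v i * (1 - cap c t))"
  let ?r = "(c * (1 - m)) / (m * (1 - c))"
  have \<beta>: "(\<integral>t. ?\<rho> i t / (1 - ?\<rho> i t) \<partial>\<mu>) = right_mean \<mu> c (v i)" for i
  proof -
    have "?\<rho> i t / (1 - ?\<rho> i t) = cap c t * (1 - v i) / (v i - cap c t)" for t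
      using v[of i] m c by (intro right_odds) (auto simp: cap_def)
    then show ?thesis unfolding right_mean_def by (simp only:)
  qed
  have \<alpha>: "(\<integral>t. v i \<partial>\<mu>) = v i" for i by (simp add: \<mu>.prob_space)
  have "\<exists>C m0. \<forall>n\<ge>m0. prob {\<omega> \<in> space M.
    real (lpp0 (\<lambda>z. X01 (id z) \<omega>) (nat \<lfloor>real n * x\<rfloor>) (Suc (nat \<lfloor>real n * y\<rfloor>)))
      \<le> (x * (\<integral>t. v 0 \<partial>\<mu>) + y * (\<integral>t. ?\<rho> 0 t / (1 - ?\<rho> 0 t) \<partial>\<mu>)
          - \<delta> * (2 + (\<integral>t. ?\<rho> 0 t / (1 - ?\<rho> 0 t) \<partial>\<mu>))) * real n} \<le> C / real n"
  proof (rule prob_lpp0_lower[where qf = "\<lambda>i _. v i" and \<rho>f = ?\<rho> and g = "cap c" and r = ?r])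
    show "0 \<le> ?r" "?r < 1" using right_\<rho>_r[of c m] c m by auto
    show "0 \<le> v i \<and> v i \<le> 1 \<and> 0 \<le> ?\<rho> i t \<and> ?\<rho> i t \<le> ?r" if "0 \<le> t" "t \<le> 1" for i t
      using right_\<rho>_bound[of "cap c t" c m "v i"] cap_bounds[OF that(1) c(1)] v[of i] m c by auto
    show "0 \<le> cap c t \<and> cap c t \<le> t" if "0 \<le> t" "t \<le> 1" for t using cap_bounds[OF that(1) c(1)] by auto
    show "cap c (p (snd (id (s, t))) \<omega>) * (1 - v i) = ?\<rho> i (p t \<omega>) * v i * (1 - cap c (p (snd (id (s, t))) \<omega>))"
      for \<omega> i s t
      using right_odds(2)[of "cap c (p t \<omega>)" "v i"] v[of i] m c by (auto simp: cap_def)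
    show "v 0 \<le> v 1" using s by (simp add: v_def)
    show "?\<rho> 0 t \<le> ?\<rho> 2 t" if "0 \<le> t" "t \<le> 1" for t
      using right_\<rho>_bound[of "cap c t" "cap c t" "v 2" "v 0"] cap_bounds[OF that(1) c(1)] v[of 0] v[of 2] m c s
      by (auto simp: v_def)
    have "(x - y * ?R (v 1)) * s < \<delta> * s"
    proof (rule mult_strict_right_mono)
      have "y * (?R u - ?R (v 1)) \<le> \<bar>?R (v 1) - ?R u\<bar> * y" using xy by (simp add: mult.commute)
      then show "x - y * ?R (v 1) < \<delta>" using lip[of 1] crit by (simp add: algebra_simps)
    qed (use s in auto)
    moreover have "right_mean \<mu> c (v 1) = right_mean \<mu> c (v 0) - s * ?R (v 1)" using diff[of 1] by (simp add: v_def)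
    then have "y * right_mean \<mu> c (v 1) = y * (right_mean \<mu> c (v 0) - s * ?R (v 1))" by (simp only:)
    ultimately show "x * (\<integral>t. v 1 \<partial>\<mu>) + y * (\<integral>t. ?\<rho> 1 t / (1 - ?\<rho> 1 t) \<partial>\<mu>) -
      (x * (\<integral>t. v 0 \<partial>\<mu>) + y * (\<integral>t. ?\<rho> 0 t / (1 - ?\<rho> 0 t) \<partial>\<mu>)) < \<delta> * ((\<integral>t. v 1 \<partial>\<mu>) - (\<integral>t. v 0 \<partial>\<mu>))"
      unfolding \<alpha> \<beta> by (simp add: v_def algebra_simps)
    have "(y * ?R (v 2) - x) * s < \<delta> * ?R (v 2) * s"
    proof (rule mult_strict_right_mono)
      have "y * (?R (v 2) - ?R u) \<le> \<bar>?R (v 2) - ?R u\<bar> * y" using xy by (simp add: mult.commute)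
      \<comment> \<open>The geometric gain is measured with the slope at \<open>v 2\<close>, which
        is at least the one at \<open>u\<close> since the parameter moved towards the cap.\<close>
      moreover have "\<delta> * ?R u \<le> \<delta> * ?R (v 2)"
        using \<delta> right_slope_mono[of c "v 2" u u] v[of 2] m c s by (intro mult_left_mono) (auto simp: v_def)
      ultimately show "y * ?R (v 2) - x < \<delta> * ?R (v 2)" using lip[of 2] crit by (simp add: algebra_simps)
    qed (use s in auto)
    moreover have "right_mean \<mu> c (v 2) = right_mean \<mu> c (v 0) + s * ?R (v 2)" using diff[of 2] by (simp add: v_def)
    then have "y * right_mean \<mu> c (v 2) = y * (right_mean \<mu> c (v 0) + s * ?R (v 2))"
      "\<delta> * right_mean \<mu> c (v 2) = \<delta> * (right_mean \<mu> c (v 0) + s * ?R (v 2))" by (simp_all only:)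
    ultimately show "x * (\<integral>t. v 2 \<partial>\<mu>) + y * (\<integral>t. ?\<rho> 2 t / (1 - ?\<rho> 2 t) \<partial>\<mu>) -
      (x * (\<integral>t. v 0 \<partial>\<mu>) + y * (\<integral>t. ?\<rho> 0 t / (1 - ?\<rho> 0 t) \<partial>\<mu>)) <
      \<delta> * ((\<integral>t. ?\<rho> 2 t / (1 - ?\<rho> 2 t) \<partial>\<mu>) - (\<integral>t. ?\<rho> 0 t / (1 - ?\<rho> 0 t) \<partial>\<mu>))"
      unfolding \<alpha> \<beta> by (simp add: v_def algebra_simps)
  qed (use \<delta> in auto)
  then show "\<exists>C m0. \<forall>n\<ge>m0. prob {\<omega> \<in> space M. passage id x y n \<omega> \<le>
      (u * x + y * right_mean \<mu> c u - \<delta> * (2 + right_mean \<mu> c u)) * real n} \<le> C / real n"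
    unfolding \<alpha> \<beta> passage_def by (simp add: v_def mult.commute)
qed

text \<open>Each \<open>u\<close> above \<open>b\<close> gives a bound, critical or not. The cap at
  \<open>b\<close> is inactive almost surely and serves to keep \<rho> in range for every t in the
  unit interval.\<close>

lemma right_upper:
  assumes b: "0 \<le> b" "b < u" "u < 1" "AE t in \<mu>. t \<le> b" and xy: "0 \<le> x" "0 \<le> y"
  shows "limsup_le id x y (u * x + y * right_mean \<mu> b u)"
proof (rule limsup_leI[OF xy])
  interpret \<mu>: prob_space \<mu> by (rule prob_space_law)
  show "0 \<le> u * x + y * right_mean \<mu> b u" using right_mean_integrable(2)[of b u] b xy by auto
  fix \<epsilon> :: real assume \<epsilon>: "0 < \<epsilon>"
  let ?\<rho> = "\<lambda>t. cap b t * (1 - u) / (u * (1 - cap b t))"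
  let ?r = "(b * (1 - u)) / (u * (1 - b))"
  have \<beta>: "(\<integral>t. ?\<rho> t / (1 - ?\<rho> t) \<partial>\<mu>) = right_mean \<mu> b u"
  proof -
    have "?\<rho> t / (1 - ?\<rho> t) = cap b t * (1 - u) / (u - cap b t)" for t
      using b by (intro right_odds) (auto simp: cap_def)
    then show ?thesis unfolding right_mean_def by (simp only:)
  qed
  have \<alpha>: "(\<integral>t. u \<partial>\<mu>) = u" by (simp add: \<mu>.prob_space)
  have AEp: "AE \<omega> in M. \<forall>j. p j \<omega> \<le> b"
    unfolding AE_all_countable
  proof
    show "AE \<omega> in M. p j \<omega> \<le> b" for j
      by (rule iffD1[OF AE_law_iff b(4)]) measurable
  qed
  have "\<exists>C m0. \<forall>n\<ge>m0. prob {\<omega> \<in> space M. (x * (\<integral>t. u \<partial>\<mu>) + y * (\<integral>t. ?\<rho> t / (1 - ?\<rho> t) \<partial>\<mu>) + \<epsilon>) * real n \<le>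
    real (lpp0 (\<lambda>z. X01 (id z) \<omega>) (nat \<lfloor>real n * x\<rfloor>) (Suc (nat \<lfloor>real n * y\<rfloor>)))} \<le> C / real n"
  proof (rule prob_lpp0_upper[where qf = "\<lambda>_. u" and \<rho>f = ?\<rho> and r = ?r])
    show "0 \<le> ?r" "?r < 1" using right_\<rho>_r[of b u] b by auto
    show "0 \<le> u \<and> u \<le> 1 \<and> 0 \<le> ?\<rho> t \<and> ?\<rho> t \<le> ?r" if "0 \<le> t" "t \<le> 1" for t
      using right_\<rho>_bound[of "cap b t" b u u] cap_bounds[OF that(1) b(1)] b by auto
    show "AE \<omega> in M. \<forall>s t. p (snd (id (s, t))) \<omega> * (1 - u) = ?\<rho> (p t \<omega>) * u * (1 - p (snd (id (s, t))) \<omega>)"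
      using AEp
    proof eventually_elim
      case (elim \<omega>)
      then have "cap b (p t \<omega>) = p t \<omega>" for t by (auto simp: cap_def)
      moreover have "p t \<omega> < u" for t using elim b by (auto intro: le_less_trans)
      moreover have "p t \<omega> < 1" for t using elim b by (meson le_less_trans less_trans)
      ultimately show ?case using right_odds(2)[of "p t \<omega>" u for t] b by auto
    qed
  qed (use xy \<epsilon> in auto)
  then show "\<exists>C m0. \<forall>n\<ge>m0. prob {\<omega> \<in> space M. (u * x + y * right_mean \<mu> b u + \<epsilon>) * real n \<le> passage id x y n \<omega>} \<le> C / real n"
    unfolding \<alpha> \<beta> passage_def by (simp add: mult.commute)
qed


section \<open>Upward boundaries: constant geometric parameter\<close>

lemma up_slope_integrable:
  assumes "0 < z" "0 < v"
  shows "integrable \<mu> (\<lambda>t. t * (1 - t) / ((t + z) * (t + v)))" "0 \<le> up_slope \<mu> z v" "up_slope \<mu> z v \<le> 1 / (z * v)"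
proof -
  have "0 \<le> t * (1 - t) / ((t + z) * (t + v)) \<and> t * (1 - t) / ((t + z) * (t + v)) \<le> 1 / (z * v)"
    if t: "0 \<le> t" "t \<le> 1" for t
  proof -
    have "t * (1 - t) \<le> 1 * 1" using t by (intro mult_mono) auto
    moreover have "z * v \<le> (t + z) * (t + v)" using t assms by (intro mult_mono) auto
    moreover have "0 < z * v" using assms by simp
    ultimately show ?thesis using t assms by (auto intro!: frac_le)
  qed
  note b = integral_law_bounds[OF _ this, simplified]
  show "integrable \<mu> (\<lambda>t. t * (1 - t) / ((t + z) * (t + v)))" "0 \<le> up_slope \<mu> z v" "up_slope \<mu> z v \<le> 1 / (z * v)"
    unfolding up_slope_def by (rule b; measurable)+
qed

lemma up_fraction_bounds:
  assumes "0 \<le> (t::real)" "t \<le> 1" "0 < z"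
  shows "0 \<le> t * (1 + z) / (t + z) \<and> t * (1 + z) / (t + z) \<le> 1"
proof -
  have "t * z \<le> 1 * z" using assms by (intro mult_right_mono) auto
  then have "t * (1 + z) \<le> t + z" by (simp add: algebra_simps)
  then show ?thesis using assms by (simp add: divide_le_eq_1)
qed

lemma up_mean_integrable:
  assumes "0 < z"
  shows "integrable \<mu> (\<lambda>t. t * (1 + z) / (t + z))" "0 \<le> up_mean \<mu> z"
proof -
  note b = integral_law_bounds[OF _ up_fraction_bounds[OF _ _ assms], simplified]
  show "integrable \<mu> (\<lambda>t. t * (1 + z) / (t + z))" "0 \<le> up_mean \<mu> z"
    unfolding up_mean_def by (rule b; measurable)+
qed

lemma integral_law_cong:
  assumes "f \<in> borel_measurable borel" "g \<in> borel_measurable borel"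
    and "\<And>t. 0 \<le> t \<Longrightarrow> t \<le> 1 \<Longrightarrow> f t = g t"
  shows "(\<integral>t. f t \<partial>\<mu>) = (\<integral>t. (g t :: real) \<partial>\<mu>)"
proof (rule integral_cong_AE)
  show "f \<in> borel_measurable \<mu>" "g \<in> borel_measurable \<mu>"
    using assms by (simp_all add: measurable_cong_sets[OF sets_law refl])
  show "AE t in \<mu>. f t = g t" using AE_law_unit by eventually_elim (use assms(3) in auto)
qed

lemma up_mean_diff:
  assumes "0 < z" "0 < v"
  shows "up_mean \<mu> v - up_mean \<mu> z = (z - v) * up_slope \<mu> z v"
proof -
  have "up_mean \<mu> v - up_mean \<mu> z = (\<integral>t. t * (1 + v) / (t + v) - t * (1 + z) / (t + z) \<partial>\<mu>)"
    unfolding up_mean_def using assms by (intro Bochner_Integration.integral_diff[symmetric] up_mean_integrable) auto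
  also have "\<dots> = (\<integral>t. (z - v) * (t * (1 - t) / ((t + z) * (t + v))) \<partial>\<mu>)"
  proof (rule integral_law_cong)
    fix t :: real assume "0 \<le> t" "t \<le> 1"
    then have "t + z \<noteq> 0" "t + v \<noteq> 0" using assms by auto
    then show "t * (1 + v) / (t + v) - t * (1 + z) / (t + z) = (z - v) * (t * (1 - t) / ((t + z) * (t + v)))"
      by (simp add: divide_simps) (simp add: algebra_simps)
  qed measurable
  also have "\<dots> = (z - v) * up_slope \<mu> z v"
    unfolding up_slope_def by (rule integral_mult_right_zero)
  finally show ?thesis .
qed

lemma up_slope_lipschitz:
  assumes "0 < m" "m \<le> u" "m \<le> v" "m \<le> w"
  shows "\<bar>up_slope \<mu> w u - up_slope \<mu> w v\<bar> \<le> 1 / m ^ 3 * \<bar>u - v\<bar>"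
  unfolding up_slope_def
proof (rule integral_law_lipschitz)
  fix t :: real assume t: "0 \<le> t" "t \<le> 1"
  have pos: "0 < t + w" "0 < t + u" "0 < t + v" using t assms by auto
  have eq: "t * (1 - t) / ((t + w) * (t + u)) - t * (1 - t) / ((t + w) * (t + v))
     = t * (1 - t) / ((t + w) * (t + u) * (t + v)) * (v - u)"
    using pos by (simp add: divide_simps) (simp add: algebra_simps)
  have "t * (1 - t) \<le> 1 * 1" using t by (intro mult_mono) auto
  moreover have "0 \<le> t * (1 - t)" using t by simp
  moreover have "m ^ 3 \<le> (t + w) * (t + u) * (t + v)"
    unfolding power3_eq_cube using t assms pos by (intro mult_mono) auto
  ultimately have "t * (1 - t) / ((t + w) * (t + u) * (t + v)) \<le> 1 / m ^ 3"
    using assms by (intro frac_le) auto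
  moreover have nonneg: "0 \<le> t * (1 - t) / ((t + w) * (t + u) * (t + v))" using pos \<open>0 \<le> t * (1 - t)\<close> by auto
  ultimately show "\<bar>t * (1 - t) / ((t + w) * (t + u)) - t * (1 - t) / ((t + w) * (t + v))\<bar> \<le> 1 / m ^ 3 * \<bar>u - v\<bar>"
    unfolding eq abs_mult abs_of_nonneg[OF nonneg] abs_minus_commute[of v u] by (intro mult_right_mono) auto
qed (use assms in \<open>auto intro!: up_slope_integrable\<close>)

lemma up_slope_mono:
  assumes "0 < u" "u \<le> v" "0 < w"
  shows "up_slope \<mu> w v \<le> up_slope \<mu> w u"
  unfolding up_slope_def
proof (rule integral_mono_AE)
  show "AE t in \<mu>. t * (1 - t) / ((t + w) * (t + v)) \<le> t * (1 - t) / ((t + w) * (t + u))"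
    using AE_law_unit
  proof eventually_elim
    case (elim t)
    then show ?case using assms by (intro divide_left_mono mult_left_mono mult_pos_pos mult_nonneg_nonneg) auto
  qed
qed (use assms in \<open>auto intro!: up_slope_integrable\<close>)

lemma up_odds:
  assumes "0 < (v::real)"
  shows "v / (1 + v) / (1 - v / (1 + v)) = v" and "0 \<le> v / (1 + v)"
    and "0 \<le> t \<Longrightarrow> t * (1 - t * (1 + v) / (t + v)) = v / (1 + v) * (t * (1 + v) / (t + v)) * (1 - t)"
proof -
  have "1 - v / (1 + v) = 1 / (1 + v)" using assms by (simp add: field_simps)
  then show "v / (1 + v) / (1 - v / (1 + v)) = v" using assms by simp
  show "0 \<le> v / (1 + v)" using assms by simp
  show "t * (1 - t * (1 + v) / (t + v)) = v / (1 + v) * (t * (1 + v) / (t + v)) * (1 - t)" if "0 \<le> t"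
  proof -
    have "t + v \<noteq> 0" "1 + v \<noteq> 0" using that assms by auto
    then show ?thesis by (simp add: divide_simps) (simp add: algebra_simps)
  qed
qed

text \<open>The transposed form of \<open>right_lower\<close>. The Bernoulli parameters decrease in
  \<open>z\<close> and the geometric one increases, so index 1 takes \<open>z - s\<close> and index
  2 takes \<open>z + s\<close>. Positivity of \<open>z\<close> keeps t + z away from 0, so the
  probabilities enter uncapped.\<close>

lemma up_lower:
  assumes z: "0 < z" and xy: "0 < x" "0 < y" and crit: "x = y * up_slope \<mu> z z"
  shows "liminf_ge prod.swap y x (z * x + y * up_mean \<mu> z)"
proof (rule liminf_geI[OF xy(2,1), where \<kappa> = "2 + z"])
  interpret \<mu>: prob_space \<mu> by (rule prob_space_law)
  let ?R = "up_slope \<mu> z"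
  show "0 < 2 + z" using z by simp
  fix \<delta> :: real assume \<delta>: "0 < \<delta>" "\<delta> \<le> y" "\<delta> \<le> x"
  have R: "0 < ?R z" using crit xy by (auto simp: zero_less_mult_iff)
  define m where "m = z / 2"
  have m: "0 < m" "m < z" using z by (auto simp: m_def)
  define K where "K = 1 / m ^ 3"
  have K: "0 \<le> K" using m by (simp add: K_def)
  obtain s where s: "0 < s" "s < min (z - m) 1" "y * K * s < min \<delta> (\<delta> * ?R z)"
    using exists_small[of "min (z - m) 1" "min \<delta> (\<delta> * ?R z)" "y * K"] m \<delta> R K xy by auto
  define v where "v i = (if i = 1 then z - s else if i = 2 then z + s else z)" for i :: nat
  have v: "m < v i" "v i < z + 1" "0 < v i" for i using s m by (auto simp: v_def)
  have lip: "\<bar>?R (v i) - ?R z\<bar> * y < min \<delta> (\<delta> * ?R z)" for i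
  proof -
    have "\<bar>?R (v i) - ?R z\<bar> \<le> K * \<bar>v i - z\<bar>" unfolding K_def
      using up_slope_lipschitz[of m "v i" z z] v[of i] m by auto
    also have "\<dots> \<le> K * s" using s K by (intro mult_left_mono) (auto simp: v_def)
    finally have "\<bar>?R (v i) - ?R z\<bar> * y \<le> K * s * y" using xy by (intro mult_right_mono) auto
    then show ?thesis using s by (simp add: mult_ac)
  qed
  have diff: "up_mean \<mu> (v i) - up_mean \<mu> z = (z - v i) * ?R (v i)" for i
    using v[of i] m by (intro up_mean_diff) auto
  let ?q = "\<lambda>i t. t * (1 + v i) / (t + v i)"
  \<comment> \<open>Since \<open>s < 1\<close>, every \<open>v i\<close> is below
    \<open>z + 1\<close>, which gives this common bound.\<close>
  let ?r = "(z + 1) / (1 + (z + 1))"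
  have \<beta>: "(\<integral>t. v i / (1 + v i) / (1 - v i / (1 + v i)) \<partial>\<mu>) = v i" for i
    by (simp only: up_odds(1)[OF v(3)]) (simp add: \<mu>.prob_space)
  have \<alpha>: "(\<integral>t. ?q i t \<partial>\<mu>) = up_mean \<mu> (v i)" for i by (simp add: up_mean_def)
  have "\<exists>C m0. \<forall>n\<ge>m0. prob {\<omega> \<in> space M.
    real (lpp0 (\<lambda>z. X01 (prod.swap z) \<omega>) (nat \<lfloor>real n * y\<rfloor>) (Suc (nat \<lfloor>real n * x\<rfloor>)))
      \<le> (y * (\<integral>t. ?q 0 t \<partial>\<mu>) + x * (\<integral>t. v 0 / (1 + v 0) / (1 - v 0 / (1 + v 0)) \<partial>\<mu>)
          - \<delta> * (2 + (\<integral>t. v 0 / (1 + v 0) / (1 - v 0 / (1 + v 0)) \<partial>\<mu>))) * real n} \<le> C / real n"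
  proof (rule prob_lpp0_lower[where qf = ?q and \<rho>f = "\<lambda>i _. v i / (1 + v i)" and g = id and r = ?r])
    show "inj prod.swap" by simp
    show "0 \<le> ?r" "?r < 1" using z by auto
    show "0 \<le> ?q i t \<and> ?q i t \<le> 1 \<and> 0 \<le> v i / (1 + v i) \<and> v i / (1 + v i) \<le> ?r" if "0 \<le> t" "t \<le> 1" for i t
      using up_fraction_bounds[OF that v(3), of i] up_odds(2)[OF v(3), of i] v[of i] z by (auto simp: field_simps)
    show "id (p (snd (prod.swap (s, t))) \<omega>) * (1 - ?q i (p s \<omega>)) =
        v i / (1 + v i) * ?q i (p s \<omega>) * (1 - id (p (snd (prod.swap (s, t))) \<omega>))"
      if "\<omega> \<in> space M" for \<omega> i s t
      using up_odds(3)[OF v(3), of "p s \<omega>" i] p_range[OF that, of s] by simp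
    show "?q 0 t \<le> ?q 1 t" if t: "0 \<le> t" "t \<le> 1" for t
    proof -
      \<comment> \<open>Cross-multiplying the two Bernoulli parameters leaves exactly this product
        as their difference.\<close>
      have "t * (1 - t) * (v 0 - v 1) \<ge> 0" using t s by (simp add: v_def)
      then have "t * (1 + v 0) * (t + v 1) \<le> t * (1 + v 1) * (t + v 0)" by (simp add: algebra_simps)
      then show ?thesis using v(3)[of 0] v(3)[of 1] t by (simp add: frac_le_eq divide_simps)
    qed
    show "v 0 / (1 + v 0) \<le> v 2 / (1 + v 2)" if "0 \<le> t" "t \<le> 1" for t :: real
      using s z by (simp add: v_def field_simps)
    have "(y * ?R (v 1) - x) * s < \<delta> * ?R (v 1) * s"
    proof (rule mult_strict_right_mono)
      have "y * (?R (v 1) - ?R z) \<le> \<bar>?R (v 1) - ?R z\<bar> * y" using xy by (simp add: mult.commute)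
      moreover have "\<delta> * ?R z \<le> \<delta> * ?R (v 1)"
        using \<delta> up_slope_mono[of "v 1" z z] v[of 1] m s by (intro mult_left_mono) (auto simp: v_def)
      ultimately show "y * ?R (v 1) - x < \<delta> * ?R (v 1)" using lip[of 1] crit by (simp add: algebra_simps)
    qed (use s in auto)
    moreover have "up_mean \<mu> (v 1) = up_mean \<mu> (v 0) + s * ?R (v 1)" using diff[of 1] by (simp add: v_def)
    then have "y * up_mean \<mu> (v 1) = y * (up_mean \<mu> (v 0) + s * ?R (v 1))"
      "\<delta> * up_mean \<mu> (v 1) = \<delta> * (up_mean \<mu> (v 0) + s * ?R (v 1))" by (simp_all only:)
    ultimately show "y * (\<integral>t. ?q 1 t \<partial>\<mu>) + x * (\<integral>t. v 1 / (1 + v 1) / (1 - v 1 / (1 + v 1)) \<partial>\<mu>) -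
      (y * (\<integral>t. ?q 0 t \<partial>\<mu>) + x * (\<integral>t. v 0 / (1 + v 0) / (1 - v 0 / (1 + v 0)) \<partial>\<mu>))
      < \<delta> * ((\<integral>t. ?q 1 t \<partial>\<mu>) - (\<integral>t. ?q 0 t \<partial>\<mu>))"
      unfolding \<alpha> \<beta> by (simp add: v_def algebra_simps)
    have "(x - y * ?R (v 2)) * s < \<delta> * s"
    proof (rule mult_strict_right_mono)
      have "y * (?R z - ?R (v 2)) \<le> \<bar>?R (v 2) - ?R z\<bar> * y" using xy by (simp add: mult.commute)
      then show "x - y * ?R (v 2) < \<delta>" using lip[of 2] crit by (simp add: algebra_simps)
    qed (use s in auto)
    moreover have "up_mean \<mu> (v 2) = up_mean \<mu> (v 0) - s * ?R (v 2)" using diff[of 2] by (simp add: v_def)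
    then have "y * up_mean \<mu> (v 2) = y * (up_mean \<mu> (v 0) - s * ?R (v 2))" by (simp only:)
    ultimately show "y * (\<integral>t. ?q 2 t \<partial>\<mu>) + x * (\<integral>t. v 2 / (1 + v 2) / (1 - v 2 / (1 + v 2)) \<partial>\<mu>) -
      (y * (\<integral>t. ?q 0 t \<partial>\<mu>) + x * (\<integral>t. v 0 / (1 + v 0) / (1 - v 0 / (1 + v 0)) \<partial>\<mu>))
      < \<delta> * ((\<integral>t. v 2 / (1 + v 2) / (1 - v 2 / (1 + v 2)) \<partial>\<mu>) - (\<integral>t. v 0 / (1 + v 0) / (1 - v 0 / (1 + v 0)) \<partial>\<mu>))"
      unfolding \<alpha> \<beta> by (simp add: v_def algebra_simps)
  qed (use \<delta> in auto)
  then show "\<exists>C m0. \<forall>n\<ge>m0. prob {\<omega> \<in> space M. passage prod.swap y x n \<omega> \<le>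
      (z * x + y * up_mean \<mu> z - \<delta> * (2 + z)) * real n} \<le> C / real n"
    unfolding \<alpha> \<beta> passage_def by (simp add: v_def mult.commute add.commute)
qed

lemma up_upper:
  assumes z: "0 < z" and xy: "0 \<le> x" "0 \<le> y"
  shows "limsup_le prod.swap y x (z * x + y * up_mean \<mu> z)"
proof (rule limsup_leI[OF xy(2,1)])
  interpret \<mu>: prob_space \<mu> by (rule prob_space_law)
  show "0 \<le> z * x + y * up_mean \<mu> z" using up_mean_integrable(2)[OF z] z xy by auto
  fix \<epsilon> :: real assume \<epsilon>: "0 < \<epsilon>"
  have \<beta>: "(\<integral>t. z / (1 + z) / (1 - z / (1 + z)) \<partial>\<mu>) = z"
    by (simp only: up_odds(1)[OF z]) (simp add: \<mu>.prob_space)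
  have "\<exists>C m0. \<forall>n\<ge>m0. prob {\<omega> \<in> space M. (y * (\<integral>t. t * (1 + z) / (t + z) \<partial>\<mu>) +
      x * (\<integral>t. z / (1 + z) / (1 - z / (1 + z)) \<partial>\<mu>) + \<epsilon>) * real n \<le>
    real (lpp0 (\<lambda>z. X01 (prod.swap z) \<omega>) (nat \<lfloor>real n * y\<rfloor>) (Suc (nat \<lfloor>real n * x\<rfloor>)))} \<le> C / real n"
  proof (rule prob_lpp0_upper[where qf = "\<lambda>t. t * (1 + z) / (t + z)" and \<rho>f = "\<lambda>_. z / (1 + z)" and r = "z / (1 + z)"])
    show "inj prod.swap" by simp
    show "0 \<le> z / (1 + z)" "z / (1 + z) < 1" using z by auto
    show "0 \<le> t * (1 + z) / (t + z) \<and> t * (1 + z) / (t + z) \<le> 1 \<and> 0 \<le> z / (1 + z) \<and> z / (1 + z) \<le> z / (1 + z)"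
      if "0 \<le> t" "t \<le> 1" for t
      using up_fraction_bounds[OF that z] z by auto
    show "AE \<omega> in M. \<forall>s t. p (snd (prod.swap (s, t))) \<omega> * (1 - p s \<omega> * (1 + z) / (p s \<omega> + z)) =
        z / (1 + z) * (p s \<omega> * (1 + z) / (p s \<omega> + z)) * (1 - p (snd (prod.swap (s, t))) \<omega>)"
    proof (intro AE_I2 allI)
      fix \<omega> s t assume "\<omega> \<in> space M"
      then show "p (snd (prod.swap (s, t))) \<omega> * (1 - p s \<omega> * (1 + z) / (p s \<omega> + z)) =
        z / (1 + z) * (p s \<omega> * (1 + z) / (p s \<omega> + z)) * (1 - p (snd (prod.swap (s, t))) \<omega>)"
        using up_odds(3)[OF z, of "p s \<omega>"] p_range[of \<omega> s] by simp
    qed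
  qed (use xy \<epsilon> in auto)
  then show "\<exists>C m0. \<forall>n\<ge>m0. prob {\<omega> \<in> space M. (z * x + y * up_mean \<mu> z + \<epsilon>) * real n \<le> passage prod.swap y x n \<omega>} \<le> C / real n"
    unfolding \<beta> passage_def up_mean_def by (simp add: mult.commute add.commute)
qed

end

subsection \<open>Solving the critical equation\<close>

text \<open>The contrapositive of Fatou's lemma. It also covers an infinite limit integral, where it
  yields arbitrarily large slopes near the end of the parameter range.\<close>

lemma exists_integral_greater:
  fixes D :: "nat \<Rightarrow> 'a \<Rightarrow> real" and r :: real
  assumes int: "\<And>n. integrable N (D n)" and nonneg: "\<And>n. AE t in N. 0 \<le> D n t"
    and lim: "AE t in N. (\<lambda>n. D n t) \<longlonglongrightarrow> f t" and gt: "ennreal r < (\<integral>\<^sup>+t. ennreal (f t) \<partial>N)" and r: "0 \<le> r"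
  shows "\<exists>n. r < (\<integral>t. D n t \<partial>N)"
proof (rule ccontr)
  assume "\<not> ?thesis"
  then have le: "(\<integral>t. D n t \<partial>N) \<le> r" for n by (simp add: not_less)
  have "(\<integral>\<^sup>+t. ennreal (f t) \<partial>N) = (\<integral>\<^sup>+t. liminf (\<lambda>n. ennreal (D n t)) \<partial>N)"
  proof (rule nn_integral_cong_AE)
    show "AE t in N. ennreal (f t) = liminf (\<lambda>n. ennreal (D n t))"
      using lim
    proof eventually_elim
      case (elim t)
      then have "(\<lambda>n. ennreal (D n t)) \<longlonglongrightarrow> ennreal (f t)" by (rule tendsto_ennrealI)
      then show ?case by (simp add: lim_imp_Liminf)
    qed
  qed
  also have "\<dots> \<le> liminf (\<lambda>n. \<integral>\<^sup>+t. ennreal (D n t) \<partial>N)"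
    using int by (intro nn_integral_liminf) auto
  also have "\<dots> \<le> liminf (\<lambda>n::nat. ennreal r)"
  proof (intro Liminf_mono always_eventually allI)
    fix n
    have "(\<integral>\<^sup>+t. ennreal (D n t) \<partial>N) = ennreal (\<integral>t. D n t \<partial>N)"
      using int nonneg by (rule nn_integral_eq_integral)
    then show "(\<integral>\<^sup>+t. ennreal (D n t) \<partial>N) \<le> ennreal r" using le[of n] by (simp add: ennreal_leI)
  qed
  also have "\<dots> = ennreal r" by (simp add: Liminf_const)
  finally show False using gt by simp
qed

text \<open>The denominators \<open>i + 2\<close> keep approximating sequences strictly inside their
  interval from \<open>i = 0\<close> on.\<close>

lemma divide_step_bounds:
  fixes d :: real
  assumes "0 < d"
  shows "0 < d / real (i + 2)" "d / real (i + 2) < d"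
  using assms divide_strict_left_mono[of 1 "real (i + 2)" d] by auto

section \<open>Monotonicity and range of the rightward slope\<close>

context bernoulli_environment
begin

lemma measurable_law: "f \<in> borel_measurable borel \<Longrightarrow> f \<in> borel_measurable \<mu>"
  by (simp add: measurable_cong_sets[OF sets_law refl])

lemma right_slope_nonneg:
  assumes "0 \<le> c" "c \<le> 1" "c < u" "c < v"
  shows "AE t in \<mu>. 0 \<le> cap c t * (1 - cap c t) / ((u - cap c t) * (v - cap c t))"
    and "0 \<le> right_slope \<mu> c u v"
proof -
  show "AE t in \<mu>. 0 \<le> cap c t * (1 - cap c t) / ((u - cap c t) * (v - cap c t))"
    using AE_law_unit
  proof eventually_elim
    case (elim t)
    then show ?case using cap_bounds[of t c] assms by (intro divide_nonneg_nonneg mult_nonneg_nonneg) auto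
  qed
  then show "0 \<le> right_slope \<mu> c u v" unfolding right_slope_def by (rule integral_nonneg_AE)
qed

lemma right_mean_antimono:
  assumes "0 \<le> c" "c < u" "u \<le> v" "v \<le> 1"
  shows "right_mean \<mu> c v \<le> right_mean \<mu> c u"
proof -
  have "(u - v) * right_slope \<mu> c u v \<le> 0"
    using assms by (intro mult_nonpos_nonneg right_slope_nonneg(2)) auto
  then show ?thesis using right_mean_diff[of c u v] assms by auto
qed

lemma right_slope_commute: "right_slope \<mu> c u v = right_slope \<mu> c v u"
  unfolding right_slope_def by (simp add: mult.commute)

text \<open>Moves the two arguments one at a time, using symmetry; hence twice the one-variable
  Lipschitz constant.\<close>

lemma right_slope_continuous:
  assumes "0 \<le> c" "c \<le> 1" "c < m"
  shows "continuous_on {m..m'} (\<lambda>u. right_slope \<mu> c u u)"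
proof (rule lipschitz_on_continuous_on[where L = "2 / (m - c) ^ 3"], rule lipschitz_onI)
  show "0 \<le> 2 / (m - c) ^ 3" using assms by simp
  fix u v assume uv: "u \<in> {m..m'}" "v \<in> {m..m'}"
  have "\<bar>right_slope \<mu> c u u - right_slope \<mu> c u v\<bar> \<le> 1 / (m - c) ^ 3 * \<bar>u - v\<bar>"
    "\<bar>right_slope \<mu> c v u - right_slope \<mu> c v v\<bar> \<le> 1 / (m - c) ^ 3 * \<bar>u - v\<bar>"
    using right_slope_lipschitz[OF assms, of u v u] right_slope_lipschitz[OF assms, of u v v] uv by auto
  then show "dist (right_slope \<mu> c u u) (right_slope \<mu> c v v) \<le> 2 / (m - c) ^ 3 * dist u v"
    unfolding right_slope_commute[of c v u] by (simp add: dist_real_def)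
qed

lemma right_slope_attains:
  assumes "0 \<le> c" "c \<le> 1" "c < l" "l \<le> h" "right_slope \<mu> c h h \<le> r" "r \<le> right_slope \<mu> c l l"
  shows "\<exists>u. l \<le> u \<and> u \<le> h \<and> right_slope \<mu> c u u = r"
  using IVT2'[OF assms(5,6,4) right_slope_continuous[OF assms(1-3)]] .

text \<open>The capped law has an atom of mass \<open>measure \<mu> {c..}\<close> at
  \<open>c\<close>, which alone contributes the mass times c(1-c)/s^2 at the parameter c +
  s.\<close>

lemma right_slope_large:
  assumes c: "0 < c" "c < 1" and mass: "0 < measure \<mu> {c..}" and v: "c < v" and r: "0 \<le> r"
  shows "\<exists>u. c < u \<and> u < v \<and> r \<le> right_slope \<mu> c u u"
proof -
  interpret \<mu>: prob_space \<mu> by (rule prob_space_law)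
  let ?k = "measure \<mu> {c..} * (c * (1 - c))"
  have k: "0 < ?k" using mass c by (intro mult_pos_pos) auto
  obtain s where s: "0 < s" "s < min (v - c) 1" "r * s < ?k"
    using exists_small[of "min (v - c) 1" ?k r] v k r by auto
  let ?u = "c + s"
  have set: "{c..} \<in> sets \<mu>" by (simp add: sets_law)
  have int: "integrable \<mu> (indicator {c..} :: real \<Rightarrow> real)"
    using set by (intro integrable_real_indicator) (auto simp: \<mu>.emeasure_eq_measure)
  have "r * (s * s) \<le> r * s" using s r by (intro mult_left_mono) (auto simp: mult_le_one)
  then have "r * (s * s) \<le> ?k" using s by linarith
  then have "r \<le> ?k / (s * s)" using s by (simp add: pos_le_divide_eq)
  also have "\<dots> = (\<integral>t. (c * (1 - c) / (s * s)) * indicator {c..} t \<partial>\<mu>)" by (simp add: sets_law)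
  also have "\<dots> \<le> right_slope \<mu> c ?u ?u"
    unfolding right_slope_def
  proof (rule integral_mono_AE)
    show "AE t in \<mu>. (c * (1 - c) / (s * s)) * indicator {c..} t
        \<le> cap c t * (1 - cap c t) / ((?u - cap c t) * (?u - cap c t))"
      using AE_law_unit
    proof eventually_elim
      case (elim t)
      then have "0 \<le> cap c t * (1 - cap c t) / ((?u - cap c t) * (?u - cap c t))"
        using cap_bounds[of t c] c s by (intro divide_nonneg_nonneg mult_nonneg_nonneg) auto
      moreover have "c \<le> t \<Longrightarrow> cap c t = c" by (simp add: cap_def)
      ultimately show ?case by (cases "c \<le> t") (auto simp: indicator_def)
    qed
    show "integrable \<mu> (\<lambda>t. cap c t * (1 - cap c t) / ((?u - cap c t) * (?u - cap c t)))"
      using c s by (intro right_slope_integrable) auto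
  qed (intro integrable_mult_right int)
  finally show ?thesis using s by (intro exI[of _ ?u]) auto
qed

lemma scaled_square_le:
  assumes "0 \<le> (N::real)" "0 < A" "A \<le> B'" "1 + k \<le> B' / A" "0 \<le> k"
  shows "(1 + k)\<^sup>2 * (N / B'\<^sup>2) \<le> N / A\<^sup>2"
proof -
  have "(1 + k)\<^sup>2 \<le> (B' / A)\<^sup>2" using assms by (intro power_mono) auto
  then have "(1 + k)\<^sup>2 * (N / B'\<^sup>2) \<le> (B' / A)\<^sup>2 * (N / B'\<^sup>2)" using assms by (intro mult_right_mono) auto
  also have "\<dots> = N / A\<^sup>2" using assms by (simp add: power_divide)
  finally show ?thesis .
qed

text \<open>Since \<open>u - cap c t\<close> is at most 1, its ratio to \<open>v - cap c t\<close>
  exceeds the factor \<open>1 + (v - u)\<close> uniformly in t when inverted. This factor gives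
  strictness, so no strict comparison of integrands is needed.\<close>

lemma right_slope_strict:
  assumes "0 \<le> c" "c \<le> 1" "c < u" "u < v" "u \<le> 1" "0 < right_slope \<mu> c v v"
  shows "right_slope \<mu> c v v < right_slope \<mu> c u u"
proof -
  let ?f = "\<lambda>u t. cap c t * (1 - cap c t) / ((u - cap c t) * (u - cap c t))"
  have "right_slope \<mu> c v v < (1 + (v - u))\<^sup>2 * right_slope \<mu> c v v"
  proof -
    have "1 < (1 + (v - u))\<^sup>2" using assms by (simp add: one_less_power)
    then show ?thesis using mult_strict_right_mono[of 1 _ "right_slope \<mu> c v v"] assms by simp
  qed
  also have "\<dots> = (\<integral>t. (1 + (v - u))\<^sup>2 * ?f v t \<partial>\<mu>)"
    unfolding right_slope_def by (rule integral_mult_right_zero[symmetric])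
  also have "\<dots> \<le> right_slope \<mu> c u u"
    unfolding right_slope_def
  proof (rule integral_mono_AE)
    show "AE t in \<mu>. (1 + (v - u))\<^sup>2 * ?f v t \<le> ?f u t"
      using AE_law_unit
    proof eventually_elim
      case (elim t)
      note cap = cap_bounds[of t c]
      have pos: "0 < u - cap c t" "u - cap c t \<le> 1" using elim cap assms by auto
      have "(1 + (v - u)) * (u - cap c t) \<le> v - cap c t"
        using mult_right_mono[of "u - cap c t" 1 "v - u"] pos assms by (simp add: algebra_simps)
      then have "1 + (v - u) \<le> (v - cap c t) / (u - cap c t)" using pos by (simp add: pos_le_divide_eq)
      then show ?case
        using scaled_square_le[of "cap c t * (1 - cap c t)" "u - cap c t" "v - cap c t" "v - u"] elim cap assms pos
        by (simp add: power2_eq_square)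
    qed
    have int: "integrable \<mu> (?f w)" if "c < w" for w using that assms by (intro right_slope_integrable) auto
    show "integrable \<mu> (?f u)" "integrable \<mu> (\<lambda>t. (1 + (v - u))\<^sup>2 * ?f v t)"
      using assms by (intro integrable_mult_right int; simp)+
  qed
  finally show ?thesis .
qed

section \<open>The regimes of rightward paths\<close>

lemma right_full:
  assumes c: "0 \<le> c" "c < u" "u < 1" and xy: "0 < x" "0 < y" and large: "x / y \<le> right_slope \<mu> c u u"
  shows "liminf_ge id x y (u * x)"
proof -
  let ?S = "right_slope \<mu> c u u"
  have S: "0 < ?S" using large xy by (meson divide_pos_pos less_le_trans)
  \<comment> \<open>\<open>x / ?S\<close> is the height at which \<open>u\<close> is critical.
    Restoring the height \<open>y\<close> only adds paths, and the nonnegative geometric part of the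
    mean is dropped.\<close>
  have y': "0 < x / ?S" "x / ?S \<le> y" using S xy large by (auto simp: field_simps)
  have "liminf_ge id x (x / ?S) (u * x + x / ?S * right_mean \<mu> c u)"
    using S xy y' by (intro right_lower c) auto
  moreover have "0 \<le> x / ?S * right_mean \<mu> c u"
    using y' right_mean_integrable(2)[of c u] c by (intro mult_nonneg_nonneg) auto
  ultimately show ?thesis using y'(2) by (elim liminf_ge_mono) auto
qed

text \<open>Dominated convergence, as caps are at most t and parameters exceed \<open>b\<close>.
  Caps may vary, which covers both the constant cap of the upper bound and the growing caps of the
  lower bound.\<close>

lemma right_mean_tendsto:
  assumes b: "0 \<le> b" "b \<le> 1" "AE t in \<mu>. t < b" and E: "integrable \<mu> (\<lambda>t. t / (b - t))"
    and c: "\<And>i::nat. 0 \<le> c i" "\<And>i. c i \<le> b" "c \<longlonglongrightarrow> b" and v: "\<And>i. b < v i" "\<And>i. v i \<le> 1" "v \<longlonglongrightarrow> b"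
  shows "(\<lambda>i. right_mean \<mu> (c i) (v i)) \<longlonglongrightarrow> (1 - b) * (\<integral>t. t / (b - t) \<partial>\<mu>)"
proof -
  have "(\<lambda>i. right_mean \<mu> (c i) (v i)) \<longlonglongrightarrow> (\<integral>t. (1 - b) * (t / (b - t)) \<partial>\<mu>)"
    unfolding right_mean_def
  proof (rule integral_dominated_convergence[where w = "\<lambda>t. t / (b - t)"])
    show "(\<lambda>t. (1 - b) * (t / (b - t))) \<in> borel_measurable \<mu>" by (rule measurable_law) measurable
    show "(\<lambda>t. cap (c i) t * (1 - v i) / (v i - cap (c i) t)) \<in> borel_measurable \<mu>" for i
      by (rule measurable_law) measurable
    show "AE t in \<mu>. (\<lambda>i. cap (c i) t * (1 - v i) / (v i - cap (c i) t)) \<longlonglongrightarrow> (1 - b) * (t / (b - t))"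
      using b(3)
    proof eventually_elim
      case (elim t)
      have "eventually (\<lambda>i. t < c i) sequentially" using order_tendstoD(1)[OF c(3) elim] .
      then have ev: "eventually (\<lambda>i. t * (1 - v i) / (v i - t) = cap (c i) t * (1 - v i) / (v i - cap (c i) t)) sequentially"
        by eventually_elim (simp add: cap_def)
      have "(\<lambda>i. t * (1 - v i) / (v i - t)) \<longlonglongrightarrow> t * (1 - b) / (b - t)"
        using elim by (intro tendsto_intros v(3)) auto
      then show ?case using Lim_transform_eventually[OF _ ev] by (simp add: mult_ac)
    qed
    show "AE t in \<mu>. norm (cap (c i) t * (1 - v i) / (v i - cap (c i) t)) \<le> t / (b - t)" for i
      using b(3) AE_law_unit
    proof eventually_elim
      case (elim t)
      note cap = cap_bounds[of t "c i"]
      have "cap (c i) t * (1 - v i) \<le> t * 1"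
        using elim cap c(1)[of i] v(1,2)[of i] b by (intro mult_mono) auto
      moreover have "0 \<le> cap (c i) t * (1 - v i)" using elim cap c(1)[of i] v(2)[of i] by auto
      ultimately show ?case using elim cap c(1)[of i] v(1)[of i]
        by (auto simp: abs_of_nonneg intro!: frac_le)
    qed
  qed (rule E)
  then show ?thesis by (simp only: integral_mult_right_zero)
qed

text \<open>An atom at \<open>b\<close> would contribute the positive number b(1-b) divided by 0,
  which is infinite.\<close>

lemma AE_lt_of_finite_quot:
  assumes b: "0 < b" "b < 1" "AE t in \<mu>. t \<le> b"
    and fin: "quot_expectation \<mu> (\<lambda>t. t * (1 - t)) (\<lambda>t. (b - t)\<^sup>2) < top"
  shows "AE t in \<mu>. t < b"
proof -
  have "AE t in \<mu>. ennreal (t * (1 - t)) / ennreal ((b - t)\<^sup>2) \<noteq> \<infinity>"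
    using fin unfolding quot_expectation_def
    by (intro nn_integral_PInf_AE measurable_law) auto
  then show ?thesis using b(3)
  proof eventually_elim
    case (elim t)
    show ?case
    proof (rule ccontr)
      assume "\<not> t < b"
      then have "t = b" using elim by simp
      moreover have "0 < b * (1 - b)" using b by simp
      ultimately show False using elim by (simp add: ennreal_eq_0_iff not_le)
    qed
  qed
qed

lemma quot_expectation_eq:
  assumes meas: "f \<in> borel_measurable borel" "g \<in> borel_measurable borel" and AE: "AE t in \<mu>. 0 \<le> f t \<and> 0 < g t"
  shows "quot_expectation \<mu> f g = (\<integral>\<^sup>+t. ennreal (f t / g t) \<partial>\<mu>)"
  unfolding quot_expectation_def
  by (rule nn_integral_cong_AE) (use AE in \<open>auto simp: divide_ennreal\<close>)

text \<open>The critical point of the law capped at \<open>c i\<close> is squeezed between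
  \<open>c i\<close> and \<open>v i\<close>: the slope is large near the atom, and at
  \<open>v i\<close> it is at most the expectation in \<open>le\<close>. As
  \<open>right_mean\<close> decreases in its parameter, this localisation gives a lower bound with
  the same limit as the upper one.\<close>

lemma right_case_flat:
  assumes b: "0 < b" "b < 1" "AE t in \<mu>. t \<le> b" and mass: "\<And>c. c < b \<Longrightarrow> 0 < measure \<mu> {c..}"
    and xy: "0 < x" "0 < y"
    and le: "quot_expectation \<mu> (\<lambda>t. t * (1 - t)) (\<lambda>t. (b - t)\<^sup>2) \<le> ennreal (x / y)"
  shows "Psi_right_is M X x y (b * x + y * (1 - b) * (\<integral>t. t / (b - t) \<partial>\<mu>))"
proof -
  have lt: "AE t in \<mu>. t < b" using b le by (intro AE_lt_of_finite_quot) (auto intro: le_less_trans)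
  let ?D = "\<lambda>t. t * (1 - t) / (b - t)\<^sup>2"
  have pos: "AE t in \<mu>. 0 \<le> t * (1 - t) \<and> 0 < (b - t)\<^sup>2"
    using lt AE_law_unit by eventually_elim auto
  have nn: "(\<integral>\<^sup>+t. ennreal (?D t) \<partial>\<mu>) \<le> ennreal (x / y)"
    using le by (subst (asm) quot_expectation_eq[OF _ _ pos]) auto
  have D0: "AE t in \<mu>. 0 \<le> ?D t" using pos by eventually_elim auto
  have D: "integrable \<mu> ?D"
    by (rule integrableI_nonneg) (use D0 nn in \<open>auto intro!: measurable_law intro: le_less_trans\<close>)
  have "ennreal (\<integral>t. ?D t \<partial>\<mu>) \<le> ennreal (x / y)" using nn nn_integral_eq_integral[OF D D0] by simp
  then have D_le: "(\<integral>t. ?D t \<partial>\<mu>) \<le> x / y" using xy by (simp add: ennreal_le_iff)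
  \<comment> \<open>Dominated by \<open>?D\<close>, because b - t is at most 1 - t.\<close>
  have E: "integrable \<mu> (\<lambda>t. t / (b - t))"
  proof (rule Bochner_Integration.integrable_bound[OF D])
    show "AE t in \<mu>. norm (t / (b - t)) \<le> norm (?D t)"
      using lt AE_law_unit
    proof eventually_elim
      case (elim t)
      have "t / (b - t) = t * (b - t) / (b - t)\<^sup>2" using elim by (simp add: power2_eq_square)
      also have "\<dots> \<le> ?D t" using elim b by (intro divide_right_mono mult_left_mono) auto
      finally show ?case using elim by auto
    qed
  qed (rule measurable_law, measurable)
  define c where "c i = b - b / real (i + 2)" for i :: nat
  define v where "v i = b + (1 - b) / real (i + 2)" for i :: nat
  have c: "0 < c i" "c i < b" for i using divide_step_bounds[OF b(1), of i] by (auto simp: c_def)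
  have v: "b < v i" "v i < 1" for i using b divide_step_bounds[of "1 - b" i] by (auto simp: v_def)
  have lim: "c \<longlonglongrightarrow> b" "v \<longlonglongrightarrow> b" unfolding c_def v_def by real_asymp+
  let ?h = "b * x + y * ((1 - b) * (\<integral>t. t / (b - t) \<partial>\<mu>))"
  have "limsup_le id x y ?h"
  proof (rule limsup_le_lim)
    show "limsup_le id x y (v i * x + y * right_mean \<mu> b (v i))" for i
      using b v[of i] xy by (intro right_upper) auto
    show "(\<lambda>i. v i * x + y * right_mean \<mu> b (v i)) \<longlonglongrightarrow> ?h"
      using b v lim less_imp_le[OF v(2)] by (intro tendsto_intros right_mean_tendsto lt E) auto
  qed
  moreover have "liminf_ge id x y ?h"
  proof (rule liminf_ge_lim)
    fix i
    have "right_slope \<mu> (c i) (v i) (v i) \<le> (\<integral>t. ?D t \<partial>\<mu>)"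
      unfolding right_slope_def
    proof (rule integral_mono_AE[OF _ D])
      show "integrable \<mu> (\<lambda>t. cap (c i) t * (1 - cap (c i) t) / ((v i - cap (c i) t) * (v i - cap (c i) t)))"
        using c[of i] v[of i] b by (intro right_slope_integrable) auto
      show "AE t in \<mu>. cap (c i) t * (1 - cap (c i) t) / ((v i - cap (c i) t) * (v i - cap (c i) t)) \<le> ?D t"
        using lt AE_law_unit
      proof eventually_elim
        case (elim t)
        let ?g = "cap (c i) t"
        have g: "0 \<le> ?g" "?g \<le> t" using cap_bounds[of t "c i"] elim c[of i] by auto
        have "?g / (v i - ?g) \<le> t / (b - t)" using g elim v[of i] by (intro frac_le) auto
        \<comment> \<open>Written as 1 + (1-v)/(v-g), the quotient visibly increases in g and
          decreases in v.\<close>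
        moreover have "(1 - ?g) / (v i - ?g) \<le> (1 - t) / (b - t)"
        proof -
          have "(1 - ?g) / (v i - ?g) = 1 + (1 - v i) / (v i - ?g)" using g elim v[of i] by (simp add: field_simps)
          also have "\<dots> \<le> 1 + (1 - b) / (b - t)" using g elim v[of i] b by (intro add_left_mono frac_le) auto
          also have "\<dots> = (1 - t) / (b - t)" using elim by (simp add: field_simps)
          finally show ?thesis .
        qed
        ultimately have "?g / (v i - ?g) * ((1 - ?g) / (v i - ?g)) \<le> t / (b - t) * ((1 - t) / (b - t))"
          using g elim v[of i] b by (intro mult_mono) auto
        then show ?case by (simp add: power2_eq_square)
      qed
    qed
    then have le: "right_slope \<mu> (c i) (v i) (v i) \<le> x / y" using D_le by linarith
    have "\<exists>u. c i < u \<and> u < v i \<and> x / y \<le> right_slope \<mu> (c i) u u"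
      using c[of i] v[of i] b xy mass by (intro right_slope_large) auto
    then obtain l where l: "c i < l" "l < v i" "x / y \<le> right_slope \<mu> (c i) l l" by blast
    obtain u where u: "l \<le> u" "u \<le> v i" "right_slope \<mu> (c i) u u = x / y"
      using right_slope_attains[of "c i" l "v i" "x / y"] l le c[of i] b by auto
    have "liminf_ge id x y (u * x + y * right_mean \<mu> (c i) u)"
      using c[of i] l u v[of i] xy by (intro right_lower) auto
    moreover have "c i * x + y * right_mean \<mu> (c i) (v i) \<le> u * x + y * right_mean \<mu> (c i) u"
      using c[of i] l u v[of i] xy by (intro add_mono mult_right_mono mult_left_mono right_mean_antimono) auto
    ultimately show "liminf_ge id x y (c i * x + y * right_mean \<mu> (c i) (v i))"
      by (rule_tac liminf_ge_mono) auto
  next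
    show "(\<lambda>i. c i * x + y * right_mean \<mu> (c i) (v i)) \<longlonglongrightarrow> ?h"
      using b v c lim less_imp_le[OF v(2)] less_imp_le[OF c(1)] less_imp_le[OF c(2)]
      by (intro tendsto_intros right_mean_tendsto lt E) auto
  qed
  ultimately show ?thesis by (intro Psi_right_isI) (simp_all add: mult.assoc)
qed

lemma right_slope_eq:
  assumes "AE t in \<mu>. t \<le> b"
  shows "right_slope \<mu> b z z = (\<integral>t. t * (1 - t) / (z - t)\<^sup>2 \<partial>\<mu>)"
  unfolding right_slope_def
proof (rule integral_cong_AE)
  show "AE t in \<mu>. cap b t * (1 - cap b t) / ((z - cap b t) * (z - cap b t)) = t * (1 - t) / (z - t)\<^sup>2"
    using assms by eventually_elim (simp add: cap_def power2_eq_square)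
qed (rule measurable_law, measurable)+

text \<open>Pointwise, z^2(1-t)/(z-t)^2 is z times the slope integrand plus the mean integrand plus
  1. So the closed form is the stationary mean at the critical parameter.\<close>

lemma right_value:
  assumes b: "0 \<le> b" "b < z" "z \<le> 1" "AE t in \<mu>. t \<le> b" and crit: "x = y * right_slope \<mu> b z z"
  shows "y * z\<^sup>2 * (\<integral>t. (1 - t) / (z - t)\<^sup>2 \<partial>\<mu>) - y = z * x + y * right_mean \<mu> b z"
proof -
  interpret \<mu>: prob_space \<mu> by (rule prob_space_law)
  let ?S = "\<lambda>t. cap b t * (1 - cap b t) / ((z - cap b t) * (z - cap b t))" and ?E = "\<lambda>t. cap b t * (1 - z) / (z - cap b t)"
  have int: "integrable \<mu> ?S" "integrable \<mu> ?E" using b by (auto intro!: right_slope_integrable right_mean_integrable)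
  have "z\<^sup>2 * (\<integral>t. (1 - t) / (z - t)\<^sup>2 \<partial>\<mu>) = (\<integral>t. z\<^sup>2 * ((1 - t) / (z - t)\<^sup>2) \<partial>\<mu>)"
    by (rule integral_mult_right_zero[symmetric])
  also have "\<dots> = (\<integral>t. z * ?S t + ?E t + 1 \<partial>\<mu>)"
  proof (rule integral_cong_AE)
    show "AE t in \<mu>. z\<^sup>2 * ((1 - t) / (z - t)\<^sup>2) = z * ?S t + ?E t + 1"
      using b(4)
    proof eventually_elim
      case (elim t)
      then have "cap b t = t" "z - t \<noteq> 0" using b by (auto simp: cap_def)
      then show ?case by (simp add: divide_simps) (simp add: algebra_simps power2_eq_square)
    qed
  qed (rule measurable_law, measurable)+
  also have "\<dots> = z * (\<integral>t. ?S t \<partial>\<mu>) + (\<integral>t. ?E t \<partial>\<mu>) + 1"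
  proof -
    have "(\<integral>t. z * f t + g t + 1 \<partial>\<mu>) = z * (\<integral>t. f t \<partial>\<mu>) + (\<integral>t. g t \<partial>\<mu>) + 1"
      if "integrable \<mu> f" "integrable \<mu> g" for f g :: "real \<Rightarrow> real"
      using that by (simp add: \<mu>.prob_space)
    then show ?thesis using int .
  qed
  finally have "z\<^sup>2 * (\<integral>t. (1 - t) / (z - t)\<^sup>2 \<partial>\<mu>) = z * right_slope \<mu> b z z + right_mean \<mu> b z + 1"
    by (simp add: right_slope_def right_mean_def)
  then have "y * (z\<^sup>2 * (\<integral>t. (1 - t) / (z - t)\<^sup>2 \<partial>\<mu>)) = y * (z * right_slope \<mu> b z z + right_mean \<mu> b z + 1)" by simp
  then show ?thesis unfolding crit by (simp add: algebra_simps)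
qed

text \<open>The slope reaches x/y near \<open>b\<close>, and at u = 1 it equals E[p/(1-p)], which is
  below x/y. So an interior critical point exists, strict monotonicity makes it unique, and both
  bounds meet there.\<close>

lemma right_case_curved:
  assumes b: "0 < b" "b < 1" "AE t in \<mu>. t \<le> b"
    and xy: "0 < x" "0 < y"
    and lower: "quot_expectation \<mu> (\<lambda>t. t) (\<lambda>t. 1 - t) < ennreal (x / y)"
    and upper: "ennreal (x / y) < quot_expectation \<mu> (\<lambda>t. t * (1 - t)) (\<lambda>t. (b - t)\<^sup>2)"
  shows "\<exists>z\<^sub>0\<in>{b<..<1}. (\<forall>z\<in>{b<..<1}. x / y = (\<integral>t. t * (1 - t) / (z - t)\<^sup>2 \<partial>\<mu>) \<longleftrightarrow> z = z\<^sub>0) \<and>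
    Psi_right_is M X x y (y * z\<^sub>0\<^sup>2 * (\<integral>t. (1 - t) / (z\<^sub>0 - t)\<^sup>2 \<partial>\<mu>) - y)"
proof -
  interpret \<mu>: prob_space \<mu> by (rule prob_space_law)
  have xy0: "0 < x / y" using xy by simp
  let ?S = "\<lambda>u. right_slope \<mu> b u u"
  have "\<exists>l. b < l \<and> l < 1 \<and> x / y \<le> ?S l"
  \<comment> \<open>The slope becomes large near \<open>b\<close> for one of two reasons: an atom at
    \<open>b\<close> or, without one, Fatou's lemma with the hypothesis
    \<open>upper\<close>.\<close>
  proof (cases "measure \<mu> {b..} = 0")
    case False
    then have "0 < measure \<mu> {b..}" by (simp add: zero_less_measure_iff)
    then show ?thesis using b xy0 by (intro right_slope_large) auto
  next
    case True
    then have "{b..} \<in> null_sets \<mu>" by (simp add: null_sets_def sets_law \<mu>.emeasure_eq_measure)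
    then have "AE t in \<mu>. t \<notin> {b..}" by (rule AE_not_in)
    then have lt: "AE t in \<mu>. t < b" by eventually_elim simp
    have pos: "AE t in \<mu>. 0 \<le> t * (1 - t) \<and> 0 < (b - t)\<^sup>2"
      using lt AE_law_unit by eventually_elim auto
    define v where "v i = b + (1 - b) / real (i + 2)" for i :: nat
    have v: "b < v i" "v i < 1" for i using b divide_step_bounds[of "1 - b" i] by (auto simp: v_def)
    have lim: "v \<longlonglongrightarrow> b" unfolding v_def by real_asymp
    have "\<exists>i. x / y < (\<integral>t. cap b t * (1 - cap b t) / ((v i - cap b t) * (v i - cap b t)) \<partial>\<mu>)"
    proof (rule exists_integral_greater[where f = "\<lambda>t. t * (1 - t) / (b - t)\<^sup>2"])
      show "integrable \<mu> (\<lambda>t. cap b t * (1 - cap b t) / ((v i - cap b t) * (v i - cap b t)))" for i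
        using b v[of i] by (intro right_slope_integrable) auto
      show "AE t in \<mu>. 0 \<le> cap b t * (1 - cap b t) / ((v i - cap b t) * (v i - cap b t))" for i
        using b v[of i] by (intro right_slope_nonneg) auto
      show "AE t in \<mu>. (\<lambda>i. cap b t * (1 - cap b t) / ((v i - cap b t) * (v i - cap b t))) \<longlonglongrightarrow> t * (1 - t) / (b - t)\<^sup>2"
        using lt
      proof eventually_elim
        case (elim t)
        then have "cap b t = t" by (simp add: cap_def)
        moreover have "(\<lambda>i. t * (1 - t) / ((v i - t) * (v i - t))) \<longlonglongrightarrow> t * (1 - t) / ((b - t) * (b - t))"
          using elim by (intro tendsto_intros lim) auto
        ultimately show ?case by (simp add: power2_eq_square)
      qed
      show "ennreal (x / y) < (\<integral>\<^sup>+t. ennreal (t * (1 - t) / (b - t)\<^sup>2) \<partial>\<mu>)"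
        using upper by (subst (asm) quot_expectation_eq[OF _ _ pos]) auto
    qed (use xy0 in auto)
    then obtain i where "x / y < ?S (v i)" by (auto simp: right_slope_def)
    then show ?thesis using v[of i] by (intro exI[of _ "v i"]) auto
  qed
  then obtain l where l: "b < l" "l < 1" "x / y \<le> ?S l" by blast
  have S1: "?S 1 < x / y"
  proof -
    have pos: "AE t in \<mu>. 0 \<le> t \<and> 0 < 1 - t" using b(3) AE_law_unit by eventually_elim (use b in auto)
    have "quot_expectation \<mu> (\<lambda>t. t) (\<lambda>t. 1 - t) = (\<integral>\<^sup>+t. ennreal (t / (1 - t)) \<partial>\<mu>)"
      by (rule quot_expectation_eq[OF _ _ pos]) auto
    also have "\<dots> = (\<integral>\<^sup>+t. ennreal (cap b t * (1 - cap b t) / ((1 - cap b t) * (1 - cap b t))) \<partial>\<mu>)"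
      by (rule nn_integral_cong_AE) (use b(3) in \<open>eventually_elim, use b in \<open>simp add: cap_def\<close>\<close>)
    also have "\<dots> = ennreal (?S 1)"
      unfolding right_slope_def
    proof (rule nn_integral_eq_integral)
      show "integrable \<mu> (\<lambda>t. cap b t * (1 - cap b t) / ((1 - cap b t) * (1 - cap b t)))"
        using b by (intro right_slope_integrable) auto
      show "AE t in \<mu>. 0 \<le> cap b t * (1 - cap b t) / ((1 - cap b t) * (1 - cap b t))"
        using b by (intro right_slope_nonneg) auto
    qed
    finally show ?thesis using lower xy0 right_slope_nonneg(2)[of b 1 1] b by (simp add: ennreal_less_iff)
  qed
  obtain z where z: "l \<le> z" "z \<le> 1" "?S z = x / y"
    using right_slope_attains[of b l 1 "x / y"] l S1 b by auto
  then have z1: "z < 1" using S1 by (cases "z = 1") auto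
  have uniq: "x / y = (\<integral>t. t * (1 - t) / (w - t)\<^sup>2 \<partial>\<mu>) \<longleftrightarrow> w = z" if w: "w \<in> {b<..<1}" for w
    unfolding right_slope_eq[OF b(3), symmetric]
  proof
    assume eq: "x / y = ?S w"
    show "w = z"
    proof (rule ccontr)
      assume "w \<noteq> z"
      then consider "w < z" | "z < w" by linarith
      then show False
        using right_slope_strict[of b w z] right_slope_strict[of b z w] w z z1 l b xy0 eq by cases auto
    qed
  qed (use z in simp)
  have crit: "x = y * ?S z" using z xy by simp
  have "liminf_ge id x y (z * x + y * right_mean \<mu> b z)"
    by (rule right_lower[OF _ _ _ xy crit]) (use b l z z1 in auto)
  moreover have "limsup_le id x y (z * x + y * right_mean \<mu> b z)"
    by (rule right_upper[OF _ _ _ b(3)]) (use b l z z1 xy in auto)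
  ultimately have "Psi_right_is M X x y (z * x + y * right_mean \<mu> b z)" by (rule Psi_right_isI)
  then have "Psi_right_is M X x y (y * z\<^sup>2 * (\<integral>t. (1 - t) / (z - t)\<^sup>2 \<partial>\<mu>) - y)"
    by (subst right_value[OF _ _ _ b(3) crit]) (use b l z in auto)
  then show ?thesis using uniq z l z1 by (intro bexI[of _ z]) auto
qed

text \<open>Mass arbitrarily close to 1 lets caps tend to 1 with slopes as large as desired just
  above them, so \<open>right_full\<close> applies for every ratio x/y.\<close>

lemma right_case_full_1:
  assumes mass: "\<And>c. c < 1 \<Longrightarrow> 0 < measure \<mu> {c..}" and xy: "0 < x" "0 < y"
  shows "Psi_right_is M X x y x"
proof (rule Psi_right_isI)
  show "limsup_le id x y x" using xy by (intro limsup_le_trivial) auto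
  show "liminf_ge id x y x"
  proof (rule liminf_ge_lim)
    fix i :: nat
    let ?c = "1 - 1 / real (i + 2)"
    have c: "0 < ?c" "?c < 1" using divide_step_bounds[of 1 i] by auto
    then obtain u where u: "?c < u" "u < 1" "x / y \<le> right_slope \<mu> ?c u u"
      using right_slope_large[of ?c 1 "x / y"] mass xy by auto
    then have "liminf_ge id x y (u * x)" using c xy by (intro right_full[of ?c]) auto
    then show "liminf_ge id x y (?c * x)" using u xy by (rule_tac liminf_ge_mono) auto
  next
    show "(\<lambda>i. (1 - 1 / real (i + 2)) * x) \<longlonglongrightarrow> x" by real_asymp
  qed
qed

text \<open>For u < 1 the slope is at least E[p/(1-p)], since u - t is below 1 - t. Hence
  \<open>right_full\<close> applies with u tending to 1.\<close>

lemma right_case_full: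
  assumes b: "0 \<le> b" "b < 1" "AE t in \<mu>. t \<le> b" and xy: "0 < x" "0 < y"
    and le: "ennreal (x / y) \<le> quot_expectation \<mu> (\<lambda>t. t) (\<lambda>t. 1 - t)"
  shows "Psi_right_is M X x y x"
proof (rule Psi_right_isI)
  show "limsup_le id x y x" using xy by (intro limsup_le_trivial) auto
  show "liminf_ge id x y x"
  proof (rule liminf_ge_lim)
    fix i :: nat
    let ?u = "1 - (1 - b) / real (i + 2)"
    have u: "b < ?u" "?u < 1" using b divide_step_bounds[of "1 - b" i] by auto
    let ?f = "\<lambda>t. cap b t * (1 - cap b t) / ((?u - cap b t) * (?u - cap b t))"
    have pos: "AE t in \<mu>. 0 \<le> t \<and> 0 < 1 - t" using b(3) AE_law_unit by eventually_elim (use b in auto)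
    have "quot_expectation \<mu> (\<lambda>t. t) (\<lambda>t. 1 - t) = (\<integral>\<^sup>+t. ennreal (t / (1 - t)) \<partial>\<mu>)"
      by (rule quot_expectation_eq[OF _ _ pos]) auto
    also have "\<dots> \<le> (\<integral>\<^sup>+t. ennreal (?f t) \<partial>\<mu>)"
    proof (rule nn_integral_mono_AE)
      show "AE t in \<mu>. ennreal (t / (1 - t)) \<le> ennreal (?f t)"
        using b(3) AE_law_unit
      proof eventually_elim
        case (elim t)
        then have c: "cap b t = t" and t: "0 < ?u - t" "t < 1" "0 \<le> t" using u b by (auto simp: cap_def)
        have "t / (1 - t) = t * (1 - t) / ((1 - t) * (1 - t))" using t by simp
        also have "\<dots> \<le> t * (1 - t) / ((?u - t) * (?u - t))"
          using t u by (intro divide_left_mono mult_mono mult_pos_pos mult_nonneg_nonneg) auto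
        finally show ?case unfolding c by (rule ennreal_leI)
      qed
    qed
    also have "\<dots> = ennreal (right_slope \<mu> b ?u ?u)"
      unfolding right_slope_def
    proof (rule nn_integral_eq_integral)
      show "integrable \<mu> ?f" using b u by (intro right_slope_integrable) auto
      show "AE t in \<mu>. 0 \<le> ?f t"
        using b u by (intro right_slope_nonneg) auto
    qed
    finally have "ennreal (x / y) \<le> ennreal (right_slope \<mu> b ?u ?u)" using le by (rule order_trans[rotated])
    then have "x / y \<le> right_slope \<mu> b ?u ?u"
      using right_slope_nonneg(2)[of b ?u ?u] b u by (simp add: ennreal_le_iff)
    then show "liminf_ge id x y (?u * x)" using b u xy by (intro right_full) auto
  next
    show "(\<lambda>i. (1 - (1 - b) / real (i + 2)) * x) \<longlonglongrightarrow> x" by real_asymp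
  qed
qed

text \<open>All probabilities vanish almost surely, so the geometric part of each upper bound is 0
  and only u x remains, with u tending to 0.\<close>

lemma right_case_0:
  assumes "AE t in \<mu>. t \<le> 0" and xy: "0 < x" "0 < y"
  shows "Psi_right_is M X x y 0"
proof (rule Psi_right_isI)
  show "liminf_ge id x y 0" by (rule liminf_ge_0)
  have mean: "right_mean \<mu> 0 u = 0" if "0 < u" for u
  proof -
    have "right_mean \<mu> 0 u = (\<integral>t. 0 \<partial>\<mu>)"
      unfolding right_mean_def
    proof (rule integral_law_cong)
      show "cap 0 t * (1 - u) / (u - cap 0 t) = 0" if "0 \<le> t" "t \<le> 1" for t using that by (simp add: cap_def)
    qed measurable
    then show ?thesis by simp
  qed
  show "limsup_le id x y 0"
  proof (rule limsup_le_lim)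
    show "limsup_le id x y (1 / real (i + 2) * x + y * right_mean \<mu> 0 (1 / real (i + 2)))" for i
      using assms by (intro right_upper) auto
    show "(\<lambda>i. 1 / real (i + 2) * x + y * right_mean \<mu> 0 (1 / real (i + 2))) \<longlonglongrightarrow> 0"
      by (subst mean) (simp, real_asymp)
  qed
qed

end

lemma lpp0_one:
  assumes "\<And>z. w z = 1"
  shows "k \<le> lpp0 w k (Suc l)"
proof (induction k)
  case (Suc k)
  then show ?case by (simp add: assms max.coboundedI1)
qed simp

section \<open>The regimes of upward paths\<close>

context bernoulli_environment
begin

lemma up_slope_commute: "up_slope \<mu> z v = up_slope \<mu> v z"
  unfolding up_slope_def by (simp add: mult.commute)

lemma up_slope_continuous:
  assumes "0 < m"
  shows "continuous_on {m..m'} (\<lambda>u. up_slope \<mu> u u)"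
proof (rule lipschitz_on_continuous_on[where L = "2 / m ^ 3"], rule lipschitz_onI)
  show "0 \<le> 2 / m ^ 3" using assms by simp
  fix u v assume uv: "u \<in> {m..m'}" "v \<in> {m..m'}"
  have "\<bar>up_slope \<mu> u u - up_slope \<mu> u v\<bar> \<le> 1 / m ^ 3 * \<bar>u - v\<bar>"
    "\<bar>up_slope \<mu> v u - up_slope \<mu> v v\<bar> \<le> 1 / m ^ 3 * \<bar>u - v\<bar>"
    using up_slope_lipschitz[OF assms, of u v u] up_slope_lipschitz[OF assms, of u v v] uv by auto
  then show "dist (up_slope \<mu> u u) (up_slope \<mu> v v) \<le> 2 / m ^ 3 * dist u v"
    unfolding up_slope_commute[of v u] by (simp add: dist_real_def)
qed

text \<open>The uniform factor is now 1 + (v-u)/(1+u), a lower bound of (t+v)/(t+u) because t is at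
  most 1.\<close>

lemma up_slope_strict:
  assumes "0 < u" "u < v" "0 < up_slope \<mu> v v"
  shows "up_slope \<mu> v v < up_slope \<mu> u u"
proof -
  let ?f = "\<lambda>u t. t * (1 - t) / ((t + u) * (t + u))"
  define k where "k = (v - u) / (1 + u)"
  have k: "0 < k" using assms by (simp add: k_def)
  have "up_slope \<mu> v v < (1 + k)\<^sup>2 * up_slope \<mu> v v"
  proof -
    have "1 < (1 + k)\<^sup>2" using k by (simp add: one_less_power)
    then show ?thesis using mult_strict_right_mono[of 1 _ "up_slope \<mu> v v"] assms by simp
  qed
  also have "\<dots> = (\<integral>t. (1 + k)\<^sup>2 * ?f v t \<partial>\<mu>)"
    unfolding up_slope_def by (rule integral_mult_right_zero[symmetric])
  also have "\<dots> \<le> up_slope \<mu> u u"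
    unfolding up_slope_def
  proof (rule integral_mono_AE)
    show "AE t in \<mu>. (1 + k)\<^sup>2 * ?f v t \<le> ?f u t"
      using AE_law_unit
    proof eventually_elim
      case (elim t)
      have "k * (t + u) \<le> k * (1 + u)" using k elim by (intro mult_left_mono) auto
      also have "\<dots> = v - u" using assms by (simp add: k_def)
      finally have "(1 + k) * (t + u) \<le> t + v" by (simp add: algebra_simps)
      then have "1 + k \<le> (t + v) / (t + u)" using elim assms by (simp add: pos_le_divide_eq)
      then show ?case
        using scaled_square_le[of "t * (1 - t)" "t + u" "t + v" k] elim assms k
        by (simp add: power2_eq_square)
    qed
    have int: "integrable \<mu> (?f w)" if "0 < w" for w using that by (intro up_slope_integrable)
    show "integrable \<mu> (?f u)" "integrable \<mu> (\<lambda>t. (1 + k)\<^sup>2 * ?f v t)"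
      using assms by (intro integrable_mult_right int; simp)+
  qed
  finally show ?thesis .
qed

lemma up_slope_eq: "up_slope \<mu> z z = (\<integral>t. t * (1 - t) / (z + t)\<^sup>2 \<partial>\<mu>)"
  unfolding up_slope_def by (simp add: power2_eq_square add.commute)

text \<open>Pointwise, z^2(1-t)/(z+t)^2 is 1 minus z times the slope integrand minus the mean
  integrand.\<close>

lemma up_value:
  assumes z: "0 < z" and crit: "x = y * up_slope \<mu> z z"
  shows "y - y * z\<^sup>2 * (\<integral>t. (1 - t) / (z + t)\<^sup>2 \<partial>\<mu>) = z * x + y * up_mean \<mu> z"
proof -
  interpret \<mu>: prob_space \<mu> by (rule prob_space_law)
  let ?S = "\<lambda>t. t * (1 - t) / ((t + z) * (t + z))" and ?E = "\<lambda>t. t * (1 + z) / (t + z)"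
  have int: "integrable \<mu> ?S" "integrable \<mu> ?E" using z by (auto intro!: up_slope_integrable up_mean_integrable)
  have "z\<^sup>2 * (\<integral>t. (1 - t) / (z + t)\<^sup>2 \<partial>\<mu>) = (\<integral>t. z\<^sup>2 * ((1 - t) / (z + t)\<^sup>2) \<partial>\<mu>)"
    by (rule integral_mult_right_zero[symmetric])
  also have "\<dots> = (\<integral>t. 1 - z * ?S t - ?E t \<partial>\<mu>)"
  proof (rule integral_law_cong)
    fix t :: real assume t: "0 \<le> t" "t \<le> 1"
    then have "z + t \<noteq> 0" "t + z \<noteq> 0" using z by auto
    then show "z\<^sup>2 * ((1 - t) / (z + t)\<^sup>2) = 1 - z * ?S t - ?E t"
      by (simp add: divide_simps) (simp add: algebra_simps power2_eq_square)
  qed measurable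
  also have "\<dots> = 1 - z * (\<integral>t. ?S t \<partial>\<mu>) - (\<integral>t. ?E t \<partial>\<mu>)"
  proof -
    have "(\<integral>t. 1 - z * f t - g t \<partial>\<mu>) = 1 - z * (\<integral>t. f t \<partial>\<mu>) - (\<integral>t. g t \<partial>\<mu>)"
      if "integrable \<mu> f" "integrable \<mu> g" for f g :: "real \<Rightarrow> real"
      using that by (simp add: \<mu>.prob_space)
    then show ?thesis using int .
  qed
  finally have "z\<^sup>2 * (\<integral>t. (1 - t) / (z + t)\<^sup>2 \<partial>\<mu>) = 1 - z * up_slope \<mu> z z - up_mean \<mu> z"
    by (simp add: up_slope_def up_mean_def)
  then have "y * (z\<^sup>2 * (\<integral>t. (1 - t) / (z + t)\<^sup>2 \<partial>\<mu>)) = y * (1 - z * up_slope \<mu> z z - up_mean \<mu> z)" by simp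
  then show ?thesis unfolding crit by (simp add: algebra_simps)
qed

text \<open>As z decreases to 0, the slope integrand tends to (1-t)/t for t > 0 but stays 0 at t =
  0. This is why the integral in \<open>upper\<close> runs over positive t only.\<close>

lemma up_case_curved:
  assumes xy: "0 < x" "0 < y"
    and upper: "ennreal (x / y) < (\<integral>\<^sup>+t. ennreal ((1 - t) / t) * indicator {0<..} t \<partial>\<mu>)"
  shows "\<exists>z\<^sub>0\<in>{0<..}. (\<forall>z\<in>{0<..}. x / y = (\<integral>t. t * (1 - t) / (z + t)\<^sup>2 \<partial>\<mu>) \<longleftrightarrow> z = z\<^sub>0) \<and>
    Psi_up_is M X x y (y - y * z\<^sub>0\<^sup>2 * (\<integral>t. (1 - t) / (z\<^sub>0 + t)\<^sup>2 \<partial>\<mu>))"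
proof -
  have xy0: "0 < x / y" using xy by simp
  let ?S = "\<lambda>u. up_slope \<mu> u u"
  define v where "v i = 1 / real (i + 2)" for i :: nat
  have v: "0 < v i" for i by (simp add: v_def)
  have lim: "v \<longlonglongrightarrow> 0" unfolding v_def by real_asymp
  have "\<exists>i. x / y < (\<integral>t. t * (1 - t) / ((t + v i) * (t + v i)) \<partial>\<mu>)"
  proof (rule exists_integral_greater[where f = "\<lambda>t. if 0 < t then (1 - t) / t else 0"])
    show "integrable \<mu> (\<lambda>t. t * (1 - t) / ((t + v i) * (t + v i)))" for i
      using v by (intro up_slope_integrable)
    show "AE t in \<mu>. 0 \<le> t * (1 - t) / ((t + v i) * (t + v i))" for i
      using AE_law_unit by eventually_elim (use v[of i] in auto)
    show "AE t in \<mu>. (\<lambda>i. t * (1 - t) / ((t + v i) * (t + v i))) \<longlonglongrightarrow> (if 0 < t then (1 - t) / t else 0)"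
      using AE_law_unit
    proof eventually_elim
      case (elim t)
      show ?case
      proof (cases "t = 0")
        case False
        then have "(\<lambda>i. t * (1 - t) / ((t + v i) * (t + v i))) \<longlonglongrightarrow> t * (1 - t) / ((t + 0) * (t + 0))"
          by (intro tendsto_intros lim) auto
        then show ?thesis using False elim by auto
      qed simp
    qed
    have "(\<integral>\<^sup>+t. ennreal ((1 - t) / t) * indicator {0<..} t \<partial>\<mu>) = (\<integral>\<^sup>+t. ennreal (if 0 < t then (1 - t) / t else 0) \<partial>\<mu>)"
      by (intro nn_integral_cong) (simp add: indicator_def)
    then show "ennreal (x / y) < (\<integral>\<^sup>+t. ennreal (if 0 < t then (1 - t) / t else 0) \<partial>\<mu>)" using upper by simp
  qed (use xy0 in auto)
  then obtain l where l: "0 < l" "x / y < ?S l" using v unfolding up_slope_def by blast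
  \<comment> \<open>The slope at \<open>h\<close> is at most 1/h^2; being at least 1 and at least
    y/x, \<open>h\<close> brings it down to x/y.\<close>
  define h where "h = max l (1 + y / x)"
  have "0 < y / x" using xy by simp
  then have h: "l \<le> h" "1 \<le> h" "y / x \<le> h" "0 < h" using l by (auto simp: h_def)
  have "?S h \<le> 1 / (h * h)" using h by (intro up_slope_integrable) auto
  also have "\<dots> \<le> 1 / (y / x)"
    using h xy mult_mono[of 1 h "y / x" h] by (intro divide_left_mono) auto
  finally have Sh: "?S h \<le> x / y" using xy by simp
  obtain z where z: "l \<le> z" "z \<le> h" "?S z = x / y"
    using IVT2'[OF Sh less_imp_le[OF l(2)] h(1) up_slope_continuous[OF l(1)]] by auto
  have uniq: "x / y = (\<integral>t. t * (1 - t) / (w + t)\<^sup>2 \<partial>\<mu>) \<longleftrightarrow> w = z" if w: "w \<in> {0<..}" for w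
    unfolding up_slope_eq[symmetric]
  proof
    assume eq: "x / y = ?S w"
    show "w = z"
    proof (rule ccontr)
      assume "w \<noteq> z"
      then consider "w < z" | "z < w" by linarith
      then show False
        using up_slope_strict[of w z] up_slope_strict[of z w] w z l xy0 eq by cases auto
    qed
  qed (use z in simp)
  have crit: "x = y * ?S z" using z xy by simp
  have z0: "0 < z" using z l by simp
  have "liminf_ge prod.swap y x (z * x + y * up_mean \<mu> z)" using z0 xy crit by (rule up_lower)
  moreover have "limsup_le prod.swap y x (z * x + y * up_mean \<mu> z)" using z0 xy by (intro up_upper) auto
  ultimately have "Psi_up_is M X x y (z * x + y * up_mean \<mu> z)" by (rule Psi_up_isI)
  then have "Psi_up_is M X x y (y - y * z\<^sup>2 * (\<integral>t. (1 - t) / (z + t)\<^sup>2 \<partial>\<mu>))"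
    using up_value[OF z0 crit] by simp
  then show ?thesis using uniq z0 by (intro bexI[of _ z]) auto
qed

text \<open>The slope vanishes for every z, so no parameter is critical; the value is computed
  directly from weights that all equal 1.\<close>

lemma up_liminf_of_constant_1:
  assumes "AE t in \<mu>. t = 1" and xy: "0 < x" "0 < y"
  shows "liminf_ge prod.swap y x y"
proof -
  have "AE \<omega> in M. \<forall>z. X z \<omega> = 1"
    unfolding AE_all_countable
  proof
    fix z :: "nat \<times> nat"
    have "AE \<omega> in M. p (snd z) \<omega> = 1" by (rule iffD1[OF AE_law_iff assms(1)]) measurable
    then have "expectation (p (snd z)) = expectation (\<lambda>_. 1)" by (intro integral_cong_AE) auto
    then have "prob {\<omega> \<in> space M. X z \<omega> = 1} = 1"
      using prob_pattern[of "{z}" "\<lambda>_. True"] by (simp add: prob_space)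
    then have "AE \<omega> in M. \<omega> \<in> {\<omega> \<in> space M. X z \<omega> = 1}" by (subst (asm) prob_eq_1) auto
    then show "AE \<omega> in M. X z \<omega> = 1" by (rule AE_mp) (auto intro!: AE_I2)
  qed
  then have L: "AE \<omega> in M. \<forall>n. y * real n - 1 \<le> passage prod.swap y x n \<omega>"
  proof eventually_elim
    case (elim \<omega>)
    show ?case
    proof
      fix n
      have "nat \<lfloor>real n * y\<rfloor> \<le> lpp0 (\<lambda>z. X01 (prod.swap z) \<omega>) (nat \<lfloor>real n * y\<rfloor>) (Suc (nat \<lfloor>real n * x\<rfloor>))"
        by (rule lpp0_one) (use spec[OF elim] in \<open>simp add: X01_def\<close>)
      then have "real (nat \<lfloor>real n * y\<rfloor>) \<le> passage prod.swap y x n \<omega>" unfolding passage_def by (rule of_nat_mono)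
      moreover have "real n * y - 1 \<le> real (nat \<lfloor>real n * y\<rfloor>)" by linarith
      ultimately show "y * real n - 1 \<le> passage prod.swap y x n \<omega>" by (simp add: mult.commute)
    qed
  qed
  show ?thesis unfolding liminf_ge_def
  proof (intro allI impI)
    fix e :: real assume e: "0 < e"
    have ev: "eventually (\<lambda>n. 1 \<le> e * real n) sequentially" using e by real_asymp
    show "AE \<omega> in M. eventually (\<lambda>n. (y - e) * real n \<le> passage prod.swap y x n \<omega>) sequentially"
      using L
    proof eventually_elim
      case (elim \<omega>)
      show ?case using ev
      proof eventually_elim
        case (elim n)
        then show ?case using \<open>\<forall>n. y * real n - 1 \<le> passage prod.swap y x n \<omega>\<close>[rule_format, of n]
          by (simp add: left_diff_distrib)
      qed
    qed
  qed
qed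

text \<open>The width is reduced from \<open>x\<close> to \<open>y * ?S\<close>, for which the small
  parameter \<open>v i\<close> is critical, and the Bernoulli part of the mean tends to
  \<open>y\<close>. This requires a positive slope, which fails only when p = 1 almost
  surely.\<close>

lemma up_case_full:
  assumes xy: "0 < x" "0 < y"
    and le: "quot_expectation \<mu> (\<lambda>t. 1 - t) (\<lambda>t. t) \<le> ennreal (x / y)"
  shows "Psi_up_is M X x y y"
proof (rule Psi_up_isI)
  interpret \<mu>: prob_space \<mu> by (rule prob_space_law)
  show "limsup_le prod.swap y x y" using xy by (intro limsup_le_trivial) auto
  have "(\<integral>\<^sup>+t. ennreal (1 - t) / ennreal t \<partial>\<mu>) \<noteq> \<infinity>"
    using le unfolding quot_expectation_def by (auto simp: top_unique)
  then have "AE t in \<mu>. ennreal (1 - t) / ennreal t \<noteq> \<infinity>"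
    by (intro nn_integral_PInf_AE measurable_law) auto
  \<comment> \<open>At t = 0 the quotient is 1/0, which is infinite, so an atom at 0 is
    excluded.\<close>
  then have pos: "AE t in \<mu>. 0 < t"
    using AE_law_unit
  proof eventually_elim
    case (elim t)
    show ?case
    proof (rule ccontr)
      assume "\<not> 0 < t"
      then have "t = 0" using elim by simp
      then show False using elim by simp
    qed
  qed
  show "liminf_ge prod.swap y x y"
  proof (cases "AE t in \<mu>. t = 1")
    case True
    then show ?thesis using xy by (rule up_liminf_of_constant_1)
  next
    case False
    define v where "v i = 1 / real (i + 2)" for i :: nat
    have v: "0 < v i" for i by (simp add: v_def)
    have lim: "v \<longlonglongrightarrow> 0" unfolding v_def by real_asymp
    have pos': "AE t in \<mu>. 0 \<le> 1 - t \<and> 0 < t" using pos AE_law_unit by eventually_elim auto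
    have Q: "quot_expectation \<mu> (\<lambda>t. 1 - t) (\<lambda>t. t) = (\<integral>\<^sup>+t. ennreal ((1 - t) / t) \<partial>\<mu>)"
      by (rule quot_expectation_eq[OF _ _ pos']) auto
    show ?thesis
    proof (rule liminf_ge_lim)
      fix i
      let ?f = "\<lambda>t. t * (1 - t) / ((t + v i) * (t + v i))" and ?S = "up_slope \<mu> (v i) (v i)"
      have int: "integrable \<mu> ?f" using v by (intro up_slope_integrable)
      have f0: "AE t in \<mu>. 0 \<le> ?f t" using AE_law_unit by eventually_elim (use v[of i] in auto)
      have "ennreal ?S = (\<integral>\<^sup>+t. ennreal (?f t) \<partial>\<mu>)"
        unfolding up_slope_def using nn_integral_eq_integral[OF int f0] by simp
      also have "\<dots> \<le> (\<integral>\<^sup>+t. ennreal ((1 - t) / t) \<partial>\<mu>)"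
      proof (rule nn_integral_mono_AE)
        show "AE t in \<mu>. ennreal (?f t) \<le> ennreal ((1 - t) / t)"
          using pos AE_law_unit
        proof eventually_elim
          case (elim t)
          have "?f t \<le> t * (1 - t) / (t * t)"
            using elim v[of i] by (intro divide_left_mono mult_mono mult_pos_pos mult_nonneg_nonneg) auto
          also have "\<dots> = (1 - t) / t" using elim by simp
          finally show ?case by (rule ennreal_leI)
        qed
      qed
      finally have "ennreal ?S \<le> ennreal (x / y)" using le Q by simp
      then have S_le: "?S \<le> x / y" using xy by (simp add: ennreal_le_iff)
      have "?S \<noteq> 0"
      proof
        assume "?S = 0"
        then have "AE t in \<mu>. ?f t = 0"
          using integral_nonneg_eq_0_iff_AE[OF int f0] by (simp add: up_slope_def)
        then have "AE t in \<mu>. t = 1" using pos by eventually_elim (use v[of i] in auto)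
        then show False using False by simp
      qed
      then have S: "0 < ?S" using up_slope_integrable(2)[OF v v, of i i] by simp
      have "liminf_ge prod.swap y (y * ?S) (v i * (y * ?S) + y * up_mean \<mu> (v i))"
        using S xy by (intro up_lower v) auto
      moreover have "y * ?S \<le> x" using S_le xy by (simp add: field_simps)
      moreover have "0 \<le> v i * (y * ?S)" using S xy v[of i] by simp
      ultimately show "liminf_ge prod.swap y x (y * up_mean \<mu> (v i))"
        by (elim liminf_ge_mono) auto
    next
      have "(\<lambda>i. up_mean \<mu> (v i)) \<longlonglongrightarrow> (\<integral>t. 1 \<partial>\<mu>)"
        unfolding up_mean_def
      proof (rule integral_dominated_convergence[where w = "\<lambda>_. 1"])
        show "(\<lambda>t. t * (1 + v i) / (t + v i)) \<in> borel_measurable \<mu>" for i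
          by (rule measurable_law) measurable
        show "AE t in \<mu>. (\<lambda>i. t * (1 + v i) / (t + v i)) \<longlonglongrightarrow> 1"
          using pos
        proof eventually_elim
          case (elim t)
          have "(\<lambda>i. t * (1 + v i) / (t + v i)) \<longlonglongrightarrow> t * (1 + 0) / (t + 0)"
            using elim by (intro tendsto_intros lim) auto
          then show ?case using elim by simp
        qed
        show "AE t in \<mu>. norm (t * (1 + v i) / (t + v i)) \<le> 1" for i
          using AE_law_unit
        proof eventually_elim
          case (elim t)
          then have "0 \<le> t * (1 + v i) / (t + v i) \<and> t * (1 + v i) / (t + v i) \<le> 1"
            by (intro up_fraction_bounds v) auto
          then show ?case unfolding real_norm_def by (subst abs_of_nonneg) blast+
        qed
      qed auto
      then have "(\<lambda>i. y * up_mean \<mu> (v i)) \<longlonglongrightarrow> y * 1" by (intro tendsto_intros) (simp add: \<mu>.prob_space)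
      then show "(\<lambda>i. y * up_mean \<mu> (v i)) \<longlonglongrightarrow> y" by simp
    qed
  qed
qed

section \<open>Degenerate essential suprema and assembly of the cases\<close>

lemma esssup_law:
  assumes b: "ereal b = esssup \<mu> ereal"
  shows "AE t in \<mu>. t \<le> b" "0 \<le> b" "b \<le> 1" "\<And>c. c < b \<Longrightarrow> 0 < measure \<mu> {c..}"
proof -
  interpret \<mu>: prob_space \<mu> by (rule prob_space_law)
  have meas: "ereal \<in> borel_measurable \<mu>" by (rule measurable_law) simp
  show le: "AE t in \<mu>. t \<le> b" using esssup_AE[of ereal \<mu>] by (simp add: b[symmetric])
  have "AE t in \<mu>. 0 \<le> b" using le AE_law_unit by eventually_elim auto
  then show "0 \<le> b" by simp
  have "esssup \<mu> ereal \<le> ereal 1" by (rule esssup_I[OF meas]) (use AE_law_unit in auto)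
  then show "b \<le> 1" by (simp add: b[symmetric])
  fix c assume c: "c < b"
  show "0 < measure \<mu> {c..}"
  proof (rule ccontr)
    assume "\<not> 0 < measure \<mu> {c..}"
    then have "{c..} \<in> null_sets \<mu>"
      by (simp add: null_sets_def sets_law \<mu>.emeasure_eq_measure zero_less_measure_iff)
    then have "AE t in \<mu>. t \<notin> {c..}" by (rule AE_not_in)
    then have "AE t in \<mu>. ereal t \<le> ereal c" by eventually_elim simp
    then have "esssup \<mu> ereal \<le> ereal c" by (rule esssup_I[OF meas])
    then show False using c by (simp add: b[symmetric])
  qed
qed

text \<open>The approximation needs 0 < b < 1. For b = 0 the integrand is 0 almost surely and so is
  the limit; for b = 1 the factor 1 - b removes the integral and the value is x.\<close>

lemma Psi_right_flat:
  assumes b: "ereal b = esssup \<mu> ereal" and xy: "0 < x" "0 < y"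
    and le: "quot_expectation \<mu> (\<lambda>t. t * (1 - t)) (\<lambda>t. (b - t)\<^sup>2) \<le> ennreal (x / y)"
  shows "Psi_right_is M X x y (b * x + y * (1 - b) * (\<integral>t. t / (b - t) \<partial>\<mu>))"
proof -
  note bs = esssup_law[OF b]
  consider "b = 0" | "b = 1" | "0 < b" "b < 1" using bs(2,3) by linarith
  then show ?thesis
  proof cases
    case 1
    have "(\<integral>t. t / (0 - t) \<partial>\<mu>) = (\<integral>t. 0 \<partial>\<mu>)"
    proof (rule integral_cong_AE)
      show "AE t in \<mu>. t / (0 - t) = 0" using bs(1) AE_law_unit by eventually_elim (use 1 in auto)
    qed (rule measurable_law, measurable)+
    then show ?thesis using right_case_0[OF _ xy] bs(1) 1 by simp
  next
    case 2
    then show ?thesis using right_case_full_1[OF _ xy] bs(4) by simp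
  next
    case 3
    then show ?thesis using right_case_flat[OF 3 bs(1) bs(4) xy le] by blast
  qed
qed

text \<open>The extreme cases are vacuous. For b = 0 the upper threshold is 0, because 0/0 = 0. For
  b = 1 a finite lower threshold excludes an atom at 1, and then both thresholds coincide.\<close>

lemma Psi_right_curved:
  assumes b: "ereal b = esssup \<mu> ereal" and xy: "0 < x" "0 < y"
    and lower: "quot_expectation \<mu> (\<lambda>t. t) (\<lambda>t. 1 - t) < ennreal (x / y)"
    and upper: "ennreal (x / y) < quot_expectation \<mu> (\<lambda>t. t * (1 - t)) (\<lambda>t. (b - t)\<^sup>2)"
  shows "\<exists>z\<^sub>0\<in>{b<..<1}. (\<forall>z\<in>{b<..<1}. x / y = (\<integral>t. t * (1 - t) / (z - t)\<^sup>2 \<partial>\<mu>) \<longleftrightarrow> z = z\<^sub>0) \<and>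
    Psi_right_is M X x y (y * z\<^sub>0\<^sup>2 * (\<integral>t. (1 - t) / (z\<^sub>0 - t)\<^sup>2 \<partial>\<mu>) - y)"
proof -
  note bs = esssup_law[OF b]
  consider "b = 0" | "b = 1" | "0 < b" "b < 1" using bs(2,3) by linarith
  then show ?thesis
  proof cases
    case 1
    have "quot_expectation \<mu> (\<lambda>t. t * (1 - t)) (\<lambda>t. (b - t)\<^sup>2) = (\<integral>\<^sup>+t. 0 \<partial>\<mu>)"
      unfolding quot_expectation_def
    proof (rule nn_integral_cong_AE)
      show "AE t in \<mu>. ennreal (t * (1 - t)) / ennreal ((b - t)\<^sup>2) = 0"
        using bs(1) AE_law_unit
      proof eventually_elim
        case (elim t)
        then have "t = 0" using 1 by simp
        then show ?case by simp
      qed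
    qed
    then show ?thesis using upper by simp
  next
    case 2
    have "quot_expectation \<mu> (\<lambda>t. t) (\<lambda>t. 1 - t) \<noteq> \<infinity>" using lower by (auto simp: top_unique)
    then have "AE t in \<mu>. ennreal t / ennreal (1 - t) \<noteq> \<infinity>"
      unfolding quot_expectation_def by (intro nn_integral_PInf_AE measurable_law) auto
    then have ne: "AE t in \<mu>. t \<noteq> 1" by eventually_elim auto
    have "quot_expectation \<mu> (\<lambda>t. t * (1 - t)) (\<lambda>t. (b - t)\<^sup>2) = quot_expectation \<mu> (\<lambda>t. t) (\<lambda>t. 1 - t)"
      unfolding quot_expectation_def
    proof (rule nn_integral_cong_AE)
      show "AE t in \<mu>. ennreal (t * (1 - t)) / ennreal ((b - t)\<^sup>2) = ennreal t / ennreal (1 - t)"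
        using ne AE_law_unit
      proof eventually_elim
        case (elim t)
        then have t: "0 < 1 - t" "0 < (1 - t)\<^sup>2" by auto
        then have "ennreal (t * (1 - t)) / ennreal ((1 - t)\<^sup>2) = ennreal (t * (1 - t) / (1 - t)\<^sup>2)"
          using elim by (intro divide_ennreal) auto
        also have "t * (1 - t) / (1 - t)\<^sup>2 = t / (1 - t)" using t by (simp add: power2_eq_square)
        also have "ennreal (t / (1 - t)) = ennreal t / ennreal (1 - t)" using elim t by (simp add: divide_ennreal)
        finally show ?case using 2 by simp
      qed
    qed
    then show ?thesis using lower upper by simp
  next
    case 3
    then show ?thesis using right_case_curved[OF 3 bs(1) xy lower upper] by blast
  qed
qed

lemma Psi_right_full:
  assumes b: "ereal b = esssup \<mu> ereal" and xy: "0 < x" "0 < y"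
    and le: "ennreal (x / y) \<le> quot_expectation \<mu> (\<lambda>t. t) (\<lambda>t. 1 - t)"
  shows "Psi_right_is M X x y x"
proof (cases "b = 1")
  case True
  then show ?thesis using right_case_full_1[OF _ xy] esssup_law(4)[OF b] by simp
next
  case False
  then show ?thesis using right_case_full[OF _ _ _ xy le] esssup_law[OF b] by simp
qed

text \<open>An atom at 0 makes E[(1-p)/p] infinite, yet the slope stays below the integral over
  positive t, so the critical equation is solvable only for ratios below that integral. Without such
  an atom the two integrals agree.\<close>

lemma Psi_up_curved:
  assumes xy: "0 < x" "0 < y"
    and "ennreal (x / y) < quot_expectation \<mu> (\<lambda>t. 1 - t) (\<lambda>t. t)"
    and "(AE t in \<mu>. t \<noteq> 0) \<or> ennreal (x / y) < (\<integral>\<^sup>+t. ennreal ((1 - t) / t) * indicator {0<..} t \<partial>\<mu>)"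
  shows "\<exists>z\<^sub>0\<in>{0<..}. (\<forall>z\<in>{0<..}. x / y = (\<integral>t. t * (1 - t) / (z + t)\<^sup>2 \<partial>\<mu>) \<longleftrightarrow> z = z\<^sub>0) \<and>
    Psi_up_is M X x y (y - y * z\<^sub>0\<^sup>2 * (\<integral>t. (1 - t) / (z\<^sub>0 + t)\<^sup>2 \<partial>\<mu>))"
proof -
  have "quot_expectation \<mu> (\<lambda>t. 1 - t) (\<lambda>t. t) = (\<integral>\<^sup>+t. ennreal ((1 - t) / t) * indicator {0<..} t \<partial>\<mu>)"
    if "AE t in \<mu>. t \<noteq> 0"
    unfolding quot_expectation_def
  proof (rule nn_integral_cong_AE)
    show "AE t in \<mu>. ennreal (1 - t) / ennreal t = ennreal ((1 - t) / t) * indicator {0<..} t"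
      using that AE_law_unit by eventually_elim (simp add: divide_ennreal)
  qed
  then show ?thesis using assms by (intro up_case_curved) auto
qed

end

theorem theorem3p1p1:
  fixes M :: "'w measure" and \<mu> :: "real measure"
    and p :: "nat \<Rightarrow> 'w \<Rightarrow> real" and X :: "nat \<times> nat \<Rightarrow> 'w \<Rightarrow> real"
    and b x y :: real
  assumes "bernoulli_environment M \<mu> p X"
    and "ereal b = esssup \<mu> ereal"
    and "0 < x" and "0 < y"
  shows
    "((quot_expectation \<mu> (\<lambda>t. t * (1 - t)) (\<lambda>t. (b - t)\<^sup>2) \<le> ennreal (x / y) \<longrightarrow>
        Psi_right_is M X x y (b * x + y * (1 - b) * (\<integral>t. t / (b - t) \<partial>\<mu>)))
     \<and> (quot_expectation \<mu> (\<lambda>t. t) (\<lambda>t. 1 - t) < ennreal (x / y) \<and>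
        ennreal (x / y) < quot_expectation \<mu> (\<lambda>t. t * (1 - t)) (\<lambda>t. (b - t)\<^sup>2) \<longrightarrow>
        (\<exists>z\<^sub>0\<in>{b<..<1}.
           (\<forall>z\<in>{b<..<1}. x / y = (\<integral>t. t * (1 - t) / (z - t)\<^sup>2 \<partial>\<mu>) \<longleftrightarrow> z = z\<^sub>0) \<and>
           Psi_right_is M X x y (y * z\<^sub>0\<^sup>2 * (\<integral>t. (1 - t) / (z\<^sub>0 - t)\<^sup>2 \<partial>\<mu>) - y)))
     \<and> (ennreal (x / y) \<le> quot_expectation \<mu> (\<lambda>t. t) (\<lambda>t. 1 - t) \<longrightarrow>
        Psi_right_is M X x y x))
     \<and>
     ((ennreal (x / y) < quot_expectation \<mu> (\<lambda>t. 1 - t) (\<lambda>t. t) \<and>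
        ((AE t in \<mu>. t \<noteq> 0) \<or>
         ennreal (x / y) < (\<integral>\<^sup>+t. ennreal ((1 - t) / t) * indicator {0<..} t \<partial>\<mu>)) \<longrightarrow>
        (\<exists>z\<^sub>0\<in>{0<..}.
           (\<forall>z\<in>{0<..}. x / y = (\<integral>t. t * (1 - t) / (z + t)\<^sup>2 \<partial>\<mu>) \<longleftrightarrow> z = z\<^sub>0) \<and>
           Psi_up_is M X x y (y - y * z\<^sub>0\<^sup>2 * (\<integral>t. (1 - t) / (z\<^sub>0 + t)\<^sup>2 \<partial>\<mu>))))
     \<and> (quot_expectation \<mu> (\<lambda>t. 1 - t) (\<lambda>t. t) \<le> ennreal (x / y) \<longrightarrow>
        Psi_up_is M X x y y))"
proof -
  interpret bernoulli_environment M \<mu> p X by (rule assms(1))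
  show ?thesis
    using Psi_right_flat[OF assms(2-4)] Psi_right_curved[OF assms(2-4)] Psi_right_full[OF assms(2-4)]
      Psi_up_curved[OF assms(3,4)] up_case_full[OF assms(3,4)]
    by blast
qed

end
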